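(* Let $\mathcal{G}=(V,E)$ be a graph with boundary $V_b$ of size $k\ge 2$ such that every interior vertex is connected by an edge to every boundary vertex. Let $\mathcal{G}_{int}$ be the induced subgraph on the set $V_{int}$ of interior vertices, and let $\chi$ be the chromatic polynomial of $\mathcal{G}_{int}$. Fix distinct boundary values $z_b\in\mathbb{C}$, $b\in V_b$. Then for fixed generic $q:E\to\mathbb{R}$ satisfying $\sum_{v\sim u}q_{uv}=0$ at every interior vertex $u$, the number $N_{\mathcal{G}}$ of realizations $z:V\to\mathbb{C}$ with the given boundary values, i.e. of solutions of $$\sum_{v\sim u}\frac{q_{uv}}{z_u-z_v}=0\qquad\text{for every interior vertex }u,$$ is $$N_{\mathcal{G}}=(-1)^{|V_{int}|}\,\chi(-k+2).$$
   Context: Graphs are finite and simple. A graph with boundary is a graph $\mathcal{G}=(V,E)$ with a specified set $V_b\subset V$ of boundary vertices; $V_{int}=V\setminus V_b$ is the set of interior vertices, and every edge has at least one interior endpoint. Functions $q$ are defined on unoriented edges, so $q_{uv}=q_{vu}$. A realization $z$ is required to satisfy $z_u\neq z_v$ for adjacent $u,v$, so that the equations make sense. Generic: a statement holds for generic $q$ if it holds for all $q$ in a nonempty Zariski open subset of the vector space of functions $q:E\to\mathbb{R}$ satisfying $\sum_{v\sim u}q_{uv}=0$ at all interior vertices $u$ (i.e. the $q$ are algebraically independent modulo these linear relations); the open set may depend on the graph and the fixed boundary values. *)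

theory Defs
  imports Complex_Main "HOL-Library.FuncSet" "HOL-Computational_Algebra.Polynomial"
begin

text \<open>
  Edges are two-element vertex sets, so a function on \<open>E\<close> is a function of unoriented edges
  and \<open>q\<^sub>u\<^sub>v\<close> is \<open>q {u, v}\<close>.
\<close>

locale graph_with_boundary =
  fixes V :: "'a set" and E :: "'a set set" and Vb :: "'a set"
  assumes finite_V: "finite V"
    and edge_subset: "e \<in> E \<Longrightarrow> e \<subseteq> V"
    and edge_card: "e \<in> E \<Longrightarrow> card e = 2"
    and boundary_subset: "Vb \<subseteq> V"
    and edge_interior: "e \<in> E \<Longrightarrow> \<exists>u\<in>e. u \<in> V - Vb"

definition neighbours :: "'a set set \<Rightarrow> 'a \<Rightarrow> 'a set" where
  "neighbours E u = {v. {u, v} \<in> E}"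

definition induced_edges :: "'a set set \<Rightarrow> 'a set \<Rightarrow> 'a set set" where
  "induced_edges E W = {e \<in> E. e \<subseteq> W}"

definition proper_colourings :: "'a set \<Rightarrow> 'a set set \<Rightarrow> nat \<Rightarrow> ('a \<Rightarrow> nat) set" where
  "proper_colourings W F n =
     {c \<in> W \<rightarrow>\<^sub>E {..<n}. \<forall>u\<in>W. \<forall>v\<in>W. {u, v} \<in> F \<longrightarrow> c u \<noteq> c v}"

definition chromatic_polynomial :: "'a set \<Rightarrow> 'a set set \<Rightarrow> int poly" where
  "chromatic_polynomial W F =
     (THE p. \<forall>n. poly p (int n) = int (card (proper_colourings W F n)))"

text \<open>
  The description defining the chromatic polynomial is proper for finite simple graphs.
  Existence is by inclusion-exclusion on the set \<open>D\<close> of pairs that have to be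
  coloured differently, generalised to also allow a set \<open>R\<close> of pairs that have to be
  coloured equally.
\<close>

lemma card_constrained_functions_eq_poly:
  fixes W :: "'a set"
  assumes "finite W" "finite D" "D \<subseteq> W \<times> W" "R \<subseteq> W \<times> W"
  shows "\<exists>p :: int poly. \<forall>n. poly p (int n) =
    int (card {f \<in> W \<rightarrow>\<^sub>E {..<n}. (\<forall>(x, y)\<in>R. f x = f y) \<and> (\<forall>(x, y)\<in>D. f x \<noteq> f y)})"
  using assms(2,3,4)
proof (induction D arbitrary: R rule: finite_induct)
  case empty
  define S where "S = {(x, y). x \<in> W \<and> y \<in> W \<and>
    (\<forall>f :: 'a \<Rightarrow> nat. (\<forall>(x, y)\<in>R. f x = f y) \<longrightarrow> f x = f y)}"
  have S: "equiv W S"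
    unfolding S_def by (rule equivI) (auto simp: refl_on_def sym_def trans_def)
  have RS: "R \<subseteq> S"
    using empty.prems unfolding S_def by auto
  have fin: "finite (W // S)"
    using finite_quotient[OF assms(1)] S by (auto simp: equiv_def refl_on_def S_def)
  have "card {f \<in> W \<rightarrow>\<^sub>E {..<n}. \<forall>(x, y)\<in>R. f x = f y} = n ^ card (W // S)" for n :: nat
  proof -
    let ?F = "{f \<in> W \<rightarrow>\<^sub>E {..<n}. \<forall>(x, y)\<in>R. f x = f y}"
    have cls: "S `` {x} \<in> W // S" if "x \<in> W" for x
      using that by (rule quotientI)
    have "bij_betw (\<lambda>g. \<lambda>x\<in>W. g (S `` {x})) ((W // S) \<rightarrow>\<^sub>E {..<n}) ?F"
    proof (rule bij_betw_imageI)
      show "inj_on (\<lambda>g. \<lambda>x\<in>W. g (S `` {x})) ((W // S) \<rightarrow>\<^sub>E {..<n})"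
      proof (rule inj_onI)
        fix g h assume g: "g \<in> (W // S) \<rightarrow>\<^sub>E {..<n}" and h: "h \<in> (W // S) \<rightarrow>\<^sub>E {..<n}"
          and eq: "(\<lambda>x\<in>W. g (S `` {x})) = (\<lambda>x\<in>W. h (S `` {x}))"
        show "g = h"
        proof (rule PiE_ext[OF g h])
          fix c assume "c \<in> W // S"
          then obtain x where "x \<in> W" "c = S `` {x}" by (rule quotientE)
          then show "g c = h c" using fun_cong[OF eq, of x] by simp
        qed
      qed
      show "(\<lambda>g. \<lambda>x\<in>W. g (S `` {x})) ` ((W // S) \<rightarrow>\<^sub>E {..<n}) = ?F"
      proof (intro equalityI subsetI)
        fix f assume "f \<in> (\<lambda>g. \<lambda>x\<in>W. g (S `` {x})) ` ((W // S) \<rightarrow>\<^sub>E {..<n})"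
        then obtain g where g: "g \<in> (W // S) \<rightarrow>\<^sub>E {..<n}" and f: "f = (\<lambda>x\<in>W. g (S `` {x}))"
          by blast
        have "f x = f y" if "(x, y) \<in> R" for x y
          using that RS empty.prems equiv_class_eq[OF S, of x y] unfolding f by auto
        moreover have "f \<in> W \<rightarrow>\<^sub>E {..<n}"
          using g cls unfolding f by (auto simp: PiE_iff)
        ultimately show "f \<in> ?F" by auto
      next
        fix f assume f: "f \<in> ?F"
        define g where "g = (\<lambda>c\<in>W // S. f (SOME x. x \<in> W \<and> c = S `` {x}))"
        have some: "(SOME x. x \<in> W \<and> c = S `` {x}) \<in> W \<and> c = S `` {SOME x. x \<in> W \<and> c = S `` {x}}"
          if "c \<in> W // S" for c
        proof (rule someI_ex)
          show "\<exists>x. x \<in> W \<and> c = S `` {x}" using that by (auto elim: quotientE)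
        qed
        have "g (S `` {x}) = f x" if x: "x \<in> W" for x
        proof -
          let ?y = "SOME y. y \<in> W \<and> S `` {x} = S `` {y}"
          have "?y \<in> W" "S `` {x} = S `` {?y}" using some[OF cls[OF x]] by auto
          then have "(x, ?y) \<in> S" using eq_equiv_class_iff[OF S x] by blast
          then have "f x = f ?y" using f unfolding S_def by auto
          then show ?thesis using cls[OF x] by (simp add: g_def)
        qed
        then have "f = (\<lambda>x\<in>W. g (S `` {x}))"
          using f by (auto simp: fun_eq_iff restrict_def PiE_iff extensional_def)
        moreover have "g \<in> (W // S) \<rightarrow>\<^sub>E {..<n}"
          using f some unfolding g_def by (auto simp: PiE_iff)
        ultimately show "f \<in> (\<lambda>g. \<lambda>x\<in>W. g (S `` {x})) ` ((W // S) \<rightarrow>\<^sub>E {..<n})" by blast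
      qed
    qed
    then have "card ?F = card ((W // S) \<rightarrow>\<^sub>E {..<n})" by (simp add: bij_betw_same_card)
    then show ?thesis using fin by (simp add: card_PiE)
  qed
  then show ?case
    by (intro exI[of _ "monom 1 (card (W // S))"]) (simp add: poly_monom)
next
  case (insert e D)
  obtain a b where e: "e = (a, b)" by (cases e)
  let ?A = "\<lambda>R D n. {f \<in> W \<rightarrow>\<^sub>E {..<n}. (\<forall>(x, y)\<in>R. f x = f y) \<and> (\<forall>(x, y)\<in>D. f x \<noteq> f y)}"
  obtain p :: "int poly" where p: "poly p (int n) = int (card (?A R D n))" for n
    using insert.IH[of R] insert.prems by auto
  obtain p' :: "int poly" where p': "poly p' (int n) = int (card (?A (insert e R) D n))" for n
    using insert.IH[of "insert e R"] insert.prems by auto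
  have "card (?A R D n) = card (?A R (insert e D) n) + card (?A (insert e R) D n)" for n :: nat
  proof -
    have fin: "finite (?A R D n)"
      by (rule finite_subset[of _ "W \<rightarrow>\<^sub>E {..<n}"]) (auto simp: finite_PiE assms(1))
    have eq: "?A R D n = ?A R (insert e D) n \<union> ?A (insert e R) D n" by (auto simp: e)
    have "finite (?A R (insert e D) n)" "finite (?A (insert e R) D n)"
      using fin unfolding eq by auto
    moreover have "?A R (insert e D) n \<inter> ?A (insert e R) D n = {}" by (auto simp: e)
    ultimately show ?thesis unfolding eq by (rule card_Un_disjoint)
  qed
  then show ?case using p p' by (intro exI[of _ "p - p'"]) simp
qed

lemma chromatic_polynomial_exists1:
  assumes "finite W"
  shows "\<exists>!p. \<forall>n. poly p (int n) = int (card (proper_colourings W F n))"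
proof (rule ex_ex1I)
  let ?D = "{(u, v). u \<in> W \<and> v \<in> W \<and> {u, v} \<in> F}"
  have D: "?D \<subseteq> W \<times> W" by auto
  then have "finite ?D" using assms by (simp add: finite_subset)
  moreover have "proper_colourings W F n = {f \<in> W \<rightarrow>\<^sub>E {..<n}. (\<forall>(x, y)\<in>{}. f x = f y) \<and>
      (\<forall>(x, y)\<in>?D. f x \<noteq> f y)}" for n
    by (auto simp: proper_colourings_def)
  ultimately show "\<exists>p. \<forall>n. poly p (int n) = int (card (proper_colourings W F n))"
    using card_constrained_functions_eq_poly[OF assms _ D, of "{}"] by simp
next
  fix p p' :: "int poly"
  assume p: "\<forall>n. poly p (int n) = int (card (proper_colourings W F n))"
    and p': "\<forall>n. poly p' (int n) = int (card (proper_colourings W F n))"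
  have "infinite (range int)" by (simp add: finite_image_iff)
  moreover have "range int \<subseteq> {x. poly (p - p') x = 0}" using p p' by auto
  ultimately have "infinite {x. poly (p - p') x = 0}" using finite_subset by blast
  then show "p = p'" using poly_roots_finite[of "p - p'"] by auto
qed

lemma poly_chromatic_polynomial:
  assumes "finite W"
  shows "poly (chromatic_polynomial W F) (int n) = int (card (proper_colourings W F n))"
  using theI'[OF chromatic_polynomial_exists1[OF assms, of F]]
  unfolding chromatic_polynomial_def by blast

definition balanced_weights :: "'a set \<Rightarrow> 'a set set \<Rightarrow> 'a set \<Rightarrow> ('a set \<Rightarrow> real) set" where
  "balanced_weights V E Vb =
     {q \<in> E \<rightarrow>\<^sub>E UNIV. \<forall>u\<in>V - Vb. (\<Sum>v\<in>neighbours E u. q {u, v}) = 0}"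

definition realizations ::
  "'a set \<Rightarrow> 'a set set \<Rightarrow> 'a set \<Rightarrow> ('a \<Rightarrow> complex) \<Rightarrow> ('a set \<Rightarrow> real) \<Rightarrow> ('a \<Rightarrow> complex) set" where
  "realizations V E Vb zb q =
     {z \<in> V \<rightarrow>\<^sub>E UNIV.
        (\<forall>b\<in>Vb. z b = zb b) \<and>
        (\<forall>u v. {u, v} \<in> E \<longrightarrow> z u \<noteq> z v) \<and>
        (\<forall>u\<in>V - Vb. (\<Sum>v\<in>neighbours E u. complex_of_real (q {u, v}) / (z u - z v)) = 0)}"

inductive polynomial_fun :: "'i set \<Rightarrow> (('i \<Rightarrow> real) \<Rightarrow> real) \<Rightarrow> bool" for I where
  const: "polynomial_fun I (\<lambda>x. c)"
| coord: "i \<in> I \<Longrightarrow> polynomial_fun I (\<lambda>x. x i)"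
| add: "polynomial_fun I f \<Longrightarrow> polynomial_fun I g \<Longrightarrow> polynomial_fun I (\<lambda>x. f x + g x)"
| mult: "polynomial_fun I f \<Longrightarrow> polynomial_fun I g \<Longrightarrow> polynomial_fun I (\<lambda>x. f x * g x)"

text \<open>
  Zariski topology induced on a subset \<open>X\<close> of the coordinate space \<open>I \<rightarrow>\<^sub>E UNIV\<close>: the closed
  sets are the common zero sets in \<open>X\<close> of arbitrary families of polynomials.
\<close>

definition zariski_open_in :: "'i set \<Rightarrow> ('i \<Rightarrow> real) set \<Rightarrow> ('i \<Rightarrow> real) set \<Rightarrow> bool" where
  "zariski_open_in I X U \<longleftrightarrow>
     (\<exists>P. (\<forall>p\<in>P. polynomial_fun I p) \<and> U = X - {x \<in> X. \<forall>p\<in>P. p x = 0})"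

definition holds_generically ::
  "'i set \<Rightarrow> ('i \<Rightarrow> real) set \<Rightarrow> (('i \<Rightarrow> real) \<Rightarrow> bool) \<Rightarrow> bool" where
  "holds_generically I X A \<longleftrightarrow> (\<exists>U. zariski_open_in I X U \<and> U \<noteq> {} \<and> (\<forall>x\<in>U. A x))"

end

theory Submission
  imports Defs "HOL-Analysis.Analysis" "HOL-Computational_Algebra.Fundamental_Theorem_Algebra"
begin

text \<open>
  The equations describe the critical points of the multivalued function
  \<open>\<Prod> (z\<^sub>u - z\<^sub>v) ^ q\<^sub>u\<^sub>v\<close> on the complement of the hyperplanes \<open>z\<^sub>u = z\<^sub>v\<close>. They are counted by
  deletion and contraction of edges.

  Normalisation. Put \<open>w = 1 / (z - z\<^sub>\<beta>)\<close> for one boundary vertex \<open>\<beta>\<close>. Since the weights at an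
  interior vertex \<open>u\<close> add up to zero, this multiplies the equation at \<open>u\<close> by \<open>- 1 / w\<^sub>u\<^sup>2\<close> and
  removes the edge to \<open>\<beta>\<close>, whose weight was determined by the others. What remains
  (\<open>bij_realizations\<close>) is a graph whose other \<open>k - 1\<close> boundary vertices are pinned at distinct
  nonzero points and whose weights are free; only the solutions with all \<open>w\<^sub>u \<noteq> 0\<close> count.

  Counting. Let \<open>N G\<close> be the generic number of solutions for such a pinned graph. Then
  \<open>N G = N (G - e) + N (G / e)\<close> (\<open>good_insert_edge\<close>): let the weight \<open>t\<close> of \<open>e = {u, v}\<close> tend
  to \<open>0\<close>. If vertices of a set \<open>S\<close> collide at a point \<open>p\<close>, multiply the equation at each
  \<open>x \<in> S\<close> by \<open>w\<^sub>x - p\<close> and add up: in the limit the weights inside \<open>S\<close> have sum zero.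
  Similarly, the weights of the edges meeting \<open>S\<close> have sum zero if \<open>S\<close> escapes to infinity.
  For weights without such resonances, every sequence of solutions therefore accumulates at a
  solution for \<open>G - e\<close>, or \<open>u\<close> and \<open>v\<close> alone collide and the limit solves \<open>G / e\<close> (\<open>crit_limits\<close>).
  Conversely, each of these limits is nondegenerate and belongs to exactly one branch of solutions,
  by the implicit function theorem. Near a collision it is applied in the coordinate \<open>y\<close> with
  \<open>w\<^sub>u = w\<^sub>v + t y\<close>, in which the singular term \<open>t / (w\<^sub>u - w\<^sub>v)\<close> is the smooth function \<open>1 / y\<close>
  (\<open>local_count\<close>).

  Genericity. The limit argument yields the count only for small \<open>t\<close>. But "there are exactly
  \<open>N\<close> solutions, all nondegenerate and with nonzero coordinates" is a first-order condition on the
  weights over the complex numbers. By elimination of quantifiers (\<open>constructible_ex\<close>) it is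
  constructible, so it holds on a nonempty Zariski open set or fails on one
  (\<open>good_dichotomy\<close>); one good point in every nonempty Zariski open set is enough.

  Colourings. Colourings that extend a fixed injective colouring of the pins satisfy the same
  recursion, with a sign (\<open>card_pinned_colourings\<close>). If \<open>P\<close> is the polynomial counting them and \<open>n\<close>
  the number of interior vertices, then \<open>N = (-1) ^ n * P 1\<close> (\<open>generic_count\<close>). When every interior
  vertex is joined to all \<open>k - 1\<close> pins, \<open>P\<close> at \<open>t\<close> is \<open>\<chi> (t - (k - 1))\<close>, which is
  \<open>\<chi> (2 - k)\<close> at \<open>t = 1\<close>.
\<close>

section \<open>Polynomial functions and constructible predicates\<close>

text \<open>
  Only finitely many of the coordinates occur in each such function, although the index type
  may be infinite.
\<close>

inductive mpoly_fun :: "(('i \<Rightarrow> complex) \<Rightarrow> complex) \<Rightarrow> bool" where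
  const: "mpoly_fun (\<lambda>x. c)"
| coord: "mpoly_fun (\<lambda>x. x i)"
| add: "mpoly_fun f \<Longrightarrow> mpoly_fun g \<Longrightarrow> mpoly_fun (\<lambda>x. f x + g x)"
| mult: "mpoly_fun f \<Longrightarrow> mpoly_fun g \<Longrightarrow> mpoly_fun (\<lambda>x. f x * g x)"

lemma mpoly_fun_diff: "mpoly_fun f \<Longrightarrow> mpoly_fun g \<Longrightarrow> mpoly_fun (\<lambda>x. f x - g x)"
  using mpoly_fun.add[OF _ mpoly_fun.mult[OF mpoly_fun.const[of "-1"]], of f g] by simp

lemma mpoly_fun_sum: "(\<And>j. j \<in> A \<Longrightarrow> mpoly_fun (f j)) \<Longrightarrow> mpoly_fun (\<lambda>x. \<Sum>j\<in>A. f j x)"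
  by (induction A rule: infinite_finite_induct) (auto intro: mpoly_fun.intros)

lemma mpoly_fun_prod: "(\<And>j. j \<in> A \<Longrightarrow> mpoly_fun (f j)) \<Longrightarrow> mpoly_fun (\<lambda>x. \<Prod>j\<in>A. f j x)"
  by (induction A rule: infinite_finite_induct) (auto intro: mpoly_fun.intros)

lemma mpoly_fun_power: "mpoly_fun f \<Longrightarrow> mpoly_fun (\<lambda>x. f x ^ n)"
  by (induction n) (auto intro: mpoly_fun.intros)

lemma mpoly_fun_compose:
  assumes "mpoly_fun f" "\<And>i. mpoly_fun (\<lambda>y. g y i)"
  shows "mpoly_fun (\<lambda>y. f (g y))"
  using assms(1) by induction (auto intro: mpoly_fun.intros assms(2))

lemma mpoly_fun_on_line:
  assumes "mpoly_fun f"
  shows "\<exists>p. \<forall>t. f (\<lambda>i. x i + t * d i) = poly p t"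
  using assms
proof induction
  case (const c) show ?case by (rule exI[of _ "[:c:]"]) simp
next
  case (coord i) show ?case by (rule exI[of _ "[:x i, d i:]"]) simp
next
  case (add f g)
  then obtain p r where "\<forall>t. f (\<lambda>i. x i + t * d i) = poly p t" "\<forall>t. g (\<lambda>i. x i + t * d i) = poly r t"
    by blast
  then show ?case by (intro exI[of _ "p + r"]) simp
next
  case (mult f g)
  then obtain p r where "\<forall>t. f (\<lambda>i. x i + t * d i) = poly p t" "\<forall>t. g (\<lambda>i. x i + t * d i) = poly r t"
    by blast
  then show ?case by (intro exI[of _ "p * r"]) simp
qed

lemma finite_zeros_on_line:
  assumes "mpoly_fun f" "f (\<lambda>i. x i + t0 * d i) \<noteq> 0"
  shows "finite {t. f (\<lambda>i. x i + t * d i) = 0}"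
proof -
  obtain p where p: "\<forall>t. f (\<lambda>i. x i + t * d i) = poly p t"
    using mpoly_fun_on_line[OF assms(1)] by blast
  then have "p \<noteq> 0" using assms(2) by auto
  then show ?thesis using poly_roots_finite[of p] p by simp
qed

text \<open>
  Irreducibility of affine space, seen on the line through the two given points.
\<close>

lemma common_nonzero:
  assumes "mpoly_fun f" "mpoly_fun g" "f x \<noteq> 0" "g y \<noteq> 0"
  shows "\<exists>z. f z \<noteq> 0 \<and> g z \<noteq> 0"
proof -
  let ?l = "\<lambda>t i. x i + t * (y i - x i)"
  have "finite {t. f (?l t) = 0}" by (rule finite_zeros_on_line[OF assms(1), of _ 0]) (use assms in simp)
  moreover have "finite {t. g (?l t) = 0}" by (rule finite_zeros_on_line[OF assms(2), of _ 1]) (use assms in simp)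
  ultimately have "finite ({t. f (?l t) = 0} \<union> {t. g (?l t) = 0})" by blast
  then obtain t where "t \<notin> {t. f (?l t) = 0} \<union> {t. g (?l t) = 0}"
    using ex_new_if_finite infinite_UNIV_char_0 by blast
  then show ?thesis by blast
qed

text \<open>
  Real points are Zariski dense: on the complex line through \<open>Re x\<close> in the direction \<open>Im x\<close>, the
  given point sits at the parameter \<open>\<i>\<close>, and all but finitely many real parameters will do.
\<close>

lemma real_nonzero:
  assumes "mpoly_fun f" "f x \<noteq> 0"
  shows "\<exists>r. f (\<lambda>i. complex_of_real (r i)) \<noteq> 0"
proof -
  let ?l = "\<lambda>t i. complex_of_real (Re (x i)) + t * complex_of_real (Im (x i))"
  have "?l \<i> = x" by (auto simp: complex_eq_iff)
  then have "finite {t. f (?l t) = 0}"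
    by (intro finite_zeros_on_line[OF assms(1), of _ \<i>]) (use assms(2) in metis)
  then have "finite (complex_of_real -` {t. f (?l t) = 0})"
    by (rule finite_vimageI) (auto simp: inj_def)
  then obtain t where "t \<notin> complex_of_real -` {t. f (?l t) = 0}"
    using ex_new_if_finite infinite_UNIV_char_0 by blast
  then have "f (?l (complex_of_real t)) \<noteq> 0" by simp
  then show ?thesis by (intro exI[of _ "\<lambda>i. Re (x i) + t * Im (x i)"]) simp
qed

inductive constructible :: "(('i \<Rightarrow> complex) \<Rightarrow> bool) \<Rightarrow> bool" where
  zero: "mpoly_fun f \<Longrightarrow> constructible (\<lambda>x. f x = 0)"
| neg: "constructible P \<Longrightarrow> constructible (\<lambda>x. \<not> P x)"
| conj: "constructible P \<Longrightarrow> constructible Q \<Longrightarrow> constructible (\<lambda>x. P x \<and> Q x)"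

lemma constructible_eq: "mpoly_fun f \<Longrightarrow> mpoly_fun g \<Longrightarrow> constructible (\<lambda>x. f x = g x)"
  using constructible.zero[OF mpoly_fun_diff, of f g] by simp

lemma constructible_disj:
  "constructible P \<Longrightarrow> constructible Q \<Longrightarrow> constructible (\<lambda>x. P x \<or> Q x)"
  using constructible.neg[OF constructible.conj[OF constructible.neg constructible.neg], of P Q] by simp

lemma constructible_imp:
  "constructible P \<Longrightarrow> constructible Q \<Longrightarrow> constructible (\<lambda>x. P x \<longrightarrow> Q x)"
  unfolding imp_conv_disj by (intro constructible_disj constructible.neg)

lemma constructible_const: "constructible (\<lambda>x. c)"
  using constructible.zero[OF mpoly_fun.const, of "if c then 0 else 1"] by (cases c) auto

lemma constructible_ball:
  "finite A \<Longrightarrow> (\<And>j. j \<in> A \<Longrightarrow> constructible (P j)) \<Longrightarrow> constructible (\<lambda>x. \<forall>j\<in>A. P j x)"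
  by (induction A rule: finite_induct) (auto intro: constructible_const constructible.conj)

lemma constructible_bex:
  "finite A \<Longrightarrow> (\<And>j. j \<in> A \<Longrightarrow> constructible (P j)) \<Longrightarrow> constructible (\<lambda>x. \<exists>j\<in>A. P j x)"
  by (induction A rule: finite_induct) (auto intro: constructible_const constructible_disj)

text \<open>
  This is how generic statements are proved below: to exclude the second alternative it suffices to
  exhibit, for each nonzero polynomial, a single point where the polynomial does not vanish
  and \<open>P\<close> holds.
\<close>

lemma constructible_dichotomy:
  assumes "constructible P"
  shows "\<exists>f. mpoly_fun f \<and> (\<exists>x. f x \<noteq> 0) \<and> ((\<forall>x. f x \<noteq> 0 \<longrightarrow> P x) \<or> (\<forall>x. f x \<noteq> 0 \<longrightarrow> \<not> P x))"
  using assms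
proof induction
  case (zero f)
  show ?case
  proof (cases "\<exists>x. f x \<noteq> 0")
    case True then show ?thesis using zero by blast
  next
    case False
    then show ?thesis by (intro exI[of _ "\<lambda>x. 1"]) (auto intro: mpoly_fun.const)
  qed
next
  case (neg P) then show ?case by blast
next
  case (conj P Q)
  then obtain f g where f: "mpoly_fun f" "\<exists>x. f x \<noteq> 0" "(\<forall>x. f x \<noteq> 0 \<longrightarrow> P x) \<or> (\<forall>x. f x \<noteq> 0 \<longrightarrow> \<not> P x)"
    and g: "mpoly_fun g" "\<exists>x. g x \<noteq> 0" "(\<forall>x. g x \<noteq> 0 \<longrightarrow> Q x) \<or> (\<forall>x. g x \<noteq> 0 \<longrightarrow> \<not> Q x)"
    by blast
  have "\<exists>x. f x * g x \<noteq> 0" using common_nonzero[OF f(1) g(1)] f(2) g(2) by auto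
  moreover have "mpoly_fun (\<lambda>x. f x * g x)" by (intro mpoly_fun.mult f g)
  moreover have "(\<forall>x. f x * g x \<noteq> 0 \<longrightarrow> P x \<and> Q x) \<or> (\<forall>x. f x * g x \<noteq> 0 \<longrightarrow> \<not> (P x \<and> Q x))"
    using f(3) g(3) by auto
  ultimately show ?case by (intro exI[of _ "\<lambda>x. f x * g x"]) blast
qed

section \<open>Elimination of an existential quantifier\<close>

text \<open>
  Univariate polynomials whose coefficients are polynomials in parameters. The bound \<open>d\<close> on the
  number of coefficients is uniform in the parameters and serves as the termination
  measure of the elimination, since actual degrees jump.
\<close>

definition poly_family :: "nat \<Rightarrow> (('i \<Rightarrow> complex) \<Rightarrow> complex poly) \<Rightarrow> bool" where
  "poly_family d p \<longleftrightarrow> (\<forall>k. mpoly_fun (\<lambda>x. coeff (p x) k)) \<and> (\<forall>x. \<forall>k\<ge>d. coeff (p x) k = 0)"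

lemma poly_family_coeff: "poly_family d p \<Longrightarrow> mpoly_fun (\<lambda>x. coeff (p x) k)"
  by (simp add: poly_family_def)

lemma poly_family_const: "mpoly_fun f \<Longrightarrow> poly_family 1 (\<lambda>x. [:f x:])"
  unfolding poly_family_def
proof (intro conjI allI)
  fix k assume "mpoly_fun f"
  then show "mpoly_fun (\<lambda>x. coeff [:f x:] k)" by (cases k) (auto intro: mpoly_fun.const)
qed (auto simp: coeff_pCons split: nat.split)

lemma poly_family_X: "poly_family 2 (\<lambda>x. [:0, 1:])"
  by (auto simp: poly_family_def coeff_pCons intro: mpoly_fun.const split: nat.split)

lemma poly_family_add: "poly_family d p \<Longrightarrow> poly_family e r \<Longrightarrow> poly_family (max d e) (\<lambda>x. p x + r x)"
  by (auto simp: poly_family_def intro: mpoly_fun.add)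

lemma poly_family_mult:
  assumes "poly_family d p" "poly_family e r"
  shows "poly_family (d + e) (\<lambda>x. p x * r x)"
  unfolding poly_family_def
proof (intro conjI allI impI)
  fix k show "mpoly_fun (\<lambda>x. coeff (p x * r x) k)"
    unfolding coeff_mult by (intro mpoly_fun_sum mpoly_fun.mult poly_family_coeff[OF assms(1)] poly_family_coeff[OF assms(2)])
next
  fix x :: "'a \<Rightarrow> complex" and k assume k: "d + e \<le> k"
  have "coeff (p x) i * coeff (r x) (k - i) = 0" for i
    using assms k by (cases "d \<le> i") (auto simp: poly_family_def)
  then show "coeff (p x * r x) k = 0" unfolding coeff_mult by (intro sum.neutral) auto
qed

lemma poly_family_power:
  assumes "poly_family d p" shows "\<exists>e. poly_family e (\<lambda>x. p x ^ n)"
proof (induction n)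
  case 0 show ?case using poly_family_const[OF mpoly_fun.const[of 1]] by (auto simp: one_pCons)
next
  case (Suc n) then show ?case using poly_family_mult[OF assms] by auto
qed

lemma poly_family_of_mpoly_fun:
  assumes "mpoly_fun f"
  shows "\<exists>d p. poly_family d p \<and> (\<forall>x c. f (x(i := c)) = poly (p x) c)"
  using assms
proof induction
  case (const c)
  show ?case using poly_family_const[OF mpoly_fun.const[of c]] by fastforce
next
  case (coord j)
  show ?case
  proof (cases "j = i")
    case True then show ?thesis
      by (intro exI[of _ 2] exI[of _ "\<lambda>x. [:0, 1:]"]) (simp add: poly_family_X)
  next
    case False then show ?thesis
      using poly_family_const[OF mpoly_fun.coord[of j]] by fastforce
  qed
next
  case (add f g)
  then obtain d p e r where "poly_family d p" "\<forall>x c. f (x(i := c)) = poly (p x) c"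
    "poly_family e r" "\<forall>x c. g (x(i := c)) = poly (r x) c" by blast
  then show ?case
    by (intro exI[of _ "max d e"] exI[of _ "\<lambda>x. p x + r x"]) (simp add: poly_family_add del: fun_upd_apply)
next
  case (mult f g)
  then obtain d p e r where "poly_family d p" "\<forall>x c. f (x(i := c)) = poly (p x) c"
    "poly_family e r" "\<forall>x c. g (x(i := c)) = poly (r x) c" by blast
  then show ?case
    by (intro exI[of _ "d + e"] exI[of _ "\<lambda>x. p x * r x"]) (simp add: poly_family_mult del: fun_upd_apply)
qed

lemma poly_family_truncate:
  assumes "poly_family (Suc n) p"
  shows "poly_family n (\<lambda>x. p x - monom (coeff (p x) n) n)"
  unfolding poly_family_def
proof (intro conjI allI impI)
  fix k show "mpoly_fun (\<lambda>x. coeff (p x - monom (coeff (p x) n) n) k)"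
    using poly_family_coeff[OF assms] by (cases "k = n") (auto intro: mpoly_fun.const)
next
  fix x k assume "n \<le> k"
  then show "coeff (p x - monom (coeff (p x) n) n) k = 0"
    using assms by (cases "k = n") (auto simp: poly_family_def)
qed

text \<open>
  One step of pseudo-division; the leading terms cancel without inverting the coefficient of \<open>p\<close>.
\<close>

lemma poly_family_reduce:
  assumes p: "poly_family (Suc n) p" and r: "poly_family (Suc m) r" and "n \<le> m"
  shows "poly_family m (\<lambda>x. smult (coeff (p x) n) (r x) - monom (coeff (r x) m) (m - n) * p x)"
    (is "poly_family m ?s")
proof -
  have c: "coeff (?s x) k = coeff (p x) n * coeff (r x) k -
      (if m - n \<le> k then coeff (r x) m * coeff (p x) (k - (m - n)) else 0)" for x k
    by (simp add: coeff_monom_mult)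
  show ?thesis
    unfolding poly_family_def
  proof (intro conjI allI impI)
    fix k show "mpoly_fun (\<lambda>x. coeff (?s x) k)"
      unfolding c using poly_family_coeff[OF p] poly_family_coeff[OF r]
      by (cases "m - n \<le> k") (auto intro!: mpoly_fun_diff mpoly_fun.intros)
  next
    fix x k assume "m \<le> k"
    then consider "k = m" | "k > m" by linarith
    then show "coeff (?s x) k = 0"
    proof cases
      case 1 then show ?thesis unfolding c using assms(3) by simp
    next
      case 2
      then have "coeff (r x) k = 0" "coeff (p x) (k - (m - n)) = 0"
        using p r assms(3) by (auto simp: poly_family_def)
      then show ?thesis unfolding c by simp
    qed
  qed
qed

lemma constructible_poly_nonzero:
  assumes "poly_family d p" shows "constructible (\<lambda>x. p x \<noteq> 0)"
proof -
  have "p x \<noteq> 0 \<longleftrightarrow> (\<exists>k\<in>{..<d}. \<not> coeff (p x) k = 0)" for x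
  proof -
    have "coeff (p x) k = 0" if "\<not> k < d" for k
      using assms that by (simp add: poly_family_def)
    then show ?thesis by (auto simp: poly_eq_iff)
  qed
  moreover have "constructible (\<lambda>x. \<exists>k\<in>{..<d}. \<not> coeff (p x) k = 0)"
    by (intro constructible_bex constructible.neg constructible.zero poly_family_coeff[OF assms]) auto
  ultimately show ?thesis by presburger
qed

lemma constructible_dvd:
  assumes p: "poly_family (Suc n) p" and "poly_family m r"
  shows "constructible (\<lambda>x. coeff (p x) n \<noteq> 0 \<and> p x dvd r x)"
  using assms(2)
proof (induction m arbitrary: r)
  case 0
  then have "r x = 0" for x by (auto simp: poly_family_def poly_eq_iff)
  moreover have "constructible (\<lambda>x. coeff (p x) n \<noteq> 0)"
    by (intro constructible.neg constructible.zero poly_family_coeff[OF p])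
  ultimately show ?case by simp
next
  case (Suc m)
  show ?case
  proof (cases "n \<le> m")
    case True
    let ?s = "\<lambda>x. smult (coeff (p x) n) (r x) - monom (coeff (r x) m) (m - n) * p x"
    have red: "p x dvd r x \<longleftrightarrow> p x dvd ?s x" if "coeff (p x) n \<noteq> 0" for x
    proof -
      have "p x dvd r x \<longleftrightarrow> p x dvd smult (coeff (p x) n) (r x)"
        using that by (simp add: dvd_smult_iff)
      also have "\<dots> \<longleftrightarrow> p x dvd ?s x"
        by (metis (no_types, lifting) diff_add_cancel dvd_add_left_iff dvd_triv_right)
      finally show ?thesis .
    qed
    have "(\<lambda>x. coeff (p x) n \<noteq> 0 \<and> p x dvd r x) = (\<lambda>x. coeff (p x) n \<noteq> 0 \<and> p x dvd ?s x)"
      by (intro ext conj_cong refl red)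
    then show ?thesis using Suc.IH[OF poly_family_reduce[OF p Suc.prems True]] by simp
  next
    case False
    have "p x dvd r x \<longleftrightarrow> r x = 0" if "coeff (p x) n \<noteq> 0" for x
    proof
      assume d: "p x dvd r x"
      have "degree (p x) \<ge> n" using that by (rule le_degree)
      moreover have "degree (r x) < n" if "r x \<noteq> 0"
        using Suc.prems False that unfolding poly_family_def
        by (metis leading_coeff_0_iff leI le_trans not_less_eq_eq)
      ultimately show "r x = 0" using d dvd_imp_degree_le by fastforce
    qed simp
    then have "(\<lambda>x. coeff (p x) n \<noteq> 0 \<and> p x dvd r x) = (\<lambda>x. coeff (p x) n \<noteq> 0 \<and> \<not> r x \<noteq> 0)"
      by (intro ext conj_cong refl) simp
    moreover have "constructible (\<lambda>x. coeff (p x) n \<noteq> 0 \<and> \<not> r x \<noteq> 0)"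
      by (intro constructible.conj constructible.neg[OF constructible_poly_nonzero] 
          constructible.neg[OF constructible.zero] poly_family_coeff[OF p]) fact
    ultimately show ?thesis by simp
  qed
qed

text \<open>
  If \<open>p x\<close> really has degree \<open>n\<close>, then every root of \<open>p x\<close> is a root of \<open>r x\<close> iff \<open>p x\<close> divides the
  \<open>n\<close>-th power of \<open>r x\<close>, and divisibility is decided by pseudo-division. If the coefficient
  of index \<open>n\<close> vanishes, it is dropped.
\<close>

lemma constructible_ex_root1:
  assumes "poly_family n p" "poly_family m r"
  shows "constructible (\<lambda>x. \<exists>c. poly (p x) c = 0 \<and> poly (r x) c \<noteq> 0)"
  using assms(1)
proof (induction n arbitrary: p)
  case 0
  then have p: "p x = 0" for x by (auto simp: poly_family_def poly_eq_iff)
  have "(\<exists>c. poly (r x) c \<noteq> 0) \<longleftrightarrow> r x \<noteq> 0" for x using poly_all_0_iff_0 by blast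
  then show ?case using constructible_poly_nonzero[OF assms(2)] by (simp add: p)
next
  case (Suc n)
  let ?p' = "\<lambda>x. p x - monom (coeff (p x) n) n"
  obtain e where e: "poly_family e (\<lambda>x. r x ^ n)" using poly_family_power[OF assms(2)] by blast
  have "(\<exists>c. poly (p x) c = 0 \<and> poly (r x) c \<noteq> 0) \<longleftrightarrow>
      (coeff (p x) n = 0 \<and> (\<exists>c. poly (?p' x) c = 0 \<and> poly (r x) c \<noteq> 0)) \<or>
      (coeff (p x) n \<noteq> 0 \<and> \<not> (coeff (p x) n \<noteq> 0 \<and> p x dvd r x ^ n))" for x
  proof (cases "coeff (p x) n = 0")
    case True then show ?thesis by simp
  next
    case False
    then have "degree (p x) = n"
      using Suc.prems by (intro antisym degree_le le_degree) (auto simp: poly_family_def)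
    then show ?thesis using False nullstellensatz_univariate[of "p x" "r x"] by auto
  qed
  moreover have "constructible \<dots>"
    by (intro constructible_disj constructible.conj constructible.neg[OF constructible.zero] constructible.zero
        poly_family_coeff[OF Suc.prems] Suc.IH poly_family_truncate[OF Suc.prems]
        constructible.neg[OF constructible_dvd[OF Suc.prems e]])
  ultimately show ?case by presburger
qed

text \<open>
  Euclid's algorithm: two equations are replaced by one of them and a pseudo-remainder, until at
  most one is left.
\<close>

lemma constructible_ex_roots:
  assumes "list_all2 poly_family ds ps" "poly_family m r"
  shows "constructible (\<lambda>x. \<exists>c. (\<forall>p\<in>set ps. poly (p x) c = 0) \<and> poly (r x) c \<noteq> 0)"
  using assms(1)
proof (induction "sum_list ds + length ds" arbitrary: ds ps rule: less_induct)
  case less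
  consider "ps = []" | p where "ps = [p]" | p1 p2 ps' where "ps = p1 # p2 # ps'"
    by (metis list.exhaust)
  then show ?case
  proof cases
    case 1
    have "poly_family 1 (\<lambda>x. [:0:])" by (rule poly_family_const[OF mpoly_fun.const])
    then show ?thesis using constructible_ex_root1[OF _ assms(2)] 1 by fastforce
  next
    case 2
    then show ?thesis using constructible_ex_root1[OF _ assms(2)] less.prems
      by (auto simp: list_all2_Cons2)
  next
    case 3
    then obtain d1 d2 ds' where d: "ds = d1 # d2 # ds'" "poly_family d1 p1" "poly_family d2 p2"
        "list_all2 poly_family ds' ps'"
      using less.prems by (auto simp: list_all2_Cons2)
    have key: "constructible (\<lambda>x. \<exists>c. (\<forall>p\<in>set (p # p' # ps'). poly (p x) c = 0) \<and> poly (r x) c \<noteq> 0)"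
      if pf: "poly_family a p" "poly_family b p'" and ab: "a \<le> b" "a + b = d1 + d2" for a b p p'
    proof (cases a)
      case 0
      then have "p x = 0" for x using pf(1) by (auto simp: poly_family_def poly_eq_iff)
      moreover have "constructible (\<lambda>x. \<exists>c. (\<forall>p\<in>set (p' # ps'). poly (p x) c = 0) \<and> poly (r x) c \<noteq> 0)"
        using less.hyps[of "b # ds'" "p' # ps'"] pf d 0 ab by simp
      ultimately show ?thesis by simp
    next
      case (Suc n)
      then obtain l where l: "b = Suc l" using ab by (cases b) auto
      have nl: "n \<le> l" using Suc l ab by simp
      let ?p' = "\<lambda>x. p x - monom (coeff (p x) n) n"
      let ?s = "\<lambda>x. smult (coeff (p x) n) (p' x) - monom (coeff (p' x) l) (l - n) * p x"
      let ?E = "\<lambda>ps x. \<exists>c. (\<forall>p\<in>set ps. poly (p x) c = 0) \<and> poly (r x) c \<noteq> 0"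
      note pf' = pf[unfolded Suc l]
      have "?E (p # p' # ps') x \<longleftrightarrow> (coeff (p x) n = 0 \<and> ?E (?p' # p' # ps') x) \<or>
          (coeff (p x) n \<noteq> 0 \<and> ?E (p # ?s # ps') x)" for x
        by (cases "coeff (p x) n = 0") (auto simp: poly_monom)
      moreover have "constructible \<dots>"
      proof (intro constructible_disj constructible.conj constructible.neg[OF constructible.zero]
          constructible.zero poly_family_coeff[OF pf'(1)])
        show "constructible (?E (?p' # p' # ps'))"
          by (rule less.hyps[of "n # b # ds'"])
            (use d ab Suc poly_family_truncate[OF pf'(1)] pf in auto)
        show "constructible (?E (p # ?s # ps'))"
          by (rule less.hyps[of "a # l # ds'"])
            (use d ab Suc l poly_family_reduce[OF pf' nl] pf in auto)
      qed
      ultimately show ?thesis by presburger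
    qed
    show ?thesis
    proof (cases "d1 \<le> d2")
      case True then show ?thesis using key[of d1 p1 d2 p2] d 3 by simp
    next
      case False 
      have "set (p2 # p1 # ps') = set ps" using 3 by auto
      then show ?thesis using False key[of d2 p2 d1 p1] d by simp
    qed
  qed
qed

text \<open>
  A disjunctive normal form in the coordinate \<open>i\<close>. One inequation per disjunct is enough, because a
  conjunction of inequations is an inequation for the product.
\<close>

definition dnf_in :: "'i \<Rightarrow> (('i \<Rightarrow> complex) \<Rightarrow> bool) \<Rightarrow> bool" where
  "dnf_in i P \<longleftrightarrow> (\<exists>L. (\<forall>(ps, r)\<in>set L. (\<exists>ds. list_all2 poly_family ds ps) \<and> (\<exists>m. poly_family m r)) \<and>
     (\<forall>x c. P (x(i := c)) \<longleftrightarrow>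
        (\<exists>(ps, r)\<in>set L. (\<forall>p\<in>set ps. poly (p x) c = 0) \<and> poly (r x) c \<noteq> 0)))"

lemma dnf_in_disj:
  assumes "dnf_in i P" "dnf_in i Q" shows "dnf_in i (\<lambda>x. P x \<or> Q x)"
proof -
  obtain L M where "\<forall>(ps, r)\<in>set L. (\<exists>ds. list_all2 poly_family ds ps) \<and> (\<exists>m. poly_family m r)"
    "\<forall>(ps, r)\<in>set M. (\<exists>ds. list_all2 poly_family ds ps) \<and> (\<exists>m. poly_family m r)"
    and "\<forall>x c. P (x(i := c)) \<longleftrightarrow> (\<exists>(ps, r)\<in>set L. (\<forall>p\<in>set ps. poly (p x) c = 0) \<and> poly (r x) c \<noteq> 0)"
    "\<forall>x c. Q (x(i := c)) \<longleftrightarrow> (\<exists>(ps, r)\<in>set M. (\<forall>p\<in>set ps. poly (p x) c = 0) \<and> poly (r x) c \<noteq> 0)"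
    using assms unfolding dnf_in_def by blast
  then show ?thesis unfolding dnf_in_def
    by (intro exI[of _ "L @ M"]) (auto simp: case_prod_unfold)
qed

lemma dnf_in_conj:
  assumes "dnf_in i P" "dnf_in i Q" shows "dnf_in i (\<lambda>x. P x \<and> Q x)"
proof -
  obtain L M where L: "\<forall>(ps, r)\<in>set L. (\<exists>ds. list_all2 poly_family ds ps) \<and> (\<exists>m. poly_family m r)"
    and M: "\<forall>(ps, r)\<in>set M. (\<exists>ds. list_all2 poly_family ds ps) \<and> (\<exists>m. poly_family m r)"
    and P: "\<forall>x c. P (x(i := c)) \<longleftrightarrow> (\<exists>(ps, r)\<in>set L. (\<forall>p\<in>set ps. poly (p x) c = 0) \<and> poly (r x) c \<noteq> 0)"
    and Q: "\<forall>x c. Q (x(i := c)) \<longleftrightarrow> (\<exists>(ps, r)\<in>set M. (\<forall>p\<in>set ps. poly (p x) c = 0) \<and> poly (r x) c \<noteq> 0)"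
    using assms unfolding dnf_in_def by blast
  let ?N = "[(fst a @ fst b, \<lambda>x. snd a x * snd b x). a \<leftarrow> L, b \<leftarrow> M]"
  have "(\<exists>ds. list_all2 poly_family ds (fst a @ fst b)) \<and> (\<exists>m. poly_family m (\<lambda>x. snd a x * snd b x))"
    if a: "a \<in> set L" and b: "b \<in> set M" for a b
  proof -
    obtain ds es m n where "list_all2 poly_family ds (fst a)" "list_all2 poly_family es (fst b)"
      "poly_family m (snd a)" "poly_family n (snd b)"
      using L[rule_format, OF a] M[rule_format, OF b] by (auto simp: case_prod_unfold)
    then show ?thesis
      by (intro conjI exI) (rule list_all2_appendI poly_family_mult; assumption)+
  qed
  then have "\<forall>(ps, r)\<in>set ?N. (\<exists>ds. list_all2 poly_family ds ps) \<and> (\<exists>m. poly_family m r)"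
    by auto
  moreover have "P (x(i := c)) \<and> Q (x(i := c)) \<longleftrightarrow>
     (\<exists>(ps, r)\<in>set ?N. (\<forall>p\<in>set ps. poly (p x) c = 0) \<and> poly (r x) c \<noteq> 0)" for x c
    unfolding P[rule_format] Q[rule_format]
    by (simp add: case_prod_unfold ball_Un) blast
  ultimately show ?thesis unfolding dnf_in_def by (intro exI[of _ ?N] conjI allI)
qed

lemma dnf_in_constructible:
  assumes "constructible P"
  shows "dnf_in i P \<and> dnf_in i (\<lambda>x. \<not> P x)"
  using assms
proof induction
  case (zero f)
  obtain d p where p: "poly_family d p" "\<forall>x c. f (x(i := c)) = poly (p x) c"
    using poly_family_of_mpoly_fun[OF zero] by blast
  have one: "poly_family 1 (\<lambda>x. [:1:])" by (rule poly_family_const[OF mpoly_fun.const])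
  have "dnf_in i (\<lambda>x. f x = 0)" unfolding dnf_in_def
    by (rule exI[of _ "[([p], \<lambda>x. [:1:])]"]) (use p one in \<open>auto simp: list_all2_Cons2\<close>)
  moreover have "dnf_in i (\<lambda>x. \<not> f x = 0)" unfolding dnf_in_def
    by (rule exI[of _ "[([], p)]"]) (use p in auto)
  ultimately show ?case by blast
next
  case (neg P) then show ?case by simp
next
  case (conj P Q)
  then show ?case using dnf_in_conj dnf_in_disj[of i "\<lambda>x. \<not> P x" "\<lambda>x. \<not> Q x"] by auto
qed

text \<open>
  Chevalley's theorem for the projection along one coordinate.
\<close>

theorem constructible_ex:
  assumes "constructible P"
  shows "constructible (\<lambda>x. \<exists>c. P (x(i := c)))"
proof -
  obtain L where L: "\<forall>(ps, r)\<in>set L. (\<exists>ds. list_all2 poly_family ds ps) \<and> (\<exists>m. poly_family m r)"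
    and P: "\<forall>x c. P (x(i := c)) \<longleftrightarrow>
        (\<exists>(ps, r)\<in>set L. (\<forall>p\<in>set ps. poly (p x) c = 0) \<and> poly (r x) c \<noteq> 0)"
    using dnf_in_constructible[OF assms, of i, THEN conjunct1] unfolding dnf_in_def by (elim exE conjE)
  have "(\<exists>c. P (x(i := c))) \<longleftrightarrow>
     (\<exists>l\<in>set L. \<exists>c. (\<forall>p\<in>set (fst l). poly (p x) c = 0) \<and> poly (snd l x) c \<noteq> 0)" for x
    unfolding P[rule_format] by (auto simp: case_prod_unfold)
  moreover have "constructible \<dots>"
  proof (intro constructible_bex)
    fix l assume "l \<in> set L"
    then have "\<exists>ds. list_all2 poly_family ds (fst l)" "\<exists>m. poly_family m (snd l)"
      using L[rule_format, of l] by (auto simp: case_prod_unfold)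
    then show "constructible (\<lambda>x. \<exists>c. (\<forall>p\<in>set (fst l). poly (p x) c = 0) \<and> poly (snd l x) c \<noteq> 0)"
      using constructible_ex_roots by blast
  qed auto
  ultimately show ?thesis by presburger
qed

lemma constructible_ex_many:
  assumes "constructible P" "finite J"
  shows "constructible (\<lambda>x. \<exists>y. P (\<lambda>i. if i \<in> J then y i else x i))"
  using assms(2)
proof (induction J rule: finite_induct)
  case empty then show ?case using assms(1) by simp
next
  case (insert j J)
  have "(\<exists>y. P (\<lambda>i. if i \<in> insert j J then y i else x i)) \<longleftrightarrow>
     (\<exists>c y. P (\<lambda>i. if i \<in> J then y i else (x(j := c)) i))" for x
  proof
    assume "\<exists>y. P (\<lambda>i. if i \<in> insert j J then y i else x i)"
    then obtain y where "P (\<lambda>i. if i \<in> insert j J then y i else x i)" by blast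
    moreover have "(\<lambda>i. if i \<in> insert j J then y i else x i) = (\<lambda>i. if i \<in> J then y i else (x(j := y j)) i)"
      by auto
    ultimately show "\<exists>c y. P (\<lambda>i. if i \<in> J then y i else (x(j := c)) i)" by metis
  next
    assume "\<exists>c y. P (\<lambda>i. if i \<in> J then y i else (x(j := c)) i)"
    then obtain c y where "P (\<lambda>i. if i \<in> J then y i else (x(j := c)) i)" by blast
    moreover have "(\<lambda>i. if i \<in> J then y i else (x(j := c)) i) = 
       (\<lambda>i. if i \<in> insert j J then (y(j := c)) i else x i)" using insert.hyps by auto
    ultimately show "\<exists>y. P (\<lambda>i. if i \<in> insert j J then y i else x i)" by metis
  qed
  then show ?case using constructible_ex[OF insert.IH, of j] by presburger
qed

section \<open>Square linear systems\<close>

text \<open>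
  Gaussian elimination, by induction on the number of columns: if the column \<open>c\<close> has a pivot in
  the row \<open>u0\<close>, a solution of the reduced system on the other rows and columns extends uniquely.
\<close>

lemma square_system_solvable:
  fixes M :: "'a \<Rightarrow> 'b \<Rightarrow> complex"
  assumes "finite C" "finite R" "card R = card C"
    and "\<And>h. (\<forall>u\<in>R. (\<Sum>v\<in>C. M u v * h v) = 0) \<Longrightarrow> \<forall>v\<in>C. h v = 0"
  shows "\<exists>h. \<forall>u\<in>R. (\<Sum>v\<in>C. M u v * h v) = r u"
  using assms
proof (induction C arbitrary: R M r rule: finite_induct)
  case empty then show ?case by auto
next
  case (insert c C)
  have split: "(\<Sum>v\<in>insert c C. N v * h v) = N c * h c + (\<Sum>v\<in>C. N v * h v)" for N h :: "'b \<Rightarrow> complex"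
    using insert.hyps by simp
  have "\<exists>u0\<in>R. M u0 c \<noteq> 0"
  proof (rule ccontr)
    assume a: "\<not> (\<exists>u0\<in>R. M u0 c \<noteq> 0)"
    have "\<forall>u\<in>R. (\<Sum>v\<in>insert c C. M u v * (if v = c then 1 else 0)) = 0"
      unfolding split using a insert.hyps by (auto intro!: sum.neutral)
    then have "\<forall>v\<in>insert c C. (if v = c then 1 else 0 :: complex) = 0" by (rule insert.prems(3))
    then show False by simp
  qed
  then obtain u0 where u0: "u0 \<in> R" "M u0 c \<noteq> 0" by blast
  define N where "N = (\<lambda>u v. M u v - M u c / M u0 c * M u0 v)"
  define ext where "ext = (\<lambda>h s v. if v = c then (s - (\<Sum>v\<in>C. M u0 v * h v)) / M u0 c else h v)"
  have ext0: "(\<Sum>v\<in>insert c C. M u0 v * ext h s v) = s" for h s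
  proof -
    have "(\<Sum>v\<in>C. M u0 v * ext h s v) = (\<Sum>v\<in>C. M u0 v * h v)"
      using insert.hyps by (intro sum.cong) (auto simp: ext_def)
    then show ?thesis unfolding split using u0(2) by (simp add: ext_def)
  qed
  have ext1: "(\<Sum>v\<in>insert c C. M u v * ext h s v) = (\<Sum>v\<in>C. N u v * h v) + M u c / M u0 c * s" for h s u
  proof -
    have "(\<Sum>v\<in>C. M u v * ext h s v) = (\<Sum>v\<in>C. M u v * h v)"
      using insert.hyps by (intro sum.cong) (auto simp: ext_def)
    moreover have "(\<Sum>v\<in>C. N u v * h v) = (\<Sum>v\<in>C. M u v * h v) - M u c / M u0 c * (\<Sum>v\<in>C. M u0 v * h v)"
      by (simp add: N_def left_diff_distrib sum_subtractf sum_distrib_left mult.assoc)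
    ultimately show ?thesis unfolding split using u0(2) by (simp add: ext_def field_simps)
  qed
  have "\<exists>h. \<forall>u\<in>R - {u0}. (\<Sum>v\<in>C. N u v * h v) = r u - M u c / M u0 c * r u0"
  proof (rule insert.IH)
    show "finite (R - {u0})" "card (R - {u0}) = card C" using insert u0 by auto
    fix h assume h: "\<forall>u\<in>R - {u0}. (\<Sum>v\<in>C. N u v * h v) = 0"
    have "\<forall>v\<in>insert c C. ext h 0 v = 0"
    proof (rule insert.prems(3), rule ballI)
      fix u assume "u \<in> R"
      then show "(\<Sum>v\<in>insert c C. M u v * ext h 0 v) = 0"
        using h ext0[of h 0] ext1[of u h 0] by (cases "u = u0") auto
    qed
    then show "\<forall>v\<in>C. h v = 0" using insert.hyps by (auto simp: ext_def split: if_splits)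
  qed
  then obtain h where h: "\<forall>u\<in>R - {u0}. (\<Sum>v\<in>C. N u v * h v) = r u - M u c / M u0 c * r u0" by blast
  have "\<forall>u\<in>R. (\<Sum>v\<in>insert c C. M u v * ext h (r u0) v) = r u"
  proof
    fix u assume "u \<in> R"
    then show "(\<Sum>v\<in>insert c C. M u v * ext h (r u0) v) = r u"
      using h ext0[of h "r u0"] ext1[of u h "r u0"] by (cases "u = u0") auto
  qed
  then show ?case by blast
qed

lemma inverse_matrix_exists:
  fixes M :: "'a \<Rightarrow> 'a \<Rightarrow> complex"
  assumes "finite U"
    and inj: "\<And>h. (\<forall>u\<in>U. (\<Sum>v\<in>U. M u v * h v) = 0) \<Longrightarrow> \<forall>v\<in>U. h v = 0"
  shows "\<exists>K. (\<forall>r. \<forall>u\<in>U. (\<Sum>v\<in>U. M u v * (\<Sum>w\<in>U. K v w * r w)) = r u) \<and>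
             (\<forall>h. \<forall>u\<in>U. (\<Sum>v\<in>U. K u v * (\<Sum>w\<in>U. M v w * h w)) = h u)"
proof -
  have "\<exists>k. \<forall>u\<in>U. (\<Sum>v\<in>U. M u v * k v) = (if u = w then 1 else 0)" for w
    by (rule square_system_solvable[OF assms(1) assms(1) refl]) (fact inj)
  then obtain k where k: "\<And>w u. u \<in> U \<Longrightarrow> (\<Sum>v\<in>U. M u v * k w v) = (if u = w then 1 else 0)" by metis
  have R: "(\<Sum>v\<in>U. M u v * (\<Sum>w\<in>U. k w v * r w)) = r u" if "u \<in> U" for r u
  proof -
    have "(\<Sum>v\<in>U. M u v * (\<Sum>w\<in>U. k w v * r w)) = (\<Sum>w\<in>U. (\<Sum>v\<in>U. M u v * k w v) * r w)"
      unfolding sum_distrib_left sum_distrib_right by (subst sum.swap) (simp add: mult.assoc)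
    also have "\<dots> = (\<Sum>w\<in>U. (if w = u then r w else 0))" using that k by (intro sum.cong) auto
    also have "\<dots> = r u" using that assms(1) by simp
    finally show ?thesis .
  qed
  have "(\<Sum>v\<in>U. k v u * (\<Sum>w\<in>U. M v w * h w)) = h u" if "u \<in> U" for h u
  proof -
    let ?g = "\<lambda>u. (\<Sum>v\<in>U. k v u * (\<Sum>w\<in>U. M v w * h w)) - h u"
    have "\<forall>u\<in>U. (\<Sum>v\<in>U. M u v * ?g v) = 0"
      using R[of _ "\<lambda>v. \<Sum>w\<in>U. M v w * h w"] by (simp add: right_diff_distrib sum_subtractf)
    then have "\<forall>v\<in>U. ?g v = 0" by (rule inj)
    then show ?thesis using that by simp
  qed
  then show ?thesis using R by (intro exI[of _ "\<lambda>v w. k w v"]) blast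
qed

section \<open>Strict differentiability and the implicit function theorem\<close>

text \<open>
  Points are functions on an arbitrary type of which only the finitely many coordinates in \<open>U\<close>
  vary. This keeps the number of unknowns a plain number, so that it can change in an induction.
\<close>

definition l1 :: "'a set \<Rightarrow> ('a \<Rightarrow> complex) \<Rightarrow> real" where
  "l1 U h = (\<Sum>u\<in>U. cmod (h u))"

lemma l1_nonneg [simp]: "0 \<le> l1 U h"
  by (simp add: l1_def sum_nonneg)

lemma l1_triangle: "l1 U (\<lambda>x. f x + g x) \<le> l1 U f + l1 U g"
  unfolding l1_def sum.distrib[symmetric] by (intro sum_mono norm_triangle_ineq)

lemma l1_triangle_diff: "l1 U (\<lambda>x. f x - h x) \<le> l1 U (\<lambda>x. f x - g x) + l1 U (\<lambda>x. g x - h x)"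
  using l1_triangle[of U "\<lambda>x. f x - g x" "\<lambda>x. g x - h x"] by simp

lemma l1_scale: "l1 U (\<lambda>x. c * f x) = cmod c * l1 U f"
  by (simp add: l1_def norm_mult sum_distrib_left)

lemma l1_commute: "l1 U (\<lambda>x. f x - g x) = l1 U (\<lambda>x. g x - f x)"
  by (simp add: l1_def norm_minus_commute)

lemma l1_eq_0_iff: "finite U \<Longrightarrow> l1 U h = 0 \<longleftrightarrow> (\<forall>u\<in>U. h u = 0)"
  by (simp add: l1_def sum_nonneg_eq_0_iff)

lemma norm_le_l1: "finite U \<Longrightarrow> u \<in> U \<Longrightarrow> cmod (h u) \<le> l1 U h"
  unfolding l1_def by (rule member_le_sum) auto

lemma l1_cong: "(\<And>u. u \<in> U \<Longrightarrow> f u = g u) \<Longrightarrow> l1 U f = l1 U g"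
  unfolding l1_def by (rule sum.cong) auto

definition lin :: "(('a \<Rightarrow> complex) \<Rightarrow> complex) \<Rightarrow> bool" where
  "lin L \<longleftrightarrow> (\<forall>f g. L (\<lambda>x. f x + g x) = L f + L g) \<and> (\<forall>c f. L (\<lambda>x. c * f x) = c * L f)"

lemma lin_add: "lin L \<Longrightarrow> L (\<lambda>x. f x + g x) = L f + L g"
  and lin_scale: "lin L \<Longrightarrow> L (\<lambda>x. c * f x) = c * L f"
  by (auto simp: lin_def)

lemma lin_0: "lin L \<Longrightarrow> L (\<lambda>x. 0) = 0"
  using lin_scale[of L 0 "\<lambda>x. 0"] by simp

lemma lin_expand:
  assumes "lin L" "finite U" "\<forall>x. x \<notin> U \<longrightarrow> h x = 0"
  shows "L h = (\<Sum>v\<in>U. L (\<lambda>x. if x = v then 1 else 0) * h v)"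
proof -
  have "L (\<lambda>x. \<Sum>v\<in>W. h v * (if x = v then 1 else 0)) = (\<Sum>v\<in>W. h v * L (\<lambda>x. if x = v then 1 else 0))"
    if "finite W" for W
    using that
  proof (induction W rule: finite_induct)
    case empty show ?case using lin_0[OF assms(1)] by simp
  next
    case (insert v W)
    then show ?case
      using lin_add[OF assms(1), of "\<lambda>x. h v * (if x = v then 1 else 0)"]
        lin_scale[OF assms(1), of "h v" "\<lambda>x. if x = v then 1 else 0"] by simp
  qed
  moreover have "h = (\<lambda>x. \<Sum>v\<in>U. h v * (if x = v then 1 else 0))"
  proof
    fix x
    have "(\<Sum>v\<in>U. h v * (if x = v then 1 else 0)) = (\<Sum>v\<in>U. if v = x then h v else 0)"
      by (intro sum.cong) auto
    then show "h x = (\<Sum>v\<in>U. h v * (if x = v then 1 else 0))" using assms(2,3) by simp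
  qed
  ultimately show ?thesis using assms(2) by (metis (no_types, lifting) mult.commute sum.cong)
qed

lemma lin_bounded:
  assumes "lin L" "finite U"
  shows "\<exists>C>0. \<forall>h. (\<forall>x. x \<notin> U \<longrightarrow> h x = 0) \<longrightarrow> cmod (L h) \<le> C * l1 U h"
proof -
  let ?C = "(\<Sum>v\<in>U. cmod (L (\<lambda>x. if x = v then 1 else 0))) + 1"
  have "cmod (L h) \<le> ?C * l1 U h" if h: "\<forall>x. x \<notin> U \<longrightarrow> h x = 0" for h
  proof -
    have "cmod (L h) \<le> (\<Sum>v\<in>U. cmod (L (\<lambda>x. if x = v then 1 else 0) * h v))"
      unfolding lin_expand[OF assms h] by (rule norm_sum)
    also have "\<dots> \<le> (\<Sum>v\<in>U. cmod (L (\<lambda>x. if x = v then 1 else 0)) * l1 U h)"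
      by (intro sum_mono) (simp add: norm_mult mult_left_mono norm_le_l1 assms(2))
    also have "\<dots> \<le> ?C * l1 U h"
      unfolding sum_distrib_right[symmetric] by (intro mult_right_mono) auto
    finally show ?thesis .
  qed
  moreover have "?C > 0" by (simp add: add_nonneg_pos sum_nonneg)
  ultimately show ?thesis by blast
qed

definition nball :: "'a set \<Rightarrow> ('a \<Rightarrow> complex) \<Rightarrow> real \<Rightarrow> ('a \<Rightarrow> complex) set" where
  "nball U x0 r = {x. (\<forall>u. u \<notin> U \<longrightarrow> x u = x0 u) \<and> l1 U (\<lambda>u. x u - x0 u) < r}"

lemma nball_mono: "r \<le> s \<Longrightarrow> nball U x0 r \<subseteq> nball U x0 s"
  by (auto simp: nball_def)

lemma centre_in_nball [simp]: "x0 \<in> nball U x0 r \<longleftrightarrow> 0 < r"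
  by (simp add: nball_def l1_def)

text \<open>
  \<open>L\<close> is a strict derivative at \<open>(x0, 0)\<close> in the variables \<open>x\<close>, uniformly in the parameter \<open>t\<close>.
  Differences at two points near \<open>x0\<close> are controlled, which is what both the contraction
  principle and the uniqueness of solutions need; in \<open>t\<close> only continuity is required.
\<close>

definition strict_deriv ::
  "'a set \<Rightarrow> ('a \<Rightarrow> complex) \<Rightarrow> (('a \<Rightarrow> complex) \<Rightarrow> complex \<Rightarrow> complex) \<Rightarrow> (('a \<Rightarrow> complex) \<Rightarrow> complex) \<Rightarrow> bool"
where
  "strict_deriv U x0 f L \<longleftrightarrow> lin L \<and> isCont (f x0) 0 \<and>
     (\<forall>e>0. \<exists>d>0. \<forall>t x y. cmod t < d \<longrightarrow> x \<in> nball U x0 d \<longrightarrow> y \<in> nball U x0 d \<longrightarrow>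
        cmod (f x t - f y t - L (\<lambda>u. x u - y u)) \<le> e * l1 U (\<lambda>u. x u - y u))"

lemma strict_derivD:
  assumes "strict_deriv U x0 f L" "e > 0"
  obtains d where "d > 0" "\<And>t x y. cmod t < d \<Longrightarrow> x \<in> nball U x0 d \<Longrightarrow> y \<in> nball U x0 d \<Longrightarrow>
        cmod (f x t - f y t - L (\<lambda>u. x u - y u)) \<le> e * l1 U (\<lambda>u. x u - y u)"
  using assms unfolding strict_deriv_def by blast

lemma strict_deriv_const: "strict_deriv U x0 (\<lambda>x t. c) (\<lambda>h. 0)"
  unfolding strict_deriv_def lin_def by (auto intro!: exI[of _ 1])

lemma strict_deriv_coord: "strict_deriv U x0 (\<lambda>x t. x v) (\<lambda>h. h v)"
  unfolding strict_deriv_def lin_def by (auto intro!: exI[of _ 1])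

lemma strict_deriv_add:
  assumes f: "strict_deriv U x0 f L" and g: "strict_deriv U x0 g K"
  shows "strict_deriv U x0 (\<lambda>x t. f x t + g x t) (\<lambda>h. L h + K h)"
  unfolding strict_deriv_def
proof (intro conjI allI impI)
  show "lin (\<lambda>h. L h + K h)" using assms by (auto simp: strict_deriv_def lin_def algebra_simps)
  show "isCont (\<lambda>t. f x0 t + g x0 t) 0" using assms by (auto simp: strict_deriv_def)
  fix e :: real assume "e > 0"
  then have e: "e / 2 > 0" by simp
  obtain d1 where d1: "d1 > 0" "\<And>t x y. cmod t < d1 \<Longrightarrow> x \<in> nball U x0 d1 \<Longrightarrow> y \<in> nball U x0 d1 \<Longrightarrow>
        cmod (f x t - f y t - L (\<lambda>u. x u - y u)) \<le> e / 2 * l1 U (\<lambda>u. x u - y u)"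
    using strict_derivD[OF f e] by blast
  obtain d2 where d2: "d2 > 0" "\<And>t x y. cmod t < d2 \<Longrightarrow> x \<in> nball U x0 d2 \<Longrightarrow> y \<in> nball U x0 d2 \<Longrightarrow>
        cmod (g x t - g y t - K (\<lambda>u. x u - y u)) \<le> e / 2 * l1 U (\<lambda>u. x u - y u)"
    using strict_derivD[OF g e] by blast
  show "\<exists>d>0. \<forall>t x y. cmod t < d \<longrightarrow> x \<in> nball U x0 d \<longrightarrow> y \<in> nball U x0 d \<longrightarrow>
        cmod (f x t + g x t - (f y t + g y t) - (L (\<lambda>u. x u - y u) + K (\<lambda>u. x u - y u)))
          \<le> e * l1 U (\<lambda>u. x u - y u)"
  proof (intro exI[of _ "min d1 d2"] conjI allI impI)
    fix t x y assume a: "cmod t < min d1 d2" "x \<in> nball U x0 (min d1 d2)" "y \<in> nball U x0 (min d1 d2)"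
    have "cmod (f x t + g x t - (f y t + g y t) - (L (\<lambda>u. x u - y u) + K (\<lambda>u. x u - y u))) =
      cmod ((f x t - f y t - L (\<lambda>u. x u - y u)) + (g x t - g y t - K (\<lambda>u. x u - y u)))"
      by (simp add: algebra_simps)
    also have "\<dots> \<le> e / 2 * l1 U (\<lambda>u. x u - y u) + e / 2 * l1 U (\<lambda>u. x u - y u)"
      using a by (intro norm_triangle_le add_mono d1(2) d2(2)) (auto simp: nball_def)
    finally show "cmod (f x t + g x t - (f y t + g y t) - (L (\<lambda>u. x u - y u) + K (\<lambda>u. x u - y u)))
          \<le> e * l1 U (\<lambda>u. x u - y u)" by simp
  qed (use d1 d2 in auto)
qed

lemma strict_deriv_cmult:
  assumes f: "strict_deriv U x0 f L"
  shows "strict_deriv U x0 (\<lambda>x t. c * f x t) (\<lambda>h. c * L h)"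
  unfolding strict_deriv_def
proof (intro conjI allI impI)
  show "lin (\<lambda>h. c * L h)" using assms by (auto simp: strict_deriv_def lin_def algebra_simps)
  show "isCont (\<lambda>t. c * f x0 t) 0" using assms by (auto simp: strict_deriv_def)
  fix e :: real assume "e > 0"
  then have e: "e / (cmod c + 1) > 0" by (simp add: add_nonneg_pos)
  obtain d where d: "d > 0" "\<And>t x y. cmod t < d \<Longrightarrow> x \<in> nball U x0 d \<Longrightarrow> y \<in> nball U x0 d \<Longrightarrow>
        cmod (f x t - f y t - L (\<lambda>u. x u - y u)) \<le> e / (cmod c + 1) * l1 U (\<lambda>u. x u - y u)"
    using strict_derivD[OF f e] by blast
  show "\<exists>d>0. \<forall>t x y. cmod t < d \<longrightarrow> x \<in> nball U x0 d \<longrightarrow> y \<in> nball U x0 d \<longrightarrow>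
        cmod (c * f x t - c * f y t - c * L (\<lambda>u. x u - y u)) \<le> e * l1 U (\<lambda>u. x u - y u)"
  proof (intro exI[of _ d] conjI allI impI d(1))
    fix t x y assume a: "cmod t < d" "x \<in> nball U x0 d" "y \<in> nball U x0 d"
    have "cmod (c * f x t - c * f y t - c * L (\<lambda>u. x u - y u)) =
      cmod c * cmod (f x t - f y t - L (\<lambda>u. x u - y u))"
      by (simp add: norm_mult[symmetric] right_diff_distrib)
    also have "\<dots> \<le> (cmod c + 1) * (e / (cmod c + 1) * l1 U (\<lambda>u. x u - y u))"
      by (intro mult_mono d(2) a) auto
    also have "\<dots> = e * l1 U (\<lambda>u. x u - y u)"
      using add_nonneg_pos[OF norm_ge_zero[of c] zero_less_one] by simp
    finally show "cmod (c * f x t - c * f y t - c * L (\<lambda>u. x u - y u)) \<le> e * l1 U (\<lambda>u. x u - y u)" .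
  qed
qed

lemma strict_deriv_diff:
  assumes "strict_deriv U x0 f L" "strict_deriv U x0 g K"
  shows "strict_deriv U x0 (\<lambda>x t. f x t - g x t) (\<lambda>h. L h - K h)"
  using strict_deriv_add[OF assms(1) strict_deriv_cmult[OF assms(2), of "-1"]] by simp

lemma strict_deriv_sum:
  assumes "\<And>j. j \<in> A \<Longrightarrow> strict_deriv U x0 (f j) (L j)"
  shows "strict_deriv U x0 (\<lambda>x t. \<Sum>j\<in>A. f j x t) (\<lambda>h. \<Sum>j\<in>A. L j h)"
  using assms
  by (induction A rule: infinite_finite_induct) (auto intro: strict_deriv_const strict_deriv_add)

lemma strict_deriv_lipschitz:
  assumes f: "strict_deriv U x0 f L" and U: "finite U"
  obtains C d where "C > 0" "d > 0" "\<And>t x y. cmod t < d \<Longrightarrow> x \<in> nball U x0 d \<Longrightarrow> y \<in> nball U x0 d \<Longrightarrow>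
    cmod (f x t - f y t) \<le> C * l1 U (\<lambda>u. x u - y u)"
proof -
  obtain C where C: "C > 0" "\<And>h. (\<forall>x. x \<notin> U \<longrightarrow> h x = 0) \<Longrightarrow> cmod (L h) \<le> C * l1 U h"
    using lin_bounded[of L U] f U unfolding strict_deriv_def by blast
  obtain d where d: "d > 0" "\<And>t x y. cmod t < d \<Longrightarrow> x \<in> nball U x0 d \<Longrightarrow> y \<in> nball U x0 d \<Longrightarrow>
        cmod (f x t - f y t - L (\<lambda>u. x u - y u)) \<le> 1 * l1 U (\<lambda>u. x u - y u)"
    using strict_derivD[OF f, of 1] by auto
  show ?thesis
  proof (rule that[of "C + 1" d])
    fix t x y assume a: "cmod t < d" "x \<in> nball U x0 d" "y \<in> nball U x0 d"
    have "cmod (L (\<lambda>u. x u - y u)) \<le> C * l1 U (\<lambda>u. x u - y u)" using a by (intro C(2)) (simp add: nball_def)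
    then show "cmod (f x t - f y t) \<le> (C + 1) * l1 U (\<lambda>u. x u - y u)"
      using d(2)[OF a] norm_triangle_ineq2[of "f x t - f y t" "L (\<lambda>u. x u - y u)"]
      by (simp add: algebra_simps)
  qed (use C d in auto)
qed

text \<open>
  A factor \<open>t\<close> kills the derivative: the difference is at most \<open>|t|\<close> times a Lipschitz bound.
\<close>

lemma strict_deriv_param_mult:
  assumes f: "strict_deriv U x0 f L" and U: "finite U"
  shows "strict_deriv U x0 (\<lambda>x t. t * f x t) (\<lambda>h. 0)"
  unfolding strict_deriv_def
proof (intro conjI allI impI)
  show "lin (\<lambda>h. 0)" by (simp add: lin_def)
  show "isCont (\<lambda>t. t * f x0 t) 0" using f by (intro continuous_intros) (simp add: strict_deriv_def)
  fix e :: real assume e: "e > 0"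
  obtain C d where C: "C > 0" and d: "d > 0" "\<And>t x y. cmod t < d \<Longrightarrow> x \<in> nball U x0 d \<Longrightarrow> y \<in> nball U x0 d \<Longrightarrow>
    cmod (f x t - f y t) \<le> C * l1 U (\<lambda>u. x u - y u)"
    using strict_deriv_lipschitz[OF f U] by metis
  show "\<exists>d>0. \<forall>t x y. cmod t < d \<longrightarrow> x \<in> nball U x0 d \<longrightarrow> y \<in> nball U x0 d \<longrightarrow>
        cmod (t * f x t - t * f y t - 0) \<le> e * l1 U (\<lambda>u. x u - y u)"
  proof (intro exI[of _ "min d (e / C)"] conjI allI impI)
    fix t x y assume a: "cmod t < min d (e / C)" "x \<in> nball U x0 (min d (e / C))" "y \<in> nball U x0 (min d (e / C))"
    have "cmod (t * f x t - t * f y t - 0) = cmod t * cmod (f x t - f y t)"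
      by (simp add: norm_mult[symmetric] right_diff_distrib)
    also have "\<dots> \<le> (e / C) * (C * l1 U (\<lambda>u. x u - y u))"
      using a e C by (intro mult_mono d(2)) (auto simp: nball_def)
    also have "\<dots> = e * l1 U (\<lambda>u. x u - y u)" using C by simp
    finally show "cmod (t * f x t - t * f y t - 0) \<le> e * l1 U (\<lambda>u. x u - y u)" .
  qed (use d C e in auto)
qed

lemma strict_deriv_continuous:
  assumes f: "strict_deriv U x0 f L" and U: "finite U" and "e > 0"
  obtains d where "d > 0" "\<And>t x. cmod t < d \<Longrightarrow> x \<in> nball U x0 d \<Longrightarrow> cmod (f x t - f x0 0) < e"
proof -
  obtain C where C: "C > 0" "\<And>h. (\<forall>x. x \<notin> U \<longrightarrow> h x = 0) \<Longrightarrow> cmod (L h) \<le> C * l1 U h"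
    using lin_bounded[of L U] f U unfolding strict_deriv_def by blast
  obtain d1 where d1: "d1 > 0" "\<And>t x y. cmod t < d1 \<Longrightarrow> x \<in> nball U x0 d1 \<Longrightarrow> y \<in> nball U x0 d1 \<Longrightarrow>
        cmod (f x t - f y t - L (\<lambda>u. x u - y u)) \<le> 1 * l1 U (\<lambda>u. x u - y u)"
    using strict_derivD[OF f, of 1] by auto
  have "isCont (f x0) 0" using f by (simp add: strict_deriv_def)
  then obtain d2 where d2: "d2 > 0" "\<And>t. cmod t < d2 \<Longrightarrow> cmod (f x0 t - f x0 0) < e / 2"
    using \<open>e > 0\<close> unfolding continuous_at_eps_delta dist_norm
    by (metis diff_zero half_gt_zero)
  define d where "d = min (min d1 d2) (e / (2 * (C + 1)))"
  show ?thesis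
  proof (rule that)
    show "d > 0" using d1 d2 C \<open>e > 0\<close> by (simp add: d_def)
    fix t x assume a: "cmod t < d" "x \<in> nball U x0 d"
    let ?h = "\<lambda>u. x u - x0 u"
    have h: "l1 U ?h < e / (2 * (C + 1))" using a by (simp add: nball_def d_def)
    have "cmod (f x t - f x0 t - L ?h) \<le> 1 * l1 U ?h"
      using a d1(1) by (intro d1(2)) (auto simp: nball_def d_def l1_def)
    moreover have "cmod (L ?h) \<le> C * l1 U ?h" using a by (intro C(2)) (simp add: nball_def)
    ultimately have "cmod (f x t - f x0 t) \<le> (C + 1) * l1 U ?h"
      using norm_triangle_ineq2[of "f x t - f x0 t" "L ?h"] by (simp add: algebra_simps)
    also have "\<dots> < (C + 1) * (e / (2 * (C + 1)))" using h C(1) by (intro mult_strict_left_mono) auto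
    also have "\<dots> = e / 2" using C(1) by (simp add: field_simps)
    finally have "cmod (f x t - f x0 t) < e / 2" .
    moreover have "cmod (f x0 t - f x0 0) < e / 2" using a by (intro d2(2)) (simp add: d_def)
    ultimately show "cmod (f x t - f x0 0) < e"
      using norm_triangle_ineq[of "f x t - f x0 t" "f x0 t - f x0 0"] by simp
  qed
qed

lemma strict_deriv_inverse:
  assumes f: "strict_deriv U x0 f L" and U: "finite U" and nz: "f x0 0 \<noteq> 0"
  shows "strict_deriv U x0 (\<lambda>x t. 1 / f x t) (\<lambda>h. - (L h / (f x0 0)\<^sup>2))"
  unfolding strict_deriv_def
proof (intro conjI allI impI)
  show "lin (\<lambda>h. - (L h / (f x0 0)\<^sup>2))"
    using f by (auto simp: strict_deriv_def lin_def algebra_simps add_divide_distrib)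
  show "isCont (\<lambda>t. 1 / f x0 t) 0" using f nz by (auto simp: strict_deriv_def)
  fix e :: real assume e: "e > 0"
  let ?g = "f x0 0"
  \<comment> \<open>The error splits into the error of \<open>f\<close>, divided by \<open>f x t * f y t\<close>, and the variation of that
    denominator applied to the linear part.\<close>
  obtain C where C: "C > 0" "\<And>h. (\<forall>x. x \<notin> U \<longrightarrow> h x = 0) \<Longrightarrow> cmod (L h) \<le> C * l1 U h"
    using lin_bounded[of L U] f U unfolding strict_deriv_def by blast
  define e1 where "e1 = e / (2 * C)"
  have e1: "e1 > 0" using e C by (simp add: e1_def)
  define D where "D = cmod (1 / (?g * ?g)) + e1"
  have D: "D > 0" using e1 by (simp add: D_def add_nonneg_pos)
  have "isCont (\<lambda>p. 1 / (fst p * snd p)) (?g, ?g)" using nz by (intro continuous_intros) auto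
  then obtain n where n: "n > 0" "\<And>p. dist p (?g, ?g) < n \<Longrightarrow> dist (1 / (fst p * snd p)) (1 / (?g * ?g)) < e1"
    using e1 unfolding continuous_at_eps_delta by auto
  obtain d1 where d1: "d1 > 0" "\<And>t x. cmod t < d1 \<Longrightarrow> x \<in> nball U x0 d1 \<Longrightarrow> cmod (f x t - ?g) < min (n / 2) (cmod ?g)"
    using strict_deriv_continuous[OF f U, of "min (n / 2) (cmod ?g)"] n(1) nz by auto
  have eD: "e / (2 * D) > 0" using e D by simp
  obtain d2 where d2: "d2 > 0" "\<And>t x y. cmod t < d2 \<Longrightarrow> x \<in> nball U x0 d2 \<Longrightarrow> y \<in> nball U x0 d2 \<Longrightarrow>
        cmod (f x t - f y t - L (\<lambda>u. x u - y u)) \<le> e / (2 * D) * l1 U (\<lambda>u. x u - y u)"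
    using strict_derivD[OF f eD] by blast
  show "\<exists>d>0. \<forall>t x y. cmod t < d \<longrightarrow> x \<in> nball U x0 d \<longrightarrow> y \<in> nball U x0 d \<longrightarrow>
        cmod (1 / f x t - 1 / f y t - - (L (\<lambda>u. x u - y u) / ?g\<^sup>2)) \<le> e * l1 U (\<lambda>u. x u - y u)"
  proof (intro exI[of _ "min d1 d2"] conjI allI impI)
    fix t x y assume a: "cmod t < min d1 d2" "x \<in> nball U x0 (min d1 d2)" "y \<in> nball U x0 (min d1 d2)"
    let ?h = "\<lambda>u. x u - y u"
    have b: "cmod (f x t - ?g) < min (n / 2) (cmod ?g)" "cmod (f y t - ?g) < min (n / 2) (cmod ?g)"
      using a d1(2)[of t x] d1(2)[of t y] by (simp_all add: nball_def)
    have nzx: "f x t \<noteq> 0" "f y t \<noteq> 0" using b by (auto simp: norm_minus_commute)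
    have "dist (f x t, f y t) (?g, ?g) \<le> dist (f x t) ?g + dist (f y t) ?g"
      unfolding dist_prod_def by (simp add: sqrt_sum_squares_le_sum)
    also have "\<dots> < n" using b by (simp add: dist_norm)
    finally have w: "cmod (1 / (f x t * f y t) - 1 / (?g * ?g)) < e1"
      using n(2)[of "(f x t, f y t)"] by (simp add: dist_norm)
    then have wD: "cmod (1 / (f x t * f y t)) \<le> D"
      unfolding D_def using norm_triangle_ineq2[of "1 / (f x t * f y t)" "1 / (?g * ?g)"] by simp
    have s: "cmod (f x t - f y t - L ?h) \<le> e / (2 * D) * l1 U ?h"
      using a by (intro d2(2)) (auto simp: nball_def)
    have Lh: "cmod (L ?h) \<le> C * l1 U ?h" using a by (intro C(2)) (simp add: nball_def)
    have "1 / f x t - 1 / f y t - - (L ?h / ?g\<^sup>2) =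
       - ((f x t - f y t - L ?h) * (1 / (f x t * f y t)) + L ?h * (1 / (f x t * f y t) - 1 / (?g * ?g)))"
      using nzx nz by (simp add: field_simps power2_eq_square)
    then have "cmod (1 / f x t - 1 / f y t - - (L ?h / ?g\<^sup>2)) \<le>
       cmod (f x t - f y t - L ?h) * cmod (1 / (f x t * f y t)) + cmod (L ?h) * cmod (1 / (f x t * f y t) - 1 / (?g * ?g))"
      by (simp only: norm_minus_cancel norm_mult[symmetric] norm_triangle_ineq)
    also have "\<dots> \<le> (e / (2 * D) * l1 U ?h) * D + (C * l1 U ?h) * e1"
      using s wD Lh w e D C(1) by (intro add_mono mult_mono) auto
    also have "\<dots> = e * l1 U ?h" using D C(1) by (simp add: e1_def field_simps)
    finally show "cmod (1 / f x t - 1 / f y t - - (L ?h / ?g\<^sup>2)) \<le> e * l1 U ?h" .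
  qed (use d1 d2 in auto)
qed

lemma l1_matrix_bound:
  fixes K :: "'a \<Rightarrow> 'a \<Rightarrow> complex"
  assumes "finite U"
  shows "\<exists>C>0. \<forall>r. l1 U (\<lambda>u. \<Sum>v\<in>U. K u v * r v) \<le> C * l1 U r"
proof -
  let ?C = "(\<Sum>u\<in>U. \<Sum>v\<in>U. cmod (K u v)) + 1"
  have "l1 U (\<lambda>u. \<Sum>v\<in>U. K u v * r v) \<le> ?C * l1 U r" for r
  proof -
    have "l1 U (\<lambda>u. \<Sum>v\<in>U. K u v * r v) \<le> (\<Sum>u\<in>U. \<Sum>v\<in>U. cmod (K u v) * l1 U r)"
      unfolding l1_def[of U "\<lambda>u. \<Sum>v\<in>U. K u v * r v"]
      by (intro sum_mono order_trans[OF norm_sum]) (simp add: norm_mult mult_left_mono norm_le_l1 assms)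
    also have "\<dots> \<le> ?C * l1 U r"
      unfolding sum_distrib_right[symmetric] by (intro mult_right_mono) auto
    finally show ?thesis .
  qed
  moreover have "?C > 0" by (simp add: add_nonneg_pos sum_nonneg)
  ultimately show ?thesis by blast
qed

text \<open>
  The contraction principle for a set that is closed under coordinatewise limits.
\<close>

lemma contraction_fixed_point:
  assumes U: "finite U" and x0: "x0 \<in> M" and TM: "\<And>x. x \<in> M \<Longrightarrow> T x \<in> M"
    and T: "\<And>x y. x \<in> M \<Longrightarrow> y \<in> M \<Longrightarrow> l1 U (\<lambda>u. T x u - T y u) \<le> l1 U (\<lambda>u. x u - y u) / 2"
    and cl: "\<And>X x. (\<And>n. X n \<in> M) \<Longrightarrow> (\<And>u. u \<in> U \<Longrightarrow> (\<lambda>n. X n u) \<longlonglongrightarrow> x u) \<Longrightarrow> (\<And>u. u \<notin> U \<Longrightarrow> x u = x0 u) \<Longrightarrow> x \<in> M"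
  shows "\<exists>x\<in>M. \<forall>u\<in>U. T x u = x u"
proof -
  define X where "X n = (T ^^ n) x0" for n
  have XM: "X n \<in> M" for n by (induction n) (auto simp: X_def x0 TM)
  have XS: "X (Suc n) = T (X n)" for n by (simp add: X_def)
  define c where "c = l1 U (\<lambda>u. X 1 u - X 0 u)"
  have step: "l1 U (\<lambda>u. X (Suc n) u - X n u) \<le> c * (1 / 2) ^ n" for n
  proof (induction n)
    case 0 show ?case by (simp add: c_def)
  next
    case (Suc n)
    have "l1 U (\<lambda>u. X (Suc (Suc n)) u - X (Suc n) u) \<le> l1 U (\<lambda>u. X (Suc n) u - X n u) / 2"
      unfolding XS[of "Suc n"] XS[of n] by (intro T XM TM)
    then show ?case using Suc by simp
  qed
  have conv: "convergent (\<lambda>n. X n u)" if "u \<in> U" for u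
  proof -
    have "summable (\<lambda>n. X (Suc n) u - X n u)"
    proof (rule summable_comparison_test')
      show "summable (\<lambda>n. c * (1 / 2) ^ n)" by (intro summable_mult summable_geometric) simp
      show "norm (X (Suc n) u - X n u) \<le> c * (1 / 2) ^ n" if "n \<ge> 0" for n
        using step[of n] norm_le_l1[OF U \<open>u \<in> U\<close>, of "\<lambda>u. X (Suc n) u - X n u"] by simp
    qed
    then have "convergent (\<lambda>n. \<Sum>i<n. X (Suc i) u - X i u)" by (simp add: summable_iff_convergent)
    then have "convergent (\<lambda>n. X n u - X 0 u)" unfolding sum_lessThan_telescope[of "\<lambda>n. X n u"] .
    then have "convergent (\<lambda>n. X n u - X 0 u + X 0 u)" by (intro convergent_add convergent_const)
    then show ?thesis by simp
  qed
  define x where "x u = (if u \<in> U then lim (\<lambda>n. X n u) else x0 u)" for u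
  have lim: "(\<lambda>n. X n u) \<longlonglongrightarrow> x u" if "u \<in> U" for u
    using conv[OF that] that by (simp add: x_def convergent_LIMSEQ_iff)
  have xM: "x \<in> M" by (rule cl[OF XM lim]) (auto simp: x_def)
  have d0: "(\<lambda>n. l1 U (\<lambda>u. X n u - x u)) \<longlonglongrightarrow> 0"
  proof -
    have "(\<lambda>n. l1 U (\<lambda>u. X n u - x u)) \<longlonglongrightarrow> (\<Sum>u\<in>U. cmod (x u - x u))"
      unfolding l1_def by (intro tendsto_sum tendsto_norm tendsto_diff lim tendsto_const)
    then show ?thesis by simp
  qed
  have "l1 U (\<lambda>u. T x u - x u) \<le> l1 U (\<lambda>u. X n u - x u) / 2 + l1 U (\<lambda>u. X (Suc n) u - x u)" for n
  proof -
    have "l1 U (\<lambda>u. T x u - x u) \<le> l1 U (\<lambda>u. T x u - T (X n) u) + l1 U (\<lambda>u. T (X n) u - x u)"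
      by (rule l1_triangle_diff)
    then show ?thesis using T[OF xM XM[of n]] XS[of n] l1_commute[of U x "X n"] by simp
  qed
  moreover have "(\<lambda>n. l1 U (\<lambda>u. X n u - x u) / 2 + l1 U (\<lambda>u. X (Suc n) u - x u)) \<longlonglongrightarrow> 0 / 2 + 0"
    by (intro tendsto_intros d0 LIMSEQ_Suc[OF d0]) simp
  ultimately have "l1 U (\<lambda>u. T x u - x u) \<le> 0"
    by (metis (no_types, lifting) LIMSEQ_le_const add_0 div_0)
  then have "l1 U (\<lambda>u. T x u - x u) = 0" using l1_nonneg[of U "\<lambda>u. T x u - x u"] by linarith
  then show ?thesis using xM l1_eq_0_iff[OF U] by (intro bexI[of _ x]) auto
qed

text \<open>
  Solutions are the fixed points of \<open>x \<mapsto> x - K (H x t)\<close>, where \<open>K\<close> is the inverse matrix of \<open>L\<close>; near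
  \<open>(x0, 0)\<close> this map shrinks distances at least by a factor of two. The last clause says that nearby zeros are again nondegenerate:
  a direction in which all equations are stationary is trivial. It speaks of one-dimensional
  derivatives, so that it can be applied after a change of coordinates.
\<close>

theorem implicit_function:
  fixes H :: "('a \<Rightarrow> complex) \<Rightarrow> complex \<Rightarrow> 'a \<Rightarrow> complex"
  assumes U: "finite U"
    and H: "\<And>u. u \<in> U \<Longrightarrow> strict_deriv U x0 (\<lambda>x t. H x t u) (\<lambda>h. L h u)"
    and H0: "\<And>u. u \<in> U \<Longrightarrow> H x0 0 u = 0"
    and inj: "\<And>h. (\<forall>x. x \<notin> U \<longrightarrow> h x = 0) \<Longrightarrow> (\<forall>u\<in>U. L h u = 0) \<Longrightarrow> \<forall>u\<in>U. h u = 0"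
  shows "\<exists>\<rho>0>0.
     (\<forall>\<rho>. 0 < \<rho> \<and> \<rho> \<le> \<rho>0 \<longrightarrow>
        (\<exists>d>0. \<forall>t. cmod t < d \<longrightarrow> (\<exists>!x. x \<in> nball U x0 \<rho> \<and> (\<forall>u\<in>U. H x t u = 0)))) \<and>
     (\<forall>t x h. cmod t < \<rho>0 \<longrightarrow> x \<in> nball U x0 \<rho>0 \<longrightarrow> (\<forall>u. u \<notin> U \<longrightarrow> h u = 0) \<longrightarrow>
        (\<forall>u\<in>U. ((\<lambda>s. H (\<lambda>v. x v + s * h v) t u) has_field_derivative 0) (at 0)) \<longrightarrow> (\<forall>u\<in>U. h u = 0))"
proof -
  define M where "M u v = L (\<lambda>x. if x = v then 1 else 0) u" for u v
  have linL: "lin (\<lambda>h. L h u)" if "u \<in> U" for u using H[OF that] by (simp add: strict_deriv_def)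
  have LM: "L h u = (\<Sum>v\<in>U. M u v * h v)" if "u \<in> U" "\<forall>x. x \<notin> U \<longrightarrow> h x = 0" for u h
    unfolding M_def by (rule lin_expand[OF linL[OF that(1)] U that(2)])
  have "\<forall>v\<in>U. h v = 0" if "\<forall>u\<in>U. (\<Sum>v\<in>U. M u v * h v) = 0" for h
  proof -
    let ?h = "\<lambda>v. if v \<in> U then h v else 0"
    have "\<forall>u\<in>U. L ?h u = 0" using that LM[of _ ?h] by (simp cong: sum.cong)
    then have "\<forall>u\<in>U. ?h u = 0" using inj[of ?h] by presburger
    then show ?thesis by simp
  qed
  then obtain K where MK: "\<And>r u. u \<in> U \<Longrightarrow> (\<Sum>v\<in>U. M u v * (\<Sum>w\<in>U. K v w * r w)) = r u"
    and KM: "\<And>h u. u \<in> U \<Longrightarrow> (\<Sum>v\<in>U. K u v * (\<Sum>w\<in>U. M v w * h w)) = h u"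
    using inverse_matrix_exists[OF U, of M] by blast
  define app where "app r u = (\<Sum>v\<in>U. K u v * r v)" for r u
  obtain C where C: "C > 0" "\<And>r. l1 U (app r) \<le> C * l1 U r"
    unfolding app_def using l1_matrix_bound[OF U, of K] by blast
  \<comment> \<open>There are \<open>card U\<close> equations, each with error at most \<open>e\<close>, and \<open>K\<close> costs a factor \<open>C\<close>.\<close>
  define e where "e = 1 / (2 * C * (card U + 1))"
  have e: "e > 0" using C by (simp add: e_def)
  have Ce: "C * (card U * e) \<le> 1 / 2" 
  proof -
    have "C * (card U * e) = card U / (2 * (card U + 1))" using C(1) by (simp add: e_def)
    also have "\<dots> \<le> 1 / 2" by (simp add: divide_le_eq)
    finally show ?thesis .
  qed
  define Q where "Q u d \<longleftrightarrow> d > 0 \<and> (\<forall>t x y. cmod t < d \<longrightarrow> x \<in> nball U x0 d \<longrightarrow> y \<in> nball U x0 d \<longrightarrow>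
        cmod (H x t u - H y t u - L (\<lambda>u. x u - y u) u) \<le> e * l1 U (\<lambda>u. x u - y u))" for u d
  have "\<forall>u\<in>U. \<exists>d. Q u d"
  proof
    fix u assume "u \<in> U"
    from strict_derivD[OF H[OF this] e] show "\<exists>d. Q u d" unfolding Q_def by metis
  qed
  then obtain d where Q: "\<forall>u\<in>U. Q u (d u)" using bchoice[of U Q] by blast
  then have d: "\<And>u. u \<in> U \<Longrightarrow> d u > 0" "\<And>u t x y. u \<in> U \<Longrightarrow> cmod t < d u \<Longrightarrow> x \<in> nball U x0 (d u) \<Longrightarrow>
      y \<in> nball U x0 (d u) \<Longrightarrow> cmod (H x t u - H y t u - L (\<lambda>u. x u - y u) u) \<le> e * l1 U (\<lambda>u. x u - y u)"
    unfolding Q_def by blast+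
  define \<rho>0 where "\<rho>0 = Min (insert 1 (d ` U))"
  have \<rho>0: "\<rho>0 > 0" "\<And>u. u \<in> U \<Longrightarrow> \<rho>0 \<le> d u" using U d(1) by (auto simp: \<rho>0_def)
  have est: "cmod (H x t u - H y t u - L (\<lambda>u. x u - y u) u) \<le> e * l1 U (\<lambda>u. x u - y u)"
    if "u \<in> U" "cmod t < \<rho>0" "x \<in> nball U x0 \<rho>0" "y \<in> nball U x0 \<rho>0" for u t x y
    using d(2)[OF that(1)] that(2-4) nball_mono[OF \<rho>0(2)[OF that(1)]] \<rho>0(2)[OF that(1)] by force
  define T where "T t x u = (if u \<in> U then x u - app (H x t) u else x0 u)" for t x u
  have T: "l1 U (\<lambda>u. T t x u - T t y u) \<le> l1 U (\<lambda>u. x u - y u) / 2"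
    if "cmod t < \<rho>0" "x \<in> nball U x0 \<rho>0" "y \<in> nball U x0 \<rho>0" for t x y
  proof -
    let ?h = "\<lambda>u. x u - y u"
    let ?r = "\<lambda>u. L ?h u - (H x t u - H y t u)"
    have h: "\<forall>x. x \<notin> U \<longrightarrow> ?h x = 0" using that by (auto simp: nball_def)
    have "T t x u - T t y u = app ?r u" if "u \<in> U" for u
    proof -
      have "(\<Sum>v\<in>U. K u v * L ?h v) = ?h u" using KM[OF that, of ?h] LM[OF _ h] by (simp cong: sum.cong)
      then show ?thesis using that by (simp add: T_def app_def right_diff_distrib sum_subtractf)
    qed
    then have "l1 U (\<lambda>u. T t x u - T t y u) = l1 U (app ?r)" by (intro l1_cong)
    also have "\<dots> \<le> C * l1 U ?r" by (rule C)
    also have "l1 U ?r \<le> (\<Sum>u\<in>U. e * l1 U ?h)"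
      unfolding l1_def[of U ?r] by (intro sum_mono) (metis est[OF _ that] norm_minus_commute)
    also have "C * (\<Sum>u\<in>U. e * l1 U ?h) = C * (card U * e) * l1 U ?h" by simp
    also have "\<dots> \<le> 1 / 2 * l1 U ?h" by (intro mult_right_mono Ce) simp
    finally show ?thesis using C(1) by simp
  qed
  have fix_iff: "(\<forall>u\<in>U. T t x u = x u) \<longleftrightarrow> (\<forall>u\<in>U. H x t u = 0)" for t x
  proof
    assume "\<forall>u\<in>U. T t x u = x u"
    then have "\<forall>u\<in>U. app (H x t) u = 0" by (simp add: T_def)
    then show "\<forall>u\<in>U. H x t u = 0" using MK[of _ "H x t"] by (simp add: app_def cong: sum.cong)
  next
    assume "\<forall>u\<in>U. H x t u = 0" then show "\<forall>u\<in>U. T t x u = x u" by (simp add: T_def app_def)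
  qed
  have uniq: "x = y" if t: "cmod t < \<rho>0" and x: "x \<in> nball U x0 \<rho>0" "\<forall>u\<in>U. H x t u = 0"
    and y: "y \<in> nball U x0 \<rho>0" "\<forall>u\<in>U. H y t u = 0" for x y t
  proof -
    have "l1 U (\<lambda>u. x u - y u) = l1 U (\<lambda>u. T t x u - T t y u)"
      using fix_iff[of t x] fix_iff[of t y] x(2) y(2) by (intro l1_cong) simp
    then have "l1 U (\<lambda>u. x u - y u) \<le> l1 U (\<lambda>u. x u - y u) / 2" using T[OF t x(1) y(1)] by simp
    then have "l1 U (\<lambda>u. x u - y u) = 0" using l1_nonneg[of U "\<lambda>u. x u - y u"] by linarith
    then have "\<forall>u\<in>U. x u = y u" using l1_eq_0_iff[OF U, of "\<lambda>u. x u - y u"] by simp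
    then show "x = y" using x y by (auto simp: nball_def fun_eq_iff)
  qed
  have ex: "\<exists>d>0. \<forall>t. cmod t < d \<longrightarrow> (\<exists>!x. x \<in> nball U x0 \<rho> \<and> (\<forall>u\<in>U. H x t u = 0))"
    if \<rho>: "0 < \<rho>" "\<rho> \<le> \<rho>0" for \<rho>
  proof -
    have "((\<lambda>t. l1 U (H x0 t)) \<longlongrightarrow> (\<Sum>u\<in>U. cmod (H x0 0 u))) (at 0)"
      unfolding l1_def using H by (intro tendsto_sum tendsto_norm) (auto simp: strict_deriv_def isCont_def)
    then have "((\<lambda>t. l1 U (H x0 t)) \<longlongrightarrow> 0) (at 0)" using H0 by simp
    then have "\<forall>\<^sub>F t in at 0. l1 U (H x0 t) < \<rho> / (4 * C)"
      using \<rho> C(1) by (intro order_tendstoD) auto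
    then obtain d1 where d1: "d1 > 0" "\<And>t. t \<noteq> 0 \<Longrightarrow> cmod t < d1 \<Longrightarrow> l1 U (H x0 t) < \<rho> / (4 * C)"
      unfolding eventually_at by (auto simp: dist_norm)
    show ?thesis
    proof (intro exI[of _ "min d1 \<rho>0"] conjI allI impI)
      show "min d1 \<rho>0 > 0" using d1 \<rho>0 by simp
      fix t assume t: "cmod t < min d1 \<rho>0"
      have small: "l1 U (H x0 t) \<le> \<rho> / (4 * C)"
      proof (cases "t = 0")
        case True
        then have "l1 U (H x0 t) = 0" using H0 by (simp add: l1_def)
        then show ?thesis using \<rho> C(1) by simp
      next
        case False then show ?thesis using d1(2)[of t] t by simp
      qed
      let ?M = "{x. (\<forall>u. u \<notin> U \<longrightarrow> x u = x0 u) \<and> l1 U (\<lambda>u. x u - x0 u) \<le> \<rho> / 2}"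
      have sub: "?M \<subseteq> nball U x0 \<rho>" "?M \<subseteq> nball U x0 \<rho>0" using \<rho> by (auto simp: nball_def)
      have "\<exists>x\<in>?M. \<forall>u\<in>U. T t x u = x u"
      proof (rule contraction_fixed_point[OF U, of x0])
        show x0M: "x0 \<in> ?M" using \<rho> by (simp add: l1_def)
        show "l1 U (\<lambda>u. T t x u - T t y u) \<le> l1 U (\<lambda>u. x u - y u) / 2" if "x \<in> ?M" "y \<in> ?M" for x y
        proof -
          have "x \<in> nball U x0 \<rho>0" "y \<in> nball U x0 \<rho>0" using that sub(2) by blast+
          then show ?thesis using T[of t x y] t by simp
        qed
        show "T t x \<in> ?M" if x: "x \<in> ?M" for x
        proof -
          have "l1 U (\<lambda>u. T t x0 u - x0 u) = l1 U (app (H x0 t))"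
            unfolding l1_def T_def by (intro sum.cong) (auto simp: norm_minus_commute)
          also have "\<dots> \<le> C * (\<rho> / (4 * C))"
            using C small by (meson mult_left_mono order_trans less_imp_le)
          also have "\<dots> = \<rho> / 4" using C by simp
          finally have "l1 U (\<lambda>u. T t x0 u - x0 u) \<le> \<rho> / 4" .
          moreover have "x \<in> nball U x0 \<rho>0" using x sub(2) by blast
          then have "l1 U (\<lambda>u. T t x u - T t x0 u) \<le> l1 U (\<lambda>u. x u - x0 u) / 2"
            using T[of t x x0] t \<rho>0(1) by simp
          moreover have "l1 U (\<lambda>u. T t x u - x0 u) \<le> l1 U (\<lambda>u. T t x u - T t x0 u) + l1 U (\<lambda>u. T t x0 u - x0 u)"
            by (rule l1_triangle_diff)
          ultimately have "l1 U (\<lambda>u. T t x u - x0 u) \<le> \<rho> / 2" using x by simp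
          then show ?thesis by (simp add: T_def)
        qed
        fix X x assume X: "\<And>n. X n \<in> ?M" "\<And>u. u \<in> U \<Longrightarrow> (\<lambda>n. X n u) \<longlonglongrightarrow> x u" "\<And>u. u \<notin> U \<Longrightarrow> x u = x0 u"
        have "(\<lambda>n. l1 U (\<lambda>u. X n u - x0 u)) \<longlonglongrightarrow> l1 U (\<lambda>u. x u - x0 u)"
          unfolding l1_def by (intro tendsto_sum tendsto_norm tendsto_diff X(2) tendsto_const)
        then have "l1 U (\<lambda>u. x u - x0 u) \<le> \<rho> / 2" using X(1) by (intro LIMSEQ_le_const2) auto
        then show "x \<in> ?M" using X(3) by simp
      qed
      then obtain x where x: "x \<in> ?M" "\<forall>u\<in>U. H x t u = 0" using fix_iff by blast
      show "\<exists>!x. x \<in> nball U x0 \<rho> \<and> (\<forall>u\<in>U. H x t u = 0)"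
      proof (rule ex1I[of _ x])
        show "x \<in> nball U x0 \<rho> \<and> (\<forall>u\<in>U. H x t u = 0)" using x sub(1) by blast
        fix y assume y: "y \<in> nball U x0 \<rho> \<and> (\<forall>u\<in>U. H y t u = 0)"
        have "x \<in> nball U x0 \<rho>0" using x(1) sub(2) by blast
        moreover have "y \<in> nball U x0 \<rho>0" using y nball_mono[OF \<rho>(2), of U x0] by blast
        ultimately show "y = x" using uniq[of t y x] t y x(2) by simp
      qed
    qed
  qed
  have der: "\<forall>u\<in>U. h u = 0"
    if t: "cmod t < \<rho>0" and x: "x \<in> nball U x0 \<rho>0" and h: "\<forall>u. u \<notin> U \<longrightarrow> h u = 0"
      and D: "\<forall>u\<in>U. ((\<lambda>s. H (\<lambda>v. x v + s * h v) t u) has_field_derivative 0) (at 0)" for t x h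
  proof -
    have small: "cmod (L h u) \<le> e * l1 U h" if u: "u \<in> U" for u
    proof -
      let ?q = "\<lambda>s. (H (\<lambda>v. x v + s * h v) t u - H x t u) / s - L h u"
      have "((\<lambda>s. (H (\<lambda>v. x v + s * h v) t u - H x t u) / s) \<longlongrightarrow> 0) (at 0)"
        using D u by (simp add: has_field_derivative_iff)
      then have q: "((\<lambda>s. cmod (?q s)) \<longlongrightarrow> cmod (0 - L h u)) (at 0)" by (intro tendsto_intros)
      have "((\<lambda>s. l1 U (\<lambda>v. x v + s * h v - x0 v)) \<longlongrightarrow> (\<Sum>v\<in>U. cmod (x v + 0 * h v - x0 v))) (at 0)"
        unfolding l1_def by (intro tendsto_intros)
      then have "((\<lambda>s. l1 U (\<lambda>v. x v + s * h v - x0 v)) \<longlongrightarrow> l1 U (\<lambda>v. x v - x0 v)) (at 0)"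
        by (simp add: l1_def)
      then have "\<forall>\<^sub>F s in at 0. l1 U (\<lambda>v. x v + s * h v - x0 v) < \<rho>0"
        using x by (intro order_tendstoD) (auto simp: nball_def)
      moreover have "\<forall>\<^sub>F s in at (0::complex). s \<noteq> 0" by (simp add: eventually_at_filter)
      ultimately have "\<forall>\<^sub>F s in at 0. cmod (?q s) \<le> e * l1 U h"
      proof eventually_elim
        case (elim s)
        have "(\<lambda>v. x v + s * h v) \<in> nball U x0 \<rho>0" using elim x h by (simp add: nball_def)
        from est[OF u t this x] have "cmod (H (\<lambda>v. x v + s * h v) t u - H x t u - s * L h u) \<le> e * (cmod s * l1 U h)"
          using lin_scale[OF linL[OF u], of s h] by (simp add: l1_scale)
        moreover have "?q s = (H (\<lambda>v. x v + s * h v) t u - H x t u - s * L h u) / s"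
          using elim by (simp add: field_simps)
        ultimately show ?case using elim by (simp add: norm_divide divide_le_eq mult_ac)
      qed
      from tendsto_upperbound[OF q this] show ?thesis by simp
    qed
    have "l1 U h = l1 U (app (L h))"
      using KM[of _ h] LM[OF _ h] by (intro l1_cong) (simp add: app_def cong: sum.cong)
    also have "\<dots> \<le> C * l1 U (L h)" by (rule C)
    also have "l1 U (L h) \<le> (\<Sum>u\<in>U. e * l1 U h)"
      unfolding l1_def[of U "L h"] by (intro sum_mono small)
    also have "C * (\<Sum>u\<in>U. e * l1 U h) = C * (card U * e) * l1 U h" by simp
    also have "\<dots> \<le> 1 / 2 * l1 U h" by (intro mult_right_mono Ce) simp
    finally have "l1 U h \<le> 1 / 2 * l1 U h" using C(1) by simp
    then have "l1 U h = 0" using l1_nonneg[of U h] by linarith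
    then show ?thesis using l1_eq_0_iff[OF U] by simp
  qed
  show ?thesis using \<rho>0(1) ex der by (intro exI[of _ \<rho>0]) blast
qed

section \<open>Critical points of pinned graphs\<close>

definition wt :: "'a set set \<Rightarrow> ('a set \<Rightarrow> complex) \<Rightarrow> 'a \<Rightarrow> 'a \<Rightarrow> complex" where
  "wt E q x y = (if {x, y} \<in> E then q {x, y} else 0)"

definition lapl :: "'a set \<Rightarrow> 'a set set \<Rightarrow> ('a set \<Rightarrow> complex) \<Rightarrow> ('a \<Rightarrow> complex) \<Rightarrow> 'a \<Rightarrow> complex" where
  "lapl V E q w x = (\<Sum>y\<in>V. wt E q x y / (w x - w y))"

text \<open>
  The derivative of \<open>lapl\<close> in the direction \<open>h\<close>, up to sign.
\<close>

definition dlapl :: "'a set \<Rightarrow> 'a set set \<Rightarrow> ('a set \<Rightarrow> complex) \<Rightarrow> ('a \<Rightarrow> complex) \<Rightarrow> ('a \<Rightarrow> complex) \<Rightarrow> 'a \<Rightarrow> complex" where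
  "dlapl V E q w h x = (\<Sum>y\<in>V. wt E q x y * (h x - h y) / (w x - w y)\<^sup>2)"

text \<open>
  The vertices outside \<open>U\<close> are held at the positions \<open>a\<close>. Edges and weights are arguments of their
  own because the vertex set \<open>V\<close> over which sums range stays the same when edges are deleted or
  contracted.
\<close>

definition crit :: "'a set \<Rightarrow> 'a set \<Rightarrow> ('a \<Rightarrow> complex) \<Rightarrow> 'a set set \<Rightarrow> ('a set \<Rightarrow> complex) \<Rightarrow> ('a \<Rightarrow> complex) set" where
  "crit V U a E q = {w. (\<forall>x. x \<notin> U \<longrightarrow> w x = a x) \<and> (\<forall>x y. {x, y} \<in> E \<longrightarrow> w x \<noteq> w y) \<and>
     (\<forall>x\<in>U. lapl V E q w x = 0)}"

definition nondegenerate :: "'a set \<Rightarrow> 'a set \<Rightarrow> 'a set set \<Rightarrow> ('a set \<Rightarrow> complex) \<Rightarrow> ('a \<Rightarrow> complex) \<Rightarrow> bool" where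
  "nondegenerate V U E q w \<longleftrightarrow>
     (\<forall>h. (\<forall>x. x \<notin> U \<longrightarrow> h x = 0) \<longrightarrow> (\<forall>x\<in>U. dlapl V E q w h x = 0) \<longrightarrow> (\<forall>x\<in>U. h x = 0))"

text \<open>
  Nonzero coordinates are required because \<open>w = 0\<close> corresponds to \<open>z = \<infinity>\<close>.
\<close>

definition good :: "'a set \<Rightarrow> 'a set \<Rightarrow> ('a \<Rightarrow> complex) \<Rightarrow> 'a set set \<Rightarrow> ('a set \<Rightarrow> complex) \<Rightarrow> nat \<Rightarrow> bool" where
  "good V U a E q N \<longleftrightarrow> finite (crit V U a E q) \<and> card (crit V U a E q) = N \<and>
     (\<forall>w\<in>crit V U a E q. nondegenerate V U E q w \<and> (\<forall>x\<in>U. w x \<noteq> 0))"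

lemma wt_commute: "wt E q x y = wt E q y x"
  by (simp add: wt_def insert_commute)

text \<open>
  The edges to \<open>b0\<close> are never deleted. They make the sums over edges meeting a set of moving
  vertices nontrivial, which keeps solutions from escaping to infinity. Edges between two pins
  are allowed because contractions produce them.
\<close>

locale pinned_graph =
  fixes V U B :: "'a set" and a :: "'a \<Rightarrow> complex" and b0 :: 'a and E :: "'a set set"
  assumes finite_V: "finite V" and UV: "U \<subseteq> V" and BV: "B \<subseteq> V" and disj: "U \<inter> B = {}"
    and b0: "b0 \<in> B" and inj_a: "inj_on a B" and a_nz: "\<And>b. b \<in> B \<Longrightarrow> a b \<noteq> 0"
    and edge: "\<And>e. e \<in> E \<Longrightarrow> \<exists>x y. e = {x, y} \<and> x \<noteq> y \<and> x \<in> U \<union> B \<and> y \<in> U \<union> B"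
    and pinned: "\<And>x. x \<in> U \<Longrightarrow> {x, b0} \<in> E"
begin

lemma edgeD: "{x, y} \<in> E \<Longrightarrow> x \<noteq> y \<and> x \<in> U \<union> B \<and> y \<in> U \<union> B"
  using edge[of "{x, y}"] by (auto simp: doubleton_eq_iff)

lemma finite_U: "finite U"
  using finite_subset[OF UV finite_V] .

lemma wt_nz: "wt E q x y \<noteq> 0 \<Longrightarrow> {x, y} \<in> E"
  by (auto simp: wt_def split: if_splits)

lemma wt_diag [simp]: "wt E q x x = 0"
  using edgeD[of x x] by (auto simp: wt_def)

end

text \<open>
  For the terms inside \<open>T\<close>, the contributions of \<open>(x, y)\<close> and \<open>(y, x)\<close> add up to \<open>c x y\<close>, whatever the
  positions are.
\<close>

lemma weighted_sum_identity:
  fixes c :: "'a \<Rightarrow> 'a \<Rightarrow> complex"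
  assumes V: "finite V" and T: "T \<subseteq> V" and sym: "\<And>x y. c x y = c y x"
    and nz: "\<And>x y. c x y \<noteq> 0 \<Longrightarrow> w x \<noteq> w y"
  shows "(\<Sum>x\<in>T. (w x - p) * (\<Sum>y\<in>V. c x y / (w x - w y))) =
     (\<Sum>x\<in>T. \<Sum>y\<in>T. c x y) / 2 + (\<Sum>x\<in>T. \<Sum>y\<in>V - T. c x y * (w x - p) / (w x - w y))"
proof -
  let ?f = "\<lambda>x y. c x y * (w x - p) / (w x - w y)"
  have "(\<Sum>x\<in>T. \<Sum>y\<in>T. ?f x y) + (\<Sum>x\<in>T. \<Sum>y\<in>T. ?f x y) = (\<Sum>x\<in>T. \<Sum>y\<in>T. ?f x y + ?f y x)"
    by (subst (2) sum.swap) (simp add: sum.distrib)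
  also have "\<dots> = (\<Sum>x\<in>T. \<Sum>y\<in>T. c x y)"
  proof (intro sum.cong refl)
    fix x y
    show "?f x y + ?f y x = c x y"
    proof (cases "c x y = 0")
      case True then show ?thesis using sym[of x y] by simp
    next
      case False
      then have "w x - w y \<noteq> 0" using nz by simp
      moreover have "?f y x = - (c x y * (w y - p) / (w x - w y))"
        using sym[of x y] by (metis minus_diff_eq minus_divide_right)
      ultimately show ?thesis by (simp add: diff_divide_distrib[symmetric] right_diff_distrib[symmetric])
    qed
  qed
  finally have half: "(\<Sum>x\<in>T. \<Sum>y\<in>T. ?f x y) = (\<Sum>x\<in>T. \<Sum>y\<in>T. c x y) / 2"
    by (simp add: eq_divide_eq mult.commute[of _ 2] del: times_divide_eq_left)
  have "(\<Sum>x\<in>T. (w x - p) * (\<Sum>y\<in>V. c x y / (w x - w y))) = (\<Sum>x\<in>T. \<Sum>y\<in>V. ?f x y)"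
    by (simp add: sum_distrib_left mult.commute)
  also have "\<dots> = (\<Sum>x\<in>T. (\<Sum>y\<in>T. ?f x y) + (\<Sum>y\<in>V - T. ?f x y))"
    using sum.subset_diff[OF T V] by (intro sum.cong refl) (simp add: add.commute)
  finally show ?thesis unfolding sum.distrib half .
qed

section \<open>Contraction of an edge\<close>

text \<open>
  Contraction merges \<open>u\<close> into \<open>v\<close>. If \<open>v\<close> is a pin, then \<open>u\<close> is pinned at the same place.
\<close>

definition contr_edges :: "'a \<Rightarrow> 'a \<Rightarrow> 'a set set \<Rightarrow> 'a set set" where
  "contr_edges u v E = {e \<in> E. u \<notin> e} \<union> {{v, y} | y. {u, y} \<in> E}"

text \<open>
  Parallel edges become one edge, and their weights are added.
\<close>

definition contr_wt :: "'a \<Rightarrow> 'a \<Rightarrow> 'a set set \<Rightarrow> ('a set \<Rightarrow> complex) \<Rightarrow> 'a set \<Rightarrow> complex" where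
  "contr_wt u v E q e = (if e \<in> E then q e else 0) +
     (if v \<in> e \<and> insert u (e - {v}) \<in> E then q (insert u (e - {v})) else 0)"

text \<open>
  Here \<open>E\<close> is the graph after deletion of the edge \<open>{u, v}\<close>; the original graph is obtained from it by
  inserting this edge.
\<close>

locale contraction = pinned_graph +
  fixes u v assumes u: "u \<in> U" and v: "v \<in> U \<union> B" and uv: "u \<noteq> v" and vb0: "v \<noteq> b0" and notin: "{u, v} \<notin> E"
begin

lemma contr_edge_iff:
  assumes "x \<noteq> u" "y \<noteq> u"
  shows "{x, y} \<in> contr_edges u v E \<longleftrightarrow> {x, y} \<in> E \<or> (x = v \<and> {u, y} \<in> E) \<or> (y = v \<and> {u, x} \<in> E)"
  using assms unfolding contr_edges_def by (auto simp: doubleton_eq_iff)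

lemma contr_edge_u: "{x, u} \<notin> contr_edges u v E"
proof
  assume "{x, u} \<in> contr_edges u v E"
  then obtain y where y: "{x, u} = {v, y}" "{u, y} \<in> E" by (auto simp: contr_edges_def)
  then have "y = u" using uv by (auto simp: doubleton_eq_iff)
  then show False using y(2) edgeD[of u u] by simp
qed

lemma contr_wt_eq:
  assumes "x \<noteq> u" "y \<noteq> u"
  shows "wt (contr_edges u v E) (contr_wt u v E q) x y =
    wt E q x y + (if x = v then wt E q u y else 0) + (if y = v then wt E q u x else 0)"
proof -
  consider "x = v" "y = v" | "x = v" "y \<noteq> v" | "x \<noteq> v" "y = v" | "x \<noteq> v" "y \<noteq> v" by blast
  then show ?thesis
  proof cases
    case 1
    then show ?thesis using contr_edge_iff[OF assms] edgeD[of v v] notin by (auto simp: wt_def)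
  next
    case 2
    then have "insert u ({v, y} - {v}) = {u, y}" by auto
    then show ?thesis using 2 contr_edge_iff[OF assms] by (auto simp: wt_def contr_wt_def)
  next
    case 3
    then have "insert u ({x, v} - {v}) = {u, x}" by auto
    then show ?thesis using 3 contr_edge_iff[OF assms] by (auto simp: wt_def contr_wt_def)
  next
    case 4
    then show ?thesis using contr_edge_iff[OF assms] by (auto simp: wt_def contr_wt_def)
  qed
qed

lemma contr_wt_u: "wt (contr_edges u v E) q x u = 0"
  using contr_edge_u[of x] by (simp add: wt_def)

text \<open>
  The neighbours of the merged vertex are those of \<open>v\<close> and of \<open>u\<close>. Hence the equation at \<open>v\<close> in the
  contracted graph is the sum of the equations at \<open>u\<close> and \<open>v\<close>, evaluated where both
  vertices coincide.
\<close>

lemma contr_sum: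
  assumes x: "x \<noteq> u" and f: "f u = f v"
  shows "(\<Sum>y\<in>V. wt (contr_edges u v E) (contr_wt u v E q) x y * f y) =
     (\<Sum>y\<in>V. wt E q x y * f y) + (if x = v then \<Sum>y\<in>V. wt E q u y * f y else 0)"
proof -
  have uV: "u \<in> V" "v \<in> V" using u v UV BV by auto
  have "(\<Sum>y\<in>V. wt (contr_edges u v E) (contr_wt u v E q) x y * f y) =
     (\<Sum>y\<in>V - {u}. wt (contr_edges u v E) (contr_wt u v E q) x y * f y)"
    by (subst sum.remove[OF finite_V uV(1)]) (simp add: contr_wt_u)
  also have "\<dots> = (\<Sum>y\<in>V - {u}. wt E q x y * f y + (if x = v then wt E q u y * f y else 0) +
      (if y = v then wt E q u x * f v else 0))"
    using contr_wt_eq[OF x] by (intro sum.cong refl) (auto simp: algebra_simps)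
  also have "\<dots> = (\<Sum>y\<in>V - {u}. wt E q x y * f y) + (if x = v then \<Sum>y\<in>V - {u}. wt E q u y * f y else 0) + wt E q x u * f u"
    using uV uv finite_V f by (simp add: sum.distrib wt_commute[of E q x u])
  also have "\<dots> = (\<Sum>y\<in>V. wt E q x y * f y) + (if x = v then \<Sum>y\<in>V. wt E q u y * f y else 0)"
    using sum.remove[OF finite_V uV(1), of "\<lambda>y. wt E q x y * f y"]
      sum.remove[OF finite_V uV(1), of "\<lambda>y. wt E q u y * f y"] by simp
  finally show ?thesis .
qed

lemma contr_lapl:
  assumes "x \<noteq> u"
  shows "lapl V (contr_edges u v E) (contr_wt u v E q) w x =
     lapl V E q (w(u := w v)) x + (if x = v then lapl V E q (w(u := w v)) u else 0)"
proof -
  have "lapl V (contr_edges u v E) (contr_wt u v E q) w x =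
     (\<Sum>y\<in>V. wt (contr_edges u v E) (contr_wt u v E q) x y * (1 / (w x - (w(u := w v)) y)))"
    unfolding lapl_def by (intro sum.cong) (auto simp: contr_wt_u)
  also have "\<dots> = lapl V E q (w(u := w v)) x + (if x = v then lapl V E q (w(u := w v)) u else 0)"
    using assms uv unfolding lapl_def by (subst contr_sum) auto
  finally show ?thesis .
qed

lemma contr_dlapl:
  assumes "x \<noteq> u"
  shows "dlapl V (contr_edges u v E) (contr_wt u v E q) w h x =
     dlapl V E q (w(u := w v)) (h(u := h v)) x + (if x = v then dlapl V E q (w(u := w v)) (h(u := h v)) u else 0)"
proof -
  have "dlapl V (contr_edges u v E) (contr_wt u v E q) w h x =
     (\<Sum>y\<in>V. wt (contr_edges u v E) (contr_wt u v E q) x y * ((h x - (h(u := h v)) y) / (w x - (w(u := w v)) y)\<^sup>2))"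
    unfolding dlapl_def by (intro sum.cong) (auto simp: contr_wt_u)
  also have "\<dots> = dlapl V E q (w(u := w v)) (h(u := h v)) x + (if x = v then dlapl V E q (w(u := w v)) (h(u := h v)) u else 0)"
    using assms uv unfolding dlapl_def by (subst contr_sum) auto
  finally show ?thesis .
qed

lemma pinned_graph_contr: "pinned_graph V (U - {u}) B a b0 (contr_edges u v E)"
proof unfold_locales
  show "\<exists>x y. e = {x, y} \<and> x \<noteq> y \<and> x \<in> U - {u} \<union> B \<and> y \<in> U - {u} \<union> B" if e: "e \<in> contr_edges u v E" for e
  proof -
    consider "e \<in> E" "u \<notin> e" | y where "e = {v, y}" "{u, y} \<in> E" 
      using e unfolding contr_edges_def by blast
    then show ?thesis
    proof cases
      case 1
      then obtain x y where "e = {x, y}" "x \<noteq> y" "x \<in> U \<union> B" "y \<in> U \<union> B" using edge by blast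
      then show ?thesis using 1 by blast
    next
      case 2
      then have "y \<noteq> u" "y \<noteq> v" "y \<in> U \<union> B" using edgeD[of u y] notin by auto
      then show ?thesis using 2 v uv by blast
    qed
  qed
  have "u \<noteq> b0" using u b0 disj by auto
  then show "{x, b0} \<in> contr_edges u v E" if "x \<in> U - {u}" for x
    using that pinned by (auto simp: contr_edges_def)
qed (use finite_V UV BV disj b0 inj_a a_nz in auto)

lemma crit_contr_no_collision:
  assumes "w \<in> crit V (U - {u}) a (contr_edges u v E) q" "{x, y} \<in> E"
  shows "(w(u := w v)) x \<noteq> (w(u := w v)) y"
proof -
  have w: "\<And>x y. {x, y} \<in> contr_edges u v E \<Longrightarrow> w x \<noteq> w y" using assms(1) by (auto simp: crit_def)
  have xy: "x \<noteq> y" using edgeD[OF assms(2)] by simp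
  consider "x = u" "y \<noteq> u" | "x \<noteq> u" "y = u" | "x \<noteq> u" "y \<noteq> u" using xy by blast
  then show ?thesis
  proof cases
    case 1 then show ?thesis using w[of v y] contr_edge_iff[of v y] uv assms(2) by simp
  next
    case 2 then show ?thesis using w[of x v] contr_edge_iff[of x v] uv assms(2) by (simp add: insert_commute)
  next
    case 3 then show ?thesis using w[of x y] contr_edge_iff[of x y] assms(2) by simp
  qed
qed

end

section \<open>Limits of critical points\<close>

text \<open>
  The first clause concerns vertices that tend to infinity: twice the sum over the edges meeting \<open>S\<close>.
  The second one concerns vertices that collide; since pins have distinct positions, at most one of
  them takes part in a collision.
\<close>

definition nonresonant :: "'a set \<Rightarrow> 'a set \<Rightarrow> 'a set \<Rightarrow> 'a set set \<Rightarrow> ('a set \<Rightarrow> complex) \<Rightarrow> bool" where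
  "nonresonant V U B E q \<longleftrightarrow>
     (\<forall>S\<subseteq>U. S \<noteq> {} \<longrightarrow> (\<Sum>x\<in>S. \<Sum>y\<in>S. wt E q x y) + 2 * (\<Sum>x\<in>S. \<Sum>y\<in>V - S. wt E q x y) \<noteq> 0) \<and>
     (\<forall>S\<subseteq>U \<union> B. (\<forall>b\<in>S \<inter> B. \<forall>c\<in>S \<inter> B. b = c) \<longrightarrow> (\<exists>x\<in>S. \<exists>y\<in>S. {x, y} \<in> E) \<longrightarrow>
        (\<Sum>x\<in>S. \<Sum>y\<in>S. wt E q x y) \<noteq> 0)"

lemma subsequence_converging_or_diverging:
  fixes X :: "nat \<Rightarrow> 'a \<Rightarrow> complex"
  assumes "finite U"
  shows "\<exists>r::nat \<Rightarrow> nat. strict_mono r \<and>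
    (\<forall>x\<in>U. convergent (\<lambda>n. X (r n) x) \<or> filterlim (\<lambda>n. X (r n) x) at_infinity sequentially)"
  using assms
proof (induction U rule: finite_induct)
  case empty
  show ?case by (rule exI[of _ "\<lambda>n. n"]) (simp add: strict_mono_def)
next
  case (insert x U)
  then obtain r where r: "strict_mono r"
    "\<forall>x\<in>U. convergent (\<lambda>n. X (r n) x) \<or> filterlim (\<lambda>n. X (r n) x) at_infinity sequentially" by blast
  have keep: "convergent (\<lambda>n. X (r (s n)) y) \<or> filterlim (\<lambda>n. X (r (s n)) y) at_infinity sequentially"
    if "y \<in> U" "strict_mono s" for y s
    using r(2)[rule_format, OF that(1)]
  proof
    assume "convergent (\<lambda>n. X (r n) y)"
    from convergent_subseq_convergent[OF this that(2)] show ?thesis by (simp add: o_def)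
  next
    assume "filterlim (\<lambda>n. X (r n) y) at_infinity sequentially"
    from filterlim_compose[OF this filterlim_subseq[OF that(2)]] show ?thesis by simp
  qed
  show ?case
  proof (cases "\<exists>M. infinite {n. cmod (X (r n) x) \<le> M}")
    case True
    then obtain M where M: "infinite {n. cmod (X (r n) x) \<le> M}" by blast
    define s where "s = enumerate {n. cmod (X (r n) x) \<le> M}"
    have s: "strict_mono s" "\<And>n. cmod (X (r (s n)) x) \<le> M"
      using strict_mono_enumerate[OF M] enumerate_in_set[OF M] by (auto simp: s_def)
    then have "bounded (range (\<lambda>n. X (r (s n)) x))" by (auto simp: bounded_iff)
    then obtain l k where k: "strict_mono k" "((\<lambda>n. X (r (s n)) x) \<circ> k) \<longlonglongrightarrow> l"
      using bounded_imp_convergent_subsequence by blast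
    show ?thesis
    proof (intro exI[of _ "\<lambda>n. r (s (k n))"] conjI ballI)
      show "strict_mono (\<lambda>n. r (s (k n)))"
        using r(1) s(1) k(1) by (simp add: strict_mono_def)
      fix y assume "y \<in> insert x U"
      moreover have "strict_mono (\<lambda>n. s (k n))" using s(1) k(1) by (simp add: strict_mono_def)
      ultimately show "convergent (\<lambda>n. X (r (s (k n))) y) \<or> filterlim (\<lambda>n. X (r (s (k n))) y) at_infinity sequentially"
        using keep[of y "\<lambda>n. s (k n)"] k(2) by (auto simp: o_def convergent_def)
    qed
  next
    case False
    have "filterlim (\<lambda>n. cmod (X (r n) x)) at_top sequentially"
      unfolding filterlim_at_top
    proof
      fix Z
      have "finite {n. cmod (X (r n) x) \<le> Z}" using False by blast
      then have "\<forall>\<^sub>F n in sequentially. \<not> cmod (X (r n) x) \<le> Z"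
        by (simp add: cofinite_eq_sequentially[symmetric] eventually_cofinite)
      then show "\<forall>\<^sub>F n in sequentially. Z \<le> cmod (X (r n) x)" by (rule eventually_mono) auto
    qed
    then have "filterlim (\<lambda>n. X (r n) x) at_infinity sequentially"
      by (rule filterlim_norm_at_top_imp_at_infinity)
    then show ?thesis using r by blast
  qed
qed

lemma tendsto_ratio_one:
  fixes f g :: "nat \<Rightarrow> complex"
  assumes f: "filterlim f at_infinity sequentially" and g: "g \<longlonglongrightarrow> l"
  shows "(\<lambda>n. f n / (f n - g n)) \<longlonglongrightarrow> 1"
proof -
  have "(\<lambda>n. g n / f n) \<longlonglongrightarrow> 0" by (rule tendsto_divide_0[OF g f])
  then have "(\<lambda>n. 1 / (1 - g n / f n)) \<longlonglongrightarrow> 1 / (1 - 0)" by (intro tendsto_intros) simp_all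
  moreover have "\<forall>\<^sub>F n in sequentially. 1 / (1 - g n / f n) = f n / (f n - g n)"
  proof -
    have "\<forall>\<^sub>F n in sequentially. f n \<noteq> 0"
      using f by (rule filterlim_at_infinity_imp_eventually_ne)
    then show ?thesis by eventually_elim (simp add: field_simps)
  qed
  ultimately show ?thesis by (simp add: tendsto_cong)
qed

text \<open>
  Apply \<open>weighted_sum_identity\<close> with \<open>p = 0\<close> to the set \<open>S\<close> of diverging vertices: if \<open>w x\<close> diverges and
  \<open>w y\<close> converges, then \<open>w x / (w x - w y)\<close> tends to \<open>1\<close>.
\<close>

lemma crit_limit_finite:
  assumes G: "pinned_graph V U B a b0 E" and lim: "\<And>x y. (\<lambda>n. wt E (q n) x y) \<longlonglongrightarrow> c x y"
    and w: "\<And>n. w n \<in> crit V U a E (q n)"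
    and div: "x0 \<in> U" "filterlim (\<lambda>n. w n x0) at_infinity sequentially"
    and all: "\<And>x. x \<in> U \<Longrightarrow> convergent (\<lambda>n. w n x) \<or> filterlim (\<lambda>n. w n x) at_infinity sequentially"
  shows "\<exists>S\<subseteq>U. S \<noteq> {} \<and> (\<Sum>x\<in>S. \<Sum>y\<in>S. c x y) + 2 * (\<Sum>x\<in>S. \<Sum>y\<in>V - S. c x y) = 0"
proof -
  interpret pinned_graph V U B a b0 E by (rule G)
  let ?S = "{x \<in> U. filterlim (\<lambda>n. w n x) at_infinity sequentially}"
  have SV: "?S \<subseteq> V" using UV by auto
  have conv: "convergent (\<lambda>n. w n y)" if "y \<in> V - ?S" for y
  proof (cases "y \<in> U")
    case True then show ?thesis using that all by auto
  next
    case False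
    then have "w n y = a y" for n using w[of n] by (simp add: crit_def)
    then show ?thesis by (simp add: convergent_const)
  qed
  have id: "0 = (\<Sum>x\<in>?S. \<Sum>y\<in>?S. wt E (q n) x y) / 2 +
      (\<Sum>x\<in>?S. \<Sum>y\<in>V - ?S. wt E (q n) x y * (w n x - 0) / (w n x - w n y))" for n
  proof -
    have "(\<Sum>x\<in>?S. (w n x - 0) * (\<Sum>y\<in>V. wt E (q n) x y / (w n x - w n y))) = 0"
      using w[of n] by (intro sum.neutral) (auto simp: crit_def lapl_def)
    moreover have "w n x \<noteq> w n y" if "wt E (q n) x y \<noteq> 0" for x y
      using wt_nz[OF that] w[of n] by (auto simp: crit_def)
    ultimately show ?thesis
      using weighted_sum_identity[OF finite_V SV, of "wt E (q n)" "w n" 0] wt_commute by metis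
  qed
  have "(\<lambda>n. (\<Sum>x\<in>?S. \<Sum>y\<in>?S. wt E (q n) x y) / 2 +
      (\<Sum>x\<in>?S. \<Sum>y\<in>V - ?S. wt E (q n) x y * (w n x - 0) / (w n x - w n y))) \<longlonglongrightarrow>
      (\<Sum>x\<in>?S. \<Sum>y\<in>?S. c x y) / 2 + (\<Sum>x\<in>?S. \<Sum>y\<in>V - ?S. c x y * 1)"
  proof (intro tendsto_add tendsto_divide tendsto_sum lim tendsto_const)
    fix x y assume x: "x \<in> ?S" and y: "y \<in> V - ?S"
    obtain l where "(\<lambda>n. w n y) \<longlonglongrightarrow> l" using conv[OF y] by (auto simp: convergent_def)
    then have "(\<lambda>n. wt E (q n) x y * (w n x / (w n x - w n y))) \<longlonglongrightarrow> c x y * 1"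
      using x by (intro tendsto_mult lim tendsto_ratio_one) auto
    then show "(\<lambda>n. wt E (q n) x y * (w n x - 0) / (w n x - w n y)) \<longlonglongrightarrow> c x y * 1" by simp
  qed simp
  then have "(\<lambda>n. 0) \<longlonglongrightarrow> (\<Sum>x\<in>?S. \<Sum>y\<in>?S. c x y) / 2 + (\<Sum>x\<in>?S. \<Sum>y\<in>V - ?S. c x y * 1)"
    unfolding id[symmetric] .
  then have "0 = (\<Sum>x\<in>?S. \<Sum>y\<in>?S. c x y) / 2 + (\<Sum>x\<in>?S. \<Sum>y\<in>V - ?S. c x y)"
    by (simp add: LIMSEQ_const_iff)
  then have "(\<Sum>x\<in>?S. \<Sum>y\<in>?S. c x y) + 2 * (\<Sum>x\<in>?S. \<Sum>y\<in>V - ?S. c x y) = 0"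
    by (simp add: field_simps)
  then show ?thesis using div by (intro exI[of _ ?S]) auto
qed

text \<open>
  Apply \<open>weighted_sum_identity\<close> to the moving vertices in \<open>S\<close>, with \<open>p\<close> the point of collision. Terms
  leaving \<open>S\<close> vanish in the limit, since their numerators tend to \<open>0\<close> and their denominators do not;
  terms towards a pin at \<open>p\<close> reduce to the weight itself.
\<close>

lemma crit_limit_collision:
  assumes G: "pinned_graph V U B a b0 E" and lim: "\<And>x y. (\<lambda>n. wt E (q n) x y) \<longlonglongrightarrow> c x y"
    and w: "\<And>n. w n \<in> crit V U a E (q n)" and wl: "\<And>x. (\<lambda>n. w n x) \<longlonglongrightarrow> l x"
    and S: "S = {x \<in> U \<union> B. l x = p}"
  shows "(\<forall>b\<in>S \<inter> B. \<forall>c\<in>S \<inter> B. b = c) \<and> (\<Sum>x\<in>S. \<Sum>y\<in>S. c x y) = 0"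
proof -
  interpret pinned_graph V U B a b0 E by (rule G)
  have la: "l b = a b" if "b \<notin> U" for b
  proof -
    have "w n b = a b" for n using w[of n] that by (simp add: crit_def)
    then show ?thesis using wl[of b] by (simp add: LIMSEQ_const_iff)
  qed
  have one: "\<forall>b\<in>S \<inter> B. \<forall>c\<in>S \<inter> B. b = c"
  proof (intro ballI)
    fix b c assume bc: "b \<in> S \<inter> B" "c \<in> S \<inter> B"
    then have "b \<notin> U" "c \<notin> U" "l b = l c" using disj S by auto
    then have "a b = a c" using la[of b] la[of c] by simp
    then show "b = c" using inj_a bc by (auto dest: inj_onD)
  qed
  have csym: "c x y = c y x" for x y
  proof -
    have "(\<lambda>n. wt E (q n) y x) = (\<lambda>n. wt E (q n) x y)" by (rule ext, rule wt_commute)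
    then show ?thesis using LIMSEQ_unique[OF lim[of x y]] lim[of y x] by simp
  qed
  have cnz: "{x, y} \<in> E" if "c x y \<noteq> 0" for x y
  proof (rule ccontr)
    assume "{x, y} \<notin> E"
    then have "wt E (q n) x y = 0" for n by (simp add: wt_def)
    then show False using lim[of x y] that by (simp add: LIMSEQ_const_iff)
  qed
  have cdiag: "c x x = 0" for x using cnz[of x x] edgeD[of x x] by auto
  let ?T = "S \<inter> U"
  have TV: "?T \<subseteq> V" using UV by auto
  have fin: "finite ?T" "finite V" using finite_subset[OF TV finite_V] finite_V by auto
  have id: "0 = (\<Sum>x\<in>?T. \<Sum>y\<in>?T. wt E (q n) x y) / 2 +
      (\<Sum>x\<in>?T. \<Sum>y\<in>V - ?T. wt E (q n) x y * (w n x - p) / (w n x - w n y))" for n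
  proof -
    have "(\<Sum>x\<in>?T. (w n x - p) * (\<Sum>y\<in>V. wt E (q n) x y / (w n x - w n y))) = 0"
      using w[of n] by (intro sum.neutral) (auto simp: crit_def lapl_def)
    moreover have "w n x \<noteq> w n y" if "wt E (q n) x y \<noteq> 0" for x y
      using wt_nz[OF that] w[of n] by (auto simp: crit_def)
    ultimately show ?thesis
      using weighted_sum_identity[OF finite_V TV, of "wt E (q n)" "w n" p] wt_commute by metis
  qed
  have "(\<lambda>n. (\<Sum>x\<in>?T. \<Sum>y\<in>?T. wt E (q n) x y) / 2 +
      (\<Sum>x\<in>?T. \<Sum>y\<in>V - ?T. wt E (q n) x y * (w n x - p) / (w n x - w n y))) \<longlonglongrightarrow>
      (\<Sum>x\<in>?T. \<Sum>y\<in>?T. c x y) / 2 + (\<Sum>x\<in>?T. \<Sum>y\<in>V - ?T. if y \<in> S then c x y else 0)"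
  proof (intro tendsto_add tendsto_divide tendsto_sum lim tendsto_const)
    fix x y assume x: "x \<in> ?T" and y: "y \<in> V - ?T"
    show "(\<lambda>n. wt E (q n) x y * (w n x - p) / (w n x - w n y)) \<longlonglongrightarrow> (if y \<in> S then c x y else 0)"
    proof (cases "y \<in> S")
      case True
      \<comment> \<open>Then \<open>y\<close> is pinned at \<open>p\<close>.\<close>
      then have "y \<notin> U" "l y = p" using y S by auto
      then have "w n y = p" for n using la[of y] w[of n] by (simp add: crit_def)
      moreover have "wt E (q n) x y * (w n x - p) / (w n x - p) = wt E (q n) x y" if "w n y = p" for n
      proof (cases "wt E (q n) x y = 0")
        case False
        then have "w n x \<noteq> p" using wt_nz[OF False] w[of n] that by (auto simp: crit_def)
        then show ?thesis by simp
      qed simp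
      ultimately show ?thesis using True lim[of x y] by simp
    next
      case False
      show ?thesis
      proof (cases "y \<in> U \<union> B")
        case True
        then have "l y \<noteq> p" using False S by auto
        then have "(\<lambda>n. wt E (q n) x y * (w n x - p) / (w n x - w n y)) \<longlonglongrightarrow> c x y * (l x - p) / (l x - l y)"
          using x S by (intro tendsto_intros lim wl) auto
        moreover have "l x = p" using x S by simp
        ultimately show ?thesis using False by simp
      next
        case nUB: False
        then have "{x, y} \<notin> E" using edgeD[of x y] by auto
        then have "wt E (q n) x y = 0" for n by (simp add: wt_def)
        then show ?thesis using False by simp
      qed
    qed
  qed simp
  then have "(\<lambda>n. 0) \<longlonglongrightarrow> (\<Sum>x\<in>?T. \<Sum>y\<in>?T. c x y) / 2 + (\<Sum>x\<in>?T. \<Sum>y\<in>V - ?T. if y \<in> S then c x y else 0)"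
    unfolding id[symmetric] .
  then have z: "0 = (\<Sum>x\<in>?T. \<Sum>y\<in>?T. c x y) / 2 + (\<Sum>x\<in>?T. \<Sum>y\<in>V - ?T. if y \<in> S then c x y else 0)"
    by (simp add: LIMSEQ_const_iff)
  let ?R = "S \<inter> B"
  have SV: "S \<subseteq> V" using UV BV S by auto
  have ST: "S = ?T \<union> ?R" "?T \<inter> ?R = {}" using S disj by auto
  have finS: "finite S" "finite ?R" using finite_subset[OF SV finite_V] by auto
  have "(\<Sum>y\<in>V - ?T. if y \<in> S then c x y else 0) = (\<Sum>y\<in>?R. c x y)" for x
  proof -
    have "{y \<in> V - ?T. y \<in> S} = ?R" using SV ST disj by auto
    then show ?thesis using finite_V by (simp add: sum.inter_filter[symmetric])
  qed
  then have z': "0 = (\<Sum>x\<in>?T. \<Sum>y\<in>?T. c x y) / 2 + (\<Sum>x\<in>?T. \<Sum>y\<in>?R. c x y)" using z by simp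
  have RR: "(\<Sum>x\<in>?R. \<Sum>y\<in>?R. c x y) = 0"
  proof (intro sum.neutral ballI)
    fix x y assume "x \<in> ?R" "y \<in> ?R"
    then have "x = y" using one by blast
    then show "c x y = 0" by (simp add: cdiag)
  qed
  have un: "(\<Sum>y\<in>S. f y) = (\<Sum>y\<in>?T. f y) + (\<Sum>y\<in>?R. f y)" for f :: "'a \<Rightarrow> complex"
    using sum.union_disjoint[OF fin(1) finS(2) ST(2), of f] ST(1) by metis
  have "(\<Sum>x\<in>S. \<Sum>y\<in>S. c x y) = (\<Sum>x\<in>?T. \<Sum>y\<in>?T. c x y) + (\<Sum>x\<in>?T. \<Sum>y\<in>?R. c x y) +
     ((\<Sum>x\<in>?R. \<Sum>y\<in>?T. c x y) + (\<Sum>x\<in>?R. \<Sum>y\<in>?R. c x y))"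
    unfolding un by (simp add: sum.distrib)
  also have "(\<Sum>x\<in>?R. \<Sum>y\<in>?T. c x y) = (\<Sum>x\<in>?T. \<Sum>y\<in>?R. c x y)"
    by (subst sum.swap) (simp add: csym)
  finally have "(\<Sum>x\<in>S. \<Sum>y\<in>S. c x y) = 2 * ((\<Sum>x\<in>?T. \<Sum>y\<in>?T. c x y) / 2 + (\<Sum>x\<in>?T. \<Sum>y\<in>?R. c x y))"
    using RR by (simp add: field_simps)
  then show ?thesis using one z' by simp
qed

section \<open>Counting critical points after inserting an edge of small weight\<close>

lemma lapl_tendsto:
  assumes "\<And>x y. {x, y} \<in> E \<Longrightarrow> l x \<noteq> l y" "\<And>x. (\<lambda>n. w n x) \<longlonglongrightarrow> l x"
  shows "(\<lambda>n. lapl V E q (w n) x) \<longlonglongrightarrow> lapl V E q l x"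
  unfolding lapl_def
proof (rule tendsto_sum)
  fix y
  show "(\<lambda>n. wt E q x y / (w n x - w n y)) \<longlonglongrightarrow> wt E q x y / (l x - l y)"
  proof (cases "{x, y} \<in> E")
    case True then show ?thesis using assms(1)[OF True] by (intro tendsto_intros assms(2)) simp
  next
    case False then show ?thesis by (simp add: wt_def)
  qed
qed

lemma lapl_has_derivative:
  assumes "\<And>x y. {x, y} \<in> E \<Longrightarrow> w x \<noteq> w y"
  shows "((\<lambda>s. lapl V E q (\<lambda>v. w v + s * h v) x) has_field_derivative - dlapl V E q w h x) (at 0)"
proof -
  have "((\<lambda>s. wt E q x y / ((w x + s * h x) - (w y + s * h y))) has_field_derivative
      - (wt E q x y * (h x - h y) / (w x - w y)\<^sup>2)) (at 0)" for y
  proof (cases "{x, y} \<in> E")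
    case True
    then show ?thesis using assms[OF True]
      by (auto intro!: derivative_eq_intros simp: power2_eq_square)
  next
    case False then show ?thesis by (simp add: wt_def)
  qed
  then show ?thesis unfolding lapl_def dlapl_def sum_negf[symmetric] by (intro DERIV_sum) 
qed

context contraction
begin

lemma uv_V: "u \<in> V" "v \<in> V" using u v UV BV by auto

lemma u_ne_b0: "u \<noteq> b0"
  using u b0 disj by auto

lemma pinned_graph_insert: "pinned_graph V U B a b0 (insert {u, v} E)"
proof unfold_locales
  show "\<exists>x y. e = {x, y} \<and> x \<noteq> y \<and> x \<in> U \<union> B \<and> y \<in> U \<union> B" if "e \<in> insert {u, v} E" for e
    using that edge u v uv by blast
qed (use finite_V UV BV disj b0 inj_a a_nz pinned in auto)

lemma wt_insert:
  "wt (insert {u, v} E) (q({u, v} := t)) x y = wt E q x y + (if {x, y} = {u, v} then t else 0)"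
  using notin by (auto simp: wt_def)

lemma lapl_insert:
  "lapl V (insert {u, v} E) (q({u, v} := t)) w x = lapl V E q w x +
     (if x = u then t / (w u - w v) else if x = v then - (t / (w u - w v)) else 0)"
proof -
  have "lapl V (insert {u, v} E) (q({u, v} := t)) w x =
      lapl V E q w x + (\<Sum>y\<in>V. (if {x, y} = {u, v} then t else 0) / (w x - w y))"
    unfolding lapl_def wt_insert by (simp add: add_divide_distrib sum.distrib)
  also have "(\<Sum>y\<in>V. (if {x, y} = {u, v} then t else 0) / (w x - w y)) =
      (if x = u then t / (w u - w v) else if x = v then - (t / (w u - w v)) else 0)"
  proof -
    consider "x = u" | "x = v" "x \<noteq> u" | "x \<noteq> u" "x \<noteq> v" by blast
    then show ?thesis
    proof cases
      case 1
      then have "(\<Sum>y\<in>V. (if {x, y} = {u, v} then t else 0) / (w x - w y)) = (\<Sum>y\<in>V. if y = v then t / (w u - w v) else 0)"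
        using uv by (intro sum.cong) (auto simp: doubleton_eq_iff)
      then show ?thesis using 1 uv_V finite_V by simp
    next
      case 2
      then have "(\<Sum>y\<in>V. (if {x, y} = {u, v} then t else 0) / (w x - w y)) = (\<Sum>y\<in>V. if y = u then - (t / (w u - w v)) else 0)"
        using uv by (intro sum.cong) (auto simp: doubleton_eq_iff minus_divide_right)
      then show ?thesis using 2 uv_V finite_V by simp
    next
      case 3
      then show ?thesis by (auto intro!: sum.neutral simp: doubleton_eq_iff)
    qed
  qed
  finally show ?thesis .
qed

text \<open>
  Nonresonance of the graph without the edge \<open>{u, v}\<close> rules out escape to infinity and all collisions
  along its edges. The endpoints \<open>u\<close> and \<open>v\<close> may still collide, because the weight between
  them tends to \<open>0\<close>; the two singular terms cancel in the sum of the equations at \<open>u\<close> and \<open>v\<close>.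
\<close>

lemma crit_limits:
  assumes nonres: "nonresonant V U B E q" and t: "t \<longlonglongrightarrow> 0"
    and w: "\<And>n. w n \<in> crit V U a (insert {u, v} E) (q({u, v} := t n))"
  shows "\<exists>(r :: nat \<Rightarrow> nat) l. strict_mono r \<and> (\<forall>x. (\<lambda>n. w (r n) x) \<longlonglongrightarrow> l x) \<and> (\<forall>x y. {x, y} \<in> E \<longrightarrow> l x \<noteq> l y) \<and>
     (if l u = l v then l(u := a u) \<in> crit V (U - {u}) a (contr_edges u v E) (contr_wt u v E q)
      else l \<in> crit V U a E q)"
proof -
  obtain r :: "nat \<Rightarrow> nat" where r: "strict_mono r"
    "\<And>x. x \<in> U \<Longrightarrow> convergent (\<lambda>n. w (r n) x) \<or> filterlim (\<lambda>n. w (r n) x) at_infinity sequentially"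
    using subsequence_converging_or_diverging[OF finite_U, of w] by blast
  have tr: "(\<lambda>n. t (r n)) \<longlonglongrightarrow> 0" using LIMSEQ_subseq_LIMSEQ[OF t r(1)] by (simp add: o_def)
  have lim: "(\<lambda>n. wt (insert {u, v} E) (q({u, v} := t (r n))) x y) \<longlonglongrightarrow> wt E q x y" for x y
  proof -
    have "(\<lambda>n. wt E q x y + (if {x, y} = {u, v} then t (r n) else 0)) \<longlonglongrightarrow> wt E q x y + 0"
      using tr by (cases "{x, y} = {u, v}") (auto intro!: tendsto_intros simp del: add_0_right)
    then show ?thesis unfolding wt_insert by simp
  qed
  have conv: "convergent (\<lambda>n. w (r n) x)" for x
  proof (cases "x \<in> U")
    case False
    then have "w (r n) x = a x" for n using w[of "r n"] by (simp add: crit_def)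
    then show ?thesis by (simp add: convergent_const)
  next
    case True
    show ?thesis
    proof (rule ccontr)
      assume "\<not> ?thesis"
      then have "filterlim (\<lambda>n. w (r n) x) at_infinity sequentially" using r(2)[OF True] by blast
      from crit_limit_finite[OF pinned_graph_insert lim w True this r(2)]
      show False using nonres unfolding nonresonant_def by blast
    qed
  qed
  define l where "l x = lim (\<lambda>n. w (r n) x)" for x
  have l: "(\<lambda>n. w (r n) x) \<longlonglongrightarrow> l x" for x using conv[of x] by (simp add: l_def convergent_LIMSEQ_iff)
  have la: "l x = a x" if "x \<notin> U" for x
  proof -
    have "w (r n) x = a x" for n using w[of "r n"] that by (simp add: crit_def)
    then show ?thesis using l[of x] by (simp add: LIMSEQ_const_iff)
  qed
  have nocoll: "l x \<noteq> l y" if e: "{x, y} \<in> E" for x y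
  proof
    assume eq: "l x = l y"
    let ?S = "{z \<in> U \<union> B. l z = l x}"
    have "(\<forall>b\<in>?S \<inter> B. \<forall>c\<in>?S \<inter> B. b = c) \<and> (\<Sum>x\<in>?S. \<Sum>y\<in>?S. wt E q x y) = 0"
      by (rule crit_limit_collision[OF pinned_graph_insert lim w l refl])
    moreover have "?S \<subseteq> U \<union> B" by blast
    moreover have "\<exists>x\<in>?S. \<exists>y\<in>?S. {x, y} \<in> E" using e edgeD[OF e] eq by (intro bexI[of _ x] bexI[of _ y]) auto
    ultimately show False using nonres unfolding nonresonant_def by blast
  qed
  have A: "(\<lambda>n. lapl V E q (w (r n)) x) \<longlonglongrightarrow> lapl V E q l x" for x
    by (rule lapl_tendsto[OF nocoll l])
  have eqn: "lapl V E q (w (r n)) x + (if x = u then t (r n) / (w (r n) u - w (r n) v)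
      else if x = v then - (t (r n) / (w (r n) u - w (r n) v)) else 0) = 0" if "x \<in> U" for n x
    using w[of "r n"] that unfolding crit_def lapl_insert[symmetric] by blast
  have other: "lapl V E q l x = 0" if "x \<in> U" "x \<noteq> u" "x \<noteq> v" for x
    using A[of x] eqn[OF that(1)] that by (simp add: LIMSEQ_const_iff)
  have "if l u = l v then l(u := a u) \<in> crit V (U - {u}) a (contr_edges u v E) (contr_wt u v E q)
      else l \<in> crit V U a E q"
  proof (cases "l u = l v")
    case False
    have "(\<lambda>n. t (r n) / (w (r n) u - w (r n) v)) \<longlonglongrightarrow> 0 / (l u - l v)"
      using False by (intro tendsto_intros tr l) simp
    then have z: "(\<lambda>n. t (r n) / (w (r n) u - w (r n) v)) \<longlonglongrightarrow> 0" by simp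
    have "lapl V E q l x = 0" if x: "x \<in> U" for x
    proof -
      have "(\<lambda>n. lapl V E q (w (r n)) x + (if x = u then t (r n) / (w (r n) u - w (r n) v)
        else if x = v then - (t (r n) / (w (r n) u - w (r n) v)) else 0)) \<longlonglongrightarrow>
        lapl V E q l x + (if x = u then 0 else if x = v then - 0 else 0)"
        using z by (intro tendsto_add A) (auto intro: tendsto_minus[OF z, simplified])
      then show ?thesis unfolding eqn[OF x] by (auto simp: LIMSEQ_const_iff split: if_splits)
    qed
    then show ?thesis using False la nocoll by (simp add: crit_def)
  next
    case True
    let ?l = "l(u := a u)"
    have upd: "?l(u := ?l v) = l" using True uv by auto
    have "?l x \<noteq> ?l y" if e: "{x, y} \<in> contr_edges u v E" for x y
    proof -
      have "x \<noteq> u" "y \<noteq> u" using contr_edge_u[of y] contr_edge_u[of x] e by (auto simp: insert_commute)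
      then show ?thesis
        using contr_edge_iff[of x y] e nocoll[of x y] nocoll[of u y] nocoll[of u x] True by auto
    qed
    moreover have "lapl V (contr_edges u v E) (contr_wt u v E q) ?l x = 0" if "x \<in> U - {u}" for x
    proof (cases "x = v")
      case False
      then show ?thesis using that other contr_lapl[of x q ?l] unfolding upd by simp
    next
      case xv: True
      have "(\<lambda>n. lapl V E q (w (r n)) v + lapl V E q (w (r n)) u) \<longlonglongrightarrow> lapl V E q l v + lapl V E q l u"
        by (intro tendsto_add A)
      moreover have "lapl V E q (w (r n)) v + lapl V E q (w (r n)) u = 0" for n
        using eqn[OF u, of n] eqn[of v n] that xv uv by (simp add: eq_neg_iff_add_eq_0 add.commute)
      ultimately have "lapl V E q l v + lapl V E q l u = 0" by (simp add: LIMSEQ_const_iff)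
      then show ?thesis using xv uv contr_lapl[of v q ?l] unfolding upd by simp
    qed
    moreover have "?l x = a x" if "x \<notin> U - {u}" for x using that la by auto
    ultimately show ?thesis using True by (simp add: crit_def)
  qed
  then show ?thesis using r(1) l nocoll by blast
qed

end

text \<open>
  A purely topological bookkeeping: the sets \<open>S t\<close> are in bijection with the possible limits \<open>P\<close> if
  each limit attracts exactly one branch, every sequence comes close to some limit, and
  different limits are separated. \<open>D\<close> measures the distance to a limit in a coordinate system that may
  depend on the limit and on \<open>t\<close>.
\<close>

lemma count_near_limits:
  fixes S :: "complex \<Rightarrow> 'w set" and D :: "'p \<Rightarrow> 'w \<Rightarrow> complex \<Rightarrow> real"
  assumes P: "finite P"
    and i: "\<And>p. p \<in> P \<Longrightarrow> \<forall>\<^sub>F \<rho> in at_right 0. \<forall>\<^sub>F t in at 0. \<exists>!w. w \<in> S t \<and> D p w t < \<rho>"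
    and ii: "\<And>t w. (\<And>n::nat. t n \<noteq> 0) \<Longrightarrow> t \<longlonglongrightarrow> 0 \<Longrightarrow> (\<And>n. w n \<in> S (t n)) \<Longrightarrow>
        \<exists>p\<in>P. \<forall>\<rho>>0. \<exists>n. D p (w n) (t n) < \<rho>"
    and iii: "\<And>p p'. p \<in> P \<Longrightarrow> p' \<in> P \<Longrightarrow> p \<noteq> p' \<Longrightarrow> \<forall>\<^sub>F \<rho> in at_right 0. \<forall>\<^sub>F t in at 0. 
        \<forall>w\<in>S t. \<not> (D p w t < \<rho> \<and> D p' w t < \<rho>)"
    and iv: "\<And>p. p \<in> P \<Longrightarrow> \<forall>\<^sub>F \<rho> in at_right 0. \<forall>\<^sub>F t in at 0. \<forall>w\<in>S t. D p w t < \<rho> \<longrightarrow> Q w t"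
  shows "\<forall>\<^sub>F t in at 0. finite (S t) \<and> card (S t) = card P \<and> (\<forall>w\<in>S t. Q w t)"
proof -
  have cover: "\<forall>\<^sub>F t in at 0. \<forall>w\<in>S t. \<exists>p\<in>P. D p w t < \<rho>" if "\<rho> > 0" for \<rho>
  proof (rule ccontr)
    assume "\<not> ?thesis"
    then have "\<forall>n::nat. \<exists>t. t \<noteq> 0 \<and> cmod t < 1 / Suc n \<and> (\<exists>w\<in>S t. \<forall>p\<in>P. \<not> D p w t < \<rho>)"
      unfolding eventually_at by (auto simp: dist_norm)
    then obtain t where t: "\<And>n::nat. t n \<noteq> 0 \<and> cmod (t n) < 1 / Suc n \<and> (\<exists>w\<in>S (t n). \<forall>p\<in>P. \<not> D p w (t n) < \<rho>)"
      by metis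
    then obtain w where w: "\<And>n. w n \<in> S (t n)" "\<And>n. \<forall>p\<in>P. \<not> D p (w n) (t n) < \<rho>" by metis
    have "t \<longlonglongrightarrow> 0"
      by (rule Lim_null_comparison[OF _ LIMSEQ_Suc[OF lim_1_over_n]])
        (use t in \<open>auto intro!: always_eventually less_imp_le simp del: of_nat_Suc\<close>)
    from ii[OF _ this w(1)] t w(2) \<open>\<rho> > 0\<close> show False by blast
  qed
  have "\<forall>\<^sub>F \<rho> in at_right 0. \<rho> > 0 \<and> (\<forall>p\<in>P. \<forall>\<^sub>F t in at 0. \<exists>!w. w \<in> S t \<and> D p w t < \<rho>) \<and>
      (\<forall>p\<in>P. \<forall>p'\<in>P. p \<noteq> p' \<longrightarrow> (\<forall>\<^sub>F t in at 0. \<forall>w\<in>S t. \<not> (D p w t < \<rho> \<and> D p' w t < \<rho>))) \<and>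
      (\<forall>p\<in>P. \<forall>\<^sub>F t in at 0. \<forall>w\<in>S t. D p w t < \<rho> \<longrightarrow> Q w t)"
    using i iii iv P
    by (intro eventually_conj eventually_at_right_less eventually_ball_finite ballI) (auto intro: eventually_mono)
  from eventually_happens'[OF trivial_limit_at_right_real this]
  obtain \<rho> where \<rho>: "\<rho> > 0" "\<forall>p\<in>P. \<forall>\<^sub>F t in at 0. \<exists>!w. w \<in> S t \<and> D p w t < \<rho>"
      "\<forall>p\<in>P. \<forall>p'\<in>P. p \<noteq> p' \<longrightarrow> (\<forall>\<^sub>F t in at 0. \<forall>w\<in>S t. \<not> (D p w t < \<rho> \<and> D p' w t < \<rho>))"
      "\<forall>p\<in>P. \<forall>\<^sub>F t in at 0. \<forall>w\<in>S t. D p w t < \<rho> \<longrightarrow> Q w t"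
    by (elim exE conjE)
  have "\<forall>\<^sub>F t in at 0. \<forall>p\<in>P. \<exists>!w. w \<in> S t \<and> D p w t < \<rho>"
    using \<rho>(2) by (intro eventually_ball_finite P)
  moreover have "\<forall>\<^sub>F t in at 0. \<forall>p\<in>P. \<forall>p'\<in>P. p \<noteq> p' \<longrightarrow> (\<forall>w\<in>S t. \<not> (D p w t < \<rho> \<and> D p' w t < \<rho>))"
    using \<rho>(3) by (intro eventually_ball_finite P ballI) (auto intro: eventually_mono)
  moreover have "\<forall>\<^sub>F t in at 0. \<forall>p\<in>P. \<forall>w\<in>S t. D p w t < \<rho> \<longrightarrow> Q w t"
    using \<rho>(4) by (intro eventually_ball_finite P)
  ultimately show ?thesis using cover[OF \<rho>(1)]
  proof eventually_elim
    case (elim t)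
    define f where "f p = (THE w. w \<in> S t \<and> D p w t < \<rho>)" for p
    have f: "f p \<in> S t \<and> D p (f p) t < \<rho>" if "p \<in> P" for p
      unfolding f_def by (rule theI') (use elim(1) that in blast)
    have fu: "w = f p" if "p \<in> P" "w \<in> S t" "D p w t < \<rho>" for p w
      using elim(1) that f[OF that(1)] by blast
    have "bij_betw f P (S t)"
      unfolding bij_betw_def
    proof
      show "inj_on f P"
      proof (rule inj_onI, rule ccontr)
        fix p p' assume p: "p \<in> P" "p' \<in> P" "f p = f p'" "p \<noteq> p'"
        then show False using elim(2) f[OF p(1)] f[OF p(2)] by metis
      qed
      show "f ` P = S t" using f fu elim(4) by blast
    qed
    then have "finite (S t) \<and> card (S t) = card P"
      using P bij_betw_finite bij_betw_same_card by metis
    then show ?case using elim(3,4) by blast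
  qed
qed


lemma strict_deriv_nonzero_near:
  assumes "finite A" "finite U" "\<And>j. j \<in> A \<Longrightarrow> strict_deriv U x0 (f j) (L j)" "\<And>j. j \<in> A \<Longrightarrow> f j x0 0 \<noteq> 0"
  shows "\<exists>d>0. \<forall>j\<in>A. \<forall>t x. cmod t < d \<longrightarrow> x \<in> nball U x0 d \<longrightarrow> f j x t \<noteq> 0"
  using assms(1,3,4)
proof (induction A rule: finite_induct)
  case empty then show ?case by (auto intro: exI[of _ 1])
next
  case (insert j A)
  then obtain d where d: "d > 0" "\<forall>j\<in>A. \<forall>t x. cmod t < d \<longrightarrow> x \<in> nball U x0 d \<longrightarrow> f j x t \<noteq> 0" by auto
  have "cmod (f j x0 0) > 0" using insert.prems by simp
  then obtain d' where d': "d' > 0" "\<And>t x. cmod t < d' \<Longrightarrow> x \<in> nball U x0 d' \<Longrightarrow> cmod (f j x t - f j x0 0) < cmod (f j x0 0)"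
    using strict_deriv_continuous[OF _ assms(2), of x0 "f j" "L j"] insert.prems by (metis insertI1)
  show ?case
  proof (intro exI[of _ "min d d'"] conjI ballI allI impI)
    fix i t x assume a: "i \<in> insert j A" "cmod t < min d d'" "x \<in> nball U x0 (min d d')"
    have x: "x \<in> nball U x0 d" "x \<in> nball U x0 d'" using a(3) by (auto simp: nball_def)
    show "f i x t \<noteq> 0"
    proof (cases "i = j")
      case True
      then show ?thesis using d'(2)[of t x] a x by (auto simp: norm_minus_commute)
    next
      case False then show ?thesis using d(2) a x by auto
    qed
  qed (use d d' in auto)
qed

context contraction
begin

text \<open>
  Coordinates near a limit: the original ones if the endpoints of the new edge stay apart, and
  otherwise (\<open>\<tau>\<close> true) the rescaled difference \<open>(w u - w v) / t\<close> in place of \<open>w u\<close>.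
\<close>

definition chart :: "bool \<Rightarrow> ('a \<Rightarrow> complex) \<Rightarrow> complex \<Rightarrow> 'a \<Rightarrow> complex" where
  "chart \<tau> x t = (if \<tau> then x(u := x v + t * x u) else x)"

definition chart_inv :: "bool \<Rightarrow> ('a \<Rightarrow> complex) \<Rightarrow> complex \<Rightarrow> 'a \<Rightarrow> complex" where
  "chart_inv \<tau> w t = (if \<tau> then w(u := (w u - w v) / t) else w)"

text \<open>
  The term \<open>t / (w u - w v)\<close> of the new edge, expressed in the coordinates in a way that is regular
  at \<open>t = 0\<close>.
\<close>

definition quot :: "bool \<Rightarrow> ('a \<Rightarrow> complex) \<Rightarrow> complex \<Rightarrow> complex" where
  "quot \<tau> x t = (if \<tau> then 1 / x u else t * (1 / (x u - x v)))"

definition chart_eqn :: "('a set \<Rightarrow> complex) \<Rightarrow> bool \<Rightarrow> ('a \<Rightarrow> complex) \<Rightarrow> complex \<Rightarrow> 'a \<Rightarrow> complex" where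
  "chart_eqn q \<tau> x t z = lapl V E q (chart \<tau> x t) z +
     (if z = u then 1 else if z = v then -1 else 0) * quot \<tau> x t"

lemma chart_chart_inv: "t \<noteq> 0 \<Longrightarrow> chart \<tau> (chart_inv \<tau> w t) t = w"
  using uv by (auto simp: chart_def chart_inv_def fun_eq_iff)

lemma chart_inv_chart: "t \<noteq> 0 \<Longrightarrow> chart_inv \<tau> (chart \<tau> x t) t = x"
  using uv by (auto simp: chart_def chart_inv_def fun_eq_iff)

lemma chart_affine: "chart \<tau> (\<lambda>z. x z + s * h z) t = (\<lambda>z. chart \<tau> x t z + s * chart \<tau> h t z)"
  by (auto simp: chart_def fun_eq_iff algebra_simps)

lemma chart_eqn_eq_lapl:
  "t \<noteq> 0 \<Longrightarrow> chart_eqn q \<tau> x t z = lapl V (insert {u, v} E) (q({u, v} := t)) (chart \<tau> x t) z"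
  using uv by (auto simp: chart_eqn_def lapl_insert quot_def chart_def)

lemma strict_deriv_chart: "strict_deriv U x0 (\<lambda>x t. chart \<tau> x t z) (\<lambda>h. chart \<tau> h 0 z)"
proof (cases "\<tau> \<and> z = u")
  case True
  have "strict_deriv U x0 (\<lambda>x t. x v + t * x u) (\<lambda>h. h v + 0)"
    by (intro strict_deriv_add strict_deriv_coord strict_deriv_param_mult[OF strict_deriv_coord finite_U])
  then show ?thesis using True by (simp add: chart_def)
next
  case False
  then show ?thesis using strict_deriv_coord[of U x0 z] by (cases \<tau>) (simp_all add: chart_def)
qed

lemma strict_deriv_chart_eqn:
  assumes nocoll: "\<And>y z. {y, z} \<in> E \<Longrightarrow> chart \<tau> x0 0 y \<noteq> chart \<tau> x0 0 z"
    and "if \<tau> then x0 u \<noteq> 0 else x0 u \<noteq> x0 v"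
  shows "strict_deriv U x0 (\<lambda>x t. chart_eqn q \<tau> x t z)
    (\<lambda>h. - dlapl V E q (chart \<tau> x0 0) (chart \<tau> h 0) z +
      (if z = u then 1 else if z = v then -1 else 0) * (if \<tau> then - (h u / (x0 u)\<^sup>2) else 0))"
  unfolding chart_eqn_def
proof (rule strict_deriv_add)
  let ?W = "chart \<tau>"
  have "strict_deriv U x0 (\<lambda>x t. wt E q z y / (?W x t z - ?W x t y))
     (\<lambda>h. - (wt E q z y * (?W h 0 z - ?W h 0 y) / (?W x0 0 z - ?W x0 0 y)\<^sup>2))" for y
  proof (cases "{z, y} \<in> E")
    case True
    have "strict_deriv U x0 (\<lambda>x t. wt E q z y * (1 / (?W x t z - ?W x t y)))
     (\<lambda>h. wt E q z y * (- ((?W h 0 z - ?W h 0 y) / (?W x0 0 z - ?W x0 0 y)\<^sup>2)))"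
      by (intro strict_deriv_cmult strict_deriv_inverse[OF strict_deriv_diff[OF strict_deriv_chart strict_deriv_chart] finite_U])
        (use nocoll[OF True] in simp)
    then show ?thesis by simp
  next
    case False
    then show ?thesis using strict_deriv_const[of U x0 0] by (simp add: wt_def)
  qed
  then show "strict_deriv U x0 (\<lambda>x t. lapl V E q (?W x t) z) (\<lambda>h. - dlapl V E q (?W x0 0) (?W h 0) z)"
    unfolding lapl_def dlapl_def sum_negf[symmetric] by (rule strict_deriv_sum)
  have "strict_deriv U x0 (quot \<tau>) (\<lambda>h. if \<tau> then - (h u / (x0 u)\<^sup>2) else 0)"
  proof (cases \<tau>)
    case True
    then show ?thesis
      using strict_deriv_inverse[OF strict_deriv_coord[of U x0 u] finite_U] assms(2) by (simp add: quot_def[abs_def])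
  next
    case False
    then have nz: "x0 u - x0 v \<noteq> 0" using assms(2) by simp
    have "strict_deriv U x0 (\<lambda>x t. x u - x v) (\<lambda>h. h u - h v)"
      by (intro strict_deriv_diff strict_deriv_coord)
    then have "strict_deriv U x0 (\<lambda>x t. 1 / (x u - x v)) (\<lambda>h. - ((h u - h v) / (x0 u - x0 v)\<^sup>2))"
      by (rule strict_deriv_inverse) (use finite_U nz in auto)
    then have "strict_deriv U x0 (\<lambda>x t. t * (1 / (x u - x v))) (\<lambda>h. 0)"
      by (rule strict_deriv_param_mult[OF _ finite_U])
    then show ?thesis using False by (simp add: quot_def[abs_def])
  qed
  then show "strict_deriv U x0 (\<lambda>x t. (if z = u then 1 else if z = v then -1 else 0) * quot \<tau> x t)
     (\<lambda>h. (if z = u then 1 else if z = v then -1 else 0) * (if \<tau> then - (h u / (x0 u)\<^sup>2) else 0))"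
    by (rule strict_deriv_cmult)
qed

text \<open>
  The implicit function theorem in the coordinates \<open>chart\<close>, translated back to critical points: near
  a nondegenerate solution at \<open>t = 0\<close> there is exactly one critical point for each small
  nonzero \<open>t\<close>, it is nondegenerate with nonzero coordinates, and it is close to the limit position.
\<close>

lemma local_count:
  assumes off: "\<And>z. z \<notin> U \<Longrightarrow> x0 z = a z"
    and nocoll: "\<And>y z. {y, z} \<in> E \<Longrightarrow> chart \<tau> x0 0 y \<noteq> chart \<tau> x0 0 z"
    and sep: "if \<tau> then x0 u \<noteq> 0 else x0 u \<noteq> x0 v"
    and H0: "\<And>z. z \<in> U \<Longrightarrow> chart_eqn q \<tau> x0 0 z = 0"
    and nz: "\<And>z. z \<in> U \<Longrightarrow> chart \<tau> x0 0 z \<noteq> 0"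
    and inj: "\<And>h. (\<forall>z. z \<notin> U \<longrightarrow> h z = 0) \<Longrightarrow>
       (\<forall>z\<in>U. - dlapl V E q (chart \<tau> x0 0) (chart \<tau> h 0) z +
          (if z = u then 1 else if z = v then -1 else 0) * (if \<tau> then - (h u / (x0 u)\<^sup>2) else 0) = 0) \<Longrightarrow>
       \<forall>z\<in>U. h z = 0"
  defines "S \<equiv> \<lambda>t. crit V U a (insert {u, v} E) (q({u, v} := t))"
  shows "\<forall>\<^sub>F \<rho> in at_right 0. \<forall>\<^sub>F t in at 0. \<exists>!w. w \<in> S t \<and> l1 U (\<lambda>z. chart_inv \<tau> w t z - x0 z) < \<rho>" (is ?A)
    and "\<forall>\<^sub>F \<rho> in at_right 0. \<forall>\<^sub>F t in at 0. \<forall>w\<in>S t. l1 U (\<lambda>z. chart_inv \<tau> w t z - x0 z) < \<rho> \<longrightarrow>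
           nondegenerate V U (insert {u, v} E) (q({u, v} := t)) w \<and> (\<forall>z\<in>U. w z \<noteq> 0)" (is ?B)
    and "e > 0 \<Longrightarrow> \<forall>\<^sub>F \<rho> in at_right 0. \<forall>\<^sub>F t in at 0. \<forall>w\<in>S t. l1 U (\<lambda>z. chart_inv \<tau> w t z - x0 z) < \<rho> \<longrightarrow>
           cmod (w z - chart \<tau> x0 0 z) < e"
proof -
  let ?D = "\<lambda>w t. l1 U (\<lambda>z. chart_inv \<tau> w t z - x0 z)"
  define L where "L h z = - dlapl V E q (chart \<tau> x0 0) (chart \<tau> h 0) z +
      (if z = u then 1 else if z = v then -1 else 0) * (if \<tau> then - (h u / (x0 u)\<^sup>2) else 0)" for h z
  have sd: "strict_deriv U x0 (\<lambda>x t. chart_eqn q \<tau> x t z) (\<lambda>h. L h z)" for z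
    unfolding L_def by (rule strict_deriv_chart_eqn[OF nocoll sep])
  have in_nball: "chart_inv \<tau> w t \<in> nball U x0 \<rho>" if "w \<in> S t" "?D w t < \<rho>" for w t \<rho>
    using that off u by (auto simp: nball_def S_def crit_def chart_inv_def)
  have injL: "\<forall>z\<in>U. h z = 0" if "\<forall>z. z \<notin> U \<longrightarrow> h z = 0" "\<forall>z\<in>U. L h z = 0" for h
    using inj[of h] that unfolding L_def by blast
  have "\<exists>\<rho>0>0. (\<forall>\<rho>. 0 < \<rho> \<and> \<rho> \<le> \<rho>0 \<longrightarrow>
        (\<exists>d>0. \<forall>t. cmod t < d \<longrightarrow> (\<exists>!x. x \<in> nball U x0 \<rho> \<and> (\<forall>z\<in>U. chart_eqn q \<tau> x t z = 0)))) \<and>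
      (\<forall>t x h. cmod t < \<rho>0 \<longrightarrow> x \<in> nball U x0 \<rho>0 \<longrightarrow> (\<forall>z. z \<notin> U \<longrightarrow> h z = 0) \<longrightarrow>
        (\<forall>z\<in>U. ((\<lambda>s. chart_eqn q \<tau> (\<lambda>v. x v + s * h v) t z) has_field_derivative 0) (at 0)) \<longrightarrow> (\<forall>z\<in>U. h z = 0))"
    by (rule implicit_function[OF finite_U sd H0 injL])
  then obtain \<rho>0 where \<rho>0: "\<rho>0 > 0"
    and ex0: "\<forall>\<rho>. 0 < \<rho> \<and> \<rho> \<le> \<rho>0 \<longrightarrow>
        (\<exists>d>0. \<forall>t. cmod t < d \<longrightarrow> (\<exists>!x. x \<in> nball U x0 \<rho> \<and> (\<forall>z\<in>U. chart_eqn q \<tau> x t z = 0)))"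
    and der0: "\<forall>t x h. cmod t < \<rho>0 \<longrightarrow> x \<in> nball U x0 \<rho>0 \<longrightarrow> (\<forall>z. z \<notin> U \<longrightarrow> h z = 0) \<longrightarrow>
        (\<forall>z\<in>U. ((\<lambda>s. chart_eqn q \<tau> (\<lambda>v. x v + s * h v) t z) has_field_derivative 0) (at 0)) \<longrightarrow> (\<forall>z\<in>U. h z = 0)"
    by (elim exE conjE)
  have ex: "\<exists>d>0. \<forall>t. cmod t < d \<longrightarrow> (\<exists>!x. x \<in> nball U x0 \<rho> \<and> (\<forall>z\<in>U. chart_eqn q \<tau> x t z = 0))"
    if "0 < \<rho>" "\<rho> \<le> \<rho>0" for \<rho> using ex0 that by simp
  have der: "\<forall>z\<in>U. h z = 0"
    if "cmod t < \<rho>0" "x \<in> nball U x0 \<rho>0" "\<forall>z. z \<notin> U \<longrightarrow> h z = 0"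
      "\<forall>z\<in>U. ((\<lambda>s. chart_eqn q \<tau> (\<lambda>v. x v + s * h v) t z) has_field_derivative 0) (at 0)" for t x h
    using der0[rule_format, of t x h] that by blast
  have "\<exists>d>0. \<forall>j\<in>{(y, z) \<in> V \<times> V. {y, z} \<in> E}. \<forall>t x. cmod t < d \<longrightarrow> x \<in> nball U x0 d \<longrightarrow>
      chart \<tau> x t (fst j) - chart \<tau> x t (snd j) \<noteq> 0"
  proof (rule strict_deriv_nonzero_near[where f = "\<lambda>j x t. chart \<tau> x t (fst j) - chart \<tau> x t (snd j)"
        and L = "\<lambda>j h. chart \<tau> h 0 (fst j) - chart \<tau> h 0 (snd j)"])
    show "finite {(y, z) \<in> V \<times> V. {y, z} \<in> E}"
      by (rule finite_subset[of _ "V \<times> V"]) (auto simp: finite_V)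
    show "strict_deriv U x0 (\<lambda>x t. chart \<tau> x t (fst j) - chart \<tau> x t (snd j))
        (\<lambda>h. chart \<tau> h 0 (fst j) - chart \<tau> h 0 (snd j))" for j
      by (rule strict_deriv_diff[OF strict_deriv_chart strict_deriv_chart])
    show "chart \<tau> x0 0 (fst j) - chart \<tau> x0 0 (snd j) \<noteq> 0" if "j \<in> {(y, z) \<in> V \<times> V. {y, z} \<in> E}" for j
      using nocoll[of "fst j" "snd j"] that by auto
  qed (rule finite_U)
  then obtain d1 where d1: "d1 > 0" "\<And>y z t x. {y, z} \<in> E \<Longrightarrow> cmod t < d1 \<Longrightarrow> x \<in> nball U x0 d1 \<Longrightarrow>
      chart \<tau> x t y \<noteq> chart \<tau> x t z"
  proof (elim exE conjE)
    fix d assume d: "d > 0" "\<forall>j\<in>{(y, z) \<in> V \<times> V. {y, z} \<in> E}. \<forall>t x. cmod t < d \<longrightarrow> x \<in> nball U x0 d \<longrightarrow>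
      chart \<tau> x t (fst j) - chart \<tau> x t (snd j) \<noteq> 0"
    show thesis
    proof (rule that[OF d(1)])
      fix y z t x assume e: "{y, z} \<in> E" "cmod t < d" "x \<in> nball U x0 d"
      have "(y, z) \<in> {(y, z) \<in> V \<times> V. {y, z} \<in> E}" using edgeD[OF e(1)] e(1) UV BV by auto
      from d(2)[rule_format, OF this e(2,3)] show "chart \<tau> x t y \<noteq> chart \<tau> x t z" by simp
    qed
  qed
  obtain d2 where d2: "d2 > 0" "\<And>z t x. z \<in> U \<Longrightarrow> cmod t < d2 \<Longrightarrow> x \<in> nball U x0 d2 \<Longrightarrow> chart \<tau> x t z \<noteq> 0"
    using strict_deriv_nonzero_near[of U U x0 "\<lambda>z x t. chart \<tau> x t z" "\<lambda>z h. chart \<tau> h 0 z"] nz finite_U strict_deriv_chart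
    by meson
  have "\<exists>d>0. \<forall>j\<in>{()}. \<forall>t x. cmod t < d \<longrightarrow> x \<in> nball U x0 d \<longrightarrow> (if \<tau> then x u else x u - x v) \<noteq> 0"
  proof (rule strict_deriv_nonzero_near[where L = "\<lambda>j h. if \<tau> then h u else h u - h v"])
    show "strict_deriv U x0 (\<lambda>x t. if \<tau> then x u else x u - x v) (\<lambda>h. if \<tau> then h u else h u - h v)"
      by (cases \<tau>) (auto intro: strict_deriv_diff strict_deriv_coord)
  qed (use sep finite_U in auto)
  then obtain d3 where d3: "d3 > 0" "\<And>t x. cmod t < d3 \<Longrightarrow> x \<in> nball U x0 d3 \<Longrightarrow> (if \<tau> then x u else x u - x v) \<noteq> 0"
    by blast
  define r where "r = min (min \<rho>0 d1) (min d2 d3)"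
  have r: "r > 0" "r \<le> \<rho>0" "r \<le> d1" "r \<le> d2" "r \<le> d3" using \<rho>0 d1 d2 d3 by (auto simp: r_def)
  have near: "x \<in> nball U x0 \<rho>0" "x \<in> nball U x0 d1" "x \<in> nball U x0 d2" "x \<in> nball U x0 d3" if "x \<in> nball U x0 r" for x
    using that r by (auto simp: nball_def)
  have ev_r: "\<forall>\<^sub>F \<rho> in at_right (0::real). 0 < \<rho> \<and> \<rho> < r"
    using eventually_at_right_real[OF r(1)] by (rule eventually_mono) auto
  have ev_t: "\<forall>\<^sub>F t in at (0::complex). t \<noteq> 0 \<and> cmod t < d" if "d > 0" for d
    using that unfolding eventually_at by (auto simp: dist_norm)
  show ?A
    using ev_r
  proof eventually_elim
    case (elim \<rho>)
    then obtain d where d: "d > 0" "\<And>t. cmod t < d \<Longrightarrow> \<exists>!x. x \<in> nball U x0 \<rho> \<and> (\<forall>z\<in>U. chart_eqn q \<tau> x t z = 0)"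
      using ex[of \<rho>] r by auto
    have "min d r > 0" using d r by simp
    from ev_t[OF this] show ?case
    proof eventually_elim
      case (elim t)
      then have t: "t \<noteq> 0" "cmod t < d" "cmod t < r" by auto
      from d(2)[OF t(2)] obtain x where x: "x \<in> nball U x0 \<rho>" "\<forall>z\<in>U. chart_eqn q \<tau> x t z = 0"
        and xu: "\<And>y. y \<in> nball U x0 \<rho> \<Longrightarrow> \<forall>z\<in>U. chart_eqn q \<tau> y t z = 0 \<Longrightarrow> y = x" by blast
      have xr: "x \<in> nball U x0 r" using x(1) \<open>0 < \<rho> \<and> \<rho> < r\<close> by (auto simp: nball_def)
      let ?w = "chart \<tau> x t"
      have uvw: "?w u \<noteq> ?w v"
        using d3(2)[of t x] near[OF xr] t r uv by (auto simp: chart_def)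
      have "?w \<in> S t"
        unfolding S_def crit_def
      proof (intro CollectI conjI allI impI ballI)
        fix z assume "z \<notin> U" then show "?w z = a z" using off x(1) u by (auto simp: chart_def nball_def)
      next
        fix y z assume "{y, z} \<in> insert {u, v} E"
        then show "?w y \<noteq> ?w z"
          using d1(2)[of y z t x] near[OF xr] t r uvw by (auto simp: doubleton_eq_iff)
      next
        fix z assume "z \<in> U"
        then show "lapl V (insert {u, v} E) (q({u, v} := t)) ?w z = 0"
          using x(2) chart_eqn_eq_lapl[OF t(1)] by simp
      qed
      moreover have "?D ?w t < \<rho>" using x(1) by (simp add: chart_inv_chart[OF t(1)] nball_def)
      moreover have "w = ?w" if w: "w \<in> S t" "?D w t < \<rho>" for w
      proof -
        have "\<forall>z\<in>U. chart_eqn q \<tau> (chart_inv \<tau> w t) t z = 0"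
          using w(1) chart_eqn_eq_lapl[OF t(1)] by (simp add: chart_chart_inv[OF t(1)] S_def crit_def)
        from xu[OF in_nball[OF w] this] show ?thesis using chart_chart_inv[OF t(1)] by metis
      qed
      ultimately show ?case by blast
    qed
  qed
  show ?B
    using ev_r
  proof eventually_elim
    case (elim \<rho>)
    from ev_t[OF r(1)] show ?case
    proof eventually_elim
      case (elim t)
      then have t: "t \<noteq> 0" "cmod t < r" by auto
      show ?case
      proof (intro ballI impI)
        fix w assume w: "w \<in> S t" "?D w t < \<rho>"
        let ?x = "chart_inv \<tau> w t"
        have xr: "?x \<in> nball U x0 r" using in_nball[OF w] \<open>0 < \<rho> \<and> \<rho> < r\<close> by (auto simp: nball_def)
        have wx: "chart \<tau> ?x t = w" by (rule chart_chart_inv[OF t(1)])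
        have nzw: "\<forall>z\<in>U. w z \<noteq> 0" using d2(2)[of _ t ?x] near[OF xr] t r wx by auto
        have "nondegenerate V U (insert {u, v} E) (q({u, v} := t)) w"
          unfolding nondegenerate_def
        proof (intro allI impI)
          fix h assume h: "\<forall>z. z \<notin> U \<longrightarrow> h z = 0"
            and k: "\<forall>z\<in>U. dlapl V (insert {u, v} E) (q({u, v} := t)) w h z = 0"
          let ?h = "chart_inv \<tau> h t"
          have hh: "chart \<tau> ?h t = h" by (rule chart_chart_inv[OF t(1)])
          have h0: "\<forall>z. z \<notin> U \<longrightarrow> ?h z = 0" using h u by (auto simp: chart_inv_def)
          have hU: "\<forall>z\<in>U. ?h z = 0"
          proof (rule der)
            show "cmod t < \<rho>0" "?x \<in> nball U x0 \<rho>0" using t r near[OF xr] by auto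
            show "\<forall>z. z \<notin> U \<longrightarrow> ?h z = 0" by (rule h0)
            show "\<forall>z\<in>U. ((\<lambda>s. chart_eqn q \<tau> (\<lambda>v. ?x v + s * ?h v) t z) has_field_derivative 0) (at 0)"
            proof
              fix z assume z: "z \<in> U"
              have "((\<lambda>s. lapl V (insert {u, v} E) (q({u, v} := t)) (\<lambda>v. w v + s * h v) z) has_field_derivative
                  - dlapl V (insert {u, v} E) (q({u, v} := t)) w h z) (at 0)"
                by (rule lapl_has_derivative) (use w(1) in \<open>auto simp: S_def crit_def\<close>)
              then show "((\<lambda>s. chart_eqn q \<tau> (\<lambda>v. ?x v + s * ?h v) t z) has_field_derivative 0) (at 0)"
                unfolding chart_eqn_eq_lapl[OF t(1)] chart_affine wx hh using k z by simp
            qed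
          qed
          have "?h = (\<lambda>z. 0)"
          proof
            fix z show "?h z = 0" using h0 hU by (cases "z \<in> U") blast+
          qed
          then have "h = chart \<tau> (\<lambda>z. 0) t" using hh by simp
          then show "\<forall>z\<in>U. h z = 0" by (simp add: chart_def)
        qed
        then show "nondegenerate V U (insert {u, v} E) (q({u, v} := t)) w \<and> (\<forall>z\<in>U. w z \<noteq> 0)" using nzw by blast
      qed
    qed
  qed
  assume e: "e > 0"
  obtain d4 where d4: "d4 > 0" "\<And>t x. cmod t < d4 \<Longrightarrow> x \<in> nball U x0 d4 \<Longrightarrow> cmod (chart \<tau> x t z - chart \<tau> x0 0 z) < e"
    using strict_deriv_continuous[OF strict_deriv_chart finite_U e] by metis
  have "\<forall>\<^sub>F \<rho> in at_right (0::real). 0 < \<rho> \<and> \<rho> < d4"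
    using eventually_at_right_real[OF d4(1)] by (rule eventually_mono) auto
  then show "\<forall>\<^sub>F \<rho> in at_right 0. \<forall>\<^sub>F t in at 0. \<forall>w\<in>S t. ?D w t < \<rho> \<longrightarrow> cmod (w z - chart \<tau> x0 0 z) < e"
  proof eventually_elim
    case (elim \<rho>)
    from ev_t[OF d4(1)] show ?case
    proof eventually_elim
      case (elim t)
      show ?case
      proof (intro ballI impI)
        fix w assume w: "w \<in> S t" "?D w t < \<rho>"
        have "chart_inv \<tau> w t \<in> nball U x0 d4" using in_nball[OF w] \<open>0 < \<rho> \<and> \<rho> < d4\<close> by (auto simp: nball_def)
        from d4(2)[OF _ this, of t] show "cmod (w z - chart \<tau> x0 0 z) < e"
          using elim by (simp add: chart_chart_inv)
      qed
    qed
  qed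
qed


text \<open>
  The limits are the critical points of the graph without the edge (\<open>Inl\<close>) and of the contracted graph
  (\<open>Inr\<close>). The assumption on \<open>lapl\<close> at \<open>u\<close> excludes critical points of the former where \<open>u\<close> and \<open>v\<close>
  coincide, and it gives a finite nonzero rescaled difference: at a collision, \<open>A + 1 / y = 0\<close> where
  \<open>A\<close> is the value of \<open>lapl\<close> at \<open>u\<close>.
\<close>

theorem good_insert_edge:
  assumes nonres: "nonresonant V U B E q"
    and G1: "good V U a E q N1"
    and G2: "good V (U - {u}) a (contr_edges u v E) (contr_wt u v E q) N2"
    and A: "\<And>w. w \<in> crit V (U - {u}) a (contr_edges u v E) (contr_wt u v E q) \<Longrightarrow> lapl V E q (w(u := w v)) u \<noteq> 0"
  shows "\<forall>\<^sub>F t in at 0. good V U a (insert {u, v} E) (q({u, v} := t)) (N1 + N2)"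
proof -
  define S where "S t = crit V U a (insert {u, v} E) (q({u, v} := t))" for t
  define C1 where "C1 = crit V U a E q"
  define C2 where "C2 = crit V (U - {u}) a (contr_edges u v E) (contr_wt u v E q)"
  define x0 where "x0 p = (case p of Inl w \<Rightarrow> w | Inr w \<Rightarrow> w(u := - (1 / lapl V E q (w(u := w v)) u)))"
    for p :: "('a \<Rightarrow> complex) + ('a \<Rightarrow> complex)"
  define \<tau> where "\<tau> p = (case p of Inl (w :: 'a \<Rightarrow> complex) \<Rightarrow> False | Inr (w :: 'a \<Rightarrow> complex) \<Rightarrow> True)" for p
  define D where "D p w t = l1 U (\<lambda>z. chart_inv (\<tau> p) w t z - x0 p z)" for p w t
  define Q where "Q w t \<longleftrightarrow> nondegenerate V U (insert {u, v} E) (q({u, v} := t)) w \<and> (\<forall>z\<in>U. w z \<noteq> 0)" for w t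
  let ?P = "C1 <+> C2"
  have fin: "finite C1" "finite C2" "card C1 = N1" "card C2 = N2"
    using G1 G2 by (auto simp: good_def C1_def C2_def)
  have C1_off: "w z = a z" if "w \<in> C1" "z \<notin> U" for w z using that by (auto simp: C1_def crit_def)
  have C2_off: "w z = a z" if "w \<in> C2" "z \<notin> U - {u}" for w z using that by (auto simp: C2_def crit_def)
  have C1_sep: "w u \<noteq> w v" if w: "w \<in> C1" for w
  proof
    assume eq: "w u = w v"
    let ?w = "w(u := a u)"
    have upd: "?w(u := ?w v) = w" using eq uv by auto
    have cr: "\<And>x. x \<notin> U \<Longrightarrow> w x = a x" "\<And>x y. {x, y} \<in> E \<Longrightarrow> w x \<noteq> w y" "\<And>x. x \<in> U \<Longrightarrow> lapl V E q w x = 0"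
      using w by (auto simp: C1_def crit_def)
    have "?w \<in> C2"
      unfolding C2_def crit_def
    proof (intro CollectI conjI allI impI ballI)
      show "?w x = a x" if "x \<notin> U - {u}" for x using that cr(1) by auto
      show "?w x \<noteq> ?w y" if e: "{x, y} \<in> contr_edges u v E" for x y
      proof -
        have "x \<noteq> u" "y \<noteq> u" using contr_edge_u[of y] contr_edge_u[of x] e by (auto simp: insert_commute)
        then show ?thesis using contr_edge_iff[of x y] e cr(2)[of x y] cr(2)[of u y] cr(2)[of u x] eq by auto
      qed
      show "lapl V (contr_edges u v E) (contr_wt u v E q) ?w x = 0" if "x \<in> U - {u}" for x
        using contr_lapl[of x q ?w] cr(3)[of x] cr(3)[OF u] that unfolding upd by auto
    qed
    then have "lapl V E q (?w(u := ?w v)) u \<noteq> 0" unfolding C2_def by (rule A)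
    then show False using cr(3)[OF u] unfolding upd by simp
  qed
  have hat: "chart (\<tau> p) (x0 p) 0 = (case p of Inl w \<Rightarrow> w | Inr w \<Rightarrow> w(u := w v))" for p
    using uv by (auto simp: \<tau>_def x0_def chart_def split: sum.split)
  have local: "(\<forall>\<^sub>F \<rho> in at_right 0. \<forall>\<^sub>F t in at 0. \<exists>!w. w \<in> S t \<and> D p w t < \<rho>) \<and>
      (\<forall>\<^sub>F \<rho> in at_right 0. \<forall>\<^sub>F t in at 0. \<forall>w\<in>S t. D p w t < \<rho> \<longrightarrow> Q w t) \<and>
      (\<forall>e>0. \<forall>z. \<forall>\<^sub>F \<rho> in at_right 0. \<forall>\<^sub>F t in at 0. \<forall>w\<in>S t. D p w t < \<rho> \<longrightarrow>
           cmod (w z - chart (\<tau> p) (x0 p) 0 z) < e)" if p: "p \<in> ?P" for p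
  proof -
    have off: "x0 p z = a z" if "z \<notin> U" for z
      using p C1_off C2_off that u by (auto simp: x0_def)
    have nocoll: "chart (\<tau> p) (x0 p) 0 y \<noteq> chart (\<tau> p) (x0 p) 0 z" if e: "{y, z} \<in> E" for y z
    proof (cases p)
      case (Inl w)
      then show ?thesis using p e unfolding hat by (auto simp: C1_def crit_def)
    next
      case (Inr w)
      then have "w \<in> C2" using p by auto
      from crit_contr_no_collision[OF this[unfolded C2_def] e] show ?thesis unfolding hat Inr by simp
    qed
    have sep: "if \<tau> p then x0 p u \<noteq> 0 else x0 p u \<noteq> x0 p v"
      using p A C1_sep by (auto simp: \<tau>_def x0_def C2_def)
    have H0: "chart_eqn q (\<tau> p) (x0 p) 0 z = 0" if z: "z \<in> U" for z
    proof (cases p)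
      case (Inl w)
      then have "chart (\<tau> p) (x0 p) 0 = w" "quot (\<tau> p) (x0 p) 0 = 0" "w \<in> C1"
        using hat[of p] p by (auto simp: quot_def \<tau>_def)
      then show ?thesis using z by (auto simp: chart_eqn_def C1_def crit_def)
    next
      case (Inr w)
      then have w: "w \<in> C2" using p by auto
      let ?A = "lapl V E q (w(u := w v))"
      have Au: "?A u \<noteq> 0" using A w by (simp add: C2_def)
      have "quot (\<tau> p) (x0 p) 0 = - ?A u" using Inr by (simp add: quot_def \<tau>_def x0_def)
      then have eq: "chart_eqn q (\<tau> p) (x0 p) 0 z = ?A z + (if z = u then 1 else if z = v then -1 else 0) * (- ?A u)"
        unfolding chart_eqn_def hat using Inr by simp
      show ?thesis
      proof (cases "z = u")
        case True then show ?thesis unfolding eq by simp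
      next
        case False
        then have "lapl V (contr_edges u v E) (contr_wt u v E q) w z = 0"
          using w z by (simp add: C2_def crit_def)
        then show ?thesis unfolding eq contr_lapl[OF False] using False by (auto simp: eq_neg_iff_add_eq_0 split: if_splits)
      qed
    qed
    have nz: "chart (\<tau> p) (x0 p) 0 z \<noteq> 0" if z: "z \<in> U" for z
    proof (cases p)
      case (Inl w)
      then show ?thesis using p z G1 unfolding hat by (auto simp: good_def C1_def)
    next
      case (Inr w)
      then have w: "w \<in> C2" using p by auto
      have nzU: "w x \<noteq> 0" if "x \<in> U - {u}" for x using w G2 that by (auto simp: good_def C2_def)
      have "w v \<noteq> 0"
      proof (cases "v \<in> U")
        case True then show ?thesis using nzU uv by auto
      next
        case False then show ?thesis using C2_off[OF w, of v] v a_nz by auto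
      qed
      then show ?thesis using nzU z unfolding hat Inr by simp
    qed
    have inj: "\<forall>z\<in>U. h z = 0" if h: "\<forall>z. z \<notin> U \<longrightarrow> h z = 0"
      and k: "\<forall>z\<in>U. - dlapl V E q (chart (\<tau> p) (x0 p) 0) (chart (\<tau> p) h 0) z +
          (if z = u then 1 else if z = v then -1 else 0) * (if \<tau> p then - (h u / (x0 p u)\<^sup>2) else 0) = 0" for h
    proof (cases p)
      case (Inl w)
      then have "nondegenerate V U E q w" using p G1 by (auto simp: good_def C1_def)
      moreover have "\<forall>z\<in>U. dlapl V E q w h z = 0"
        using k Inl unfolding hat by (simp add: \<tau>_def chart_def)
      ultimately show ?thesis using h by (auto simp: nondegenerate_def)
    next
      case (Inr w)
      then have w: "w \<in> C2" and x0u: "x0 p u \<noteq> 0" using p sep by (auto simp: \<tau>_def)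
      have nd: "nondegenerate V (U - {u}) (contr_edges u v E) (contr_wt u v E q) w"
        using w G2 by (auto simp: good_def C2_def)
      \<comment> \<open>Adding the linearised equations at \<open>u\<close> and \<open>v\<close> eliminates the coordinate \<open>h u\<close> and leaves the
        linearised equations of the contracted graph.\<close>
      let ?w = "w(u := w v)" and ?h = "h(u := h v)" and ?g = "h(u := 0)"
      have gh: "?g(u := ?g v) = ?h" using uv by auto
      have k': "- dlapl V E q ?w ?h z + (if z = u then 1 else if z = v then -1 else 0) * (- (h u / (x0 p u)\<^sup>2)) = 0"
        if "z \<in> U" for z
        using k that Inr unfolding hat by (simp add: \<tau>_def chart_def)
      have "- dlapl V E q ?w ?h u = h u / (x0 p u)\<^sup>2" using k'[OF u] by simp
      then have ku: "dlapl V E q ?w ?h u = - (h u / (x0 p u)\<^sup>2)" by (metis minus_minus)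
      have "\<forall>z\<in>U - {u}. ?g z = 0"
      proof -
        have "\<forall>z\<in>U - {u}. dlapl V (contr_edges u v E) (contr_wt u v E q) w ?g z = 0"
        proof
          fix z assume z: "z \<in> U - {u}"
          show "dlapl V (contr_edges u v E) (contr_wt u v E q) w ?g z = 0"
          proof (cases "z = v")
            case True
            then show ?thesis using contr_dlapl[of z q w ?g] z k'[of z] ku unfolding gh by simp
          next
            case False
            then show ?thesis using contr_dlapl[of z q w ?g] z k'[of z] unfolding gh by simp
          qed
        qed
        moreover have "\<forall>x. x \<notin> U - {u} \<longrightarrow> ?g x = 0" using h by auto
        ultimately show ?thesis using nd unfolding nondegenerate_def by blast
      qed
      then have h0: "h z = 0" if "z \<noteq> u" for z using h that by (cases "z \<in> U") auto
      then have "?h = (\<lambda>z. 0)" using uv by (auto simp: fun_eq_iff)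
      then have "dlapl V E q ?w ?h u = 0" by (simp add: dlapl_def)
      then have "h u = 0" using ku x0u by simp
      then show ?thesis using h0 by (metis (full_types))
    qed
    note lc = local_count[OF off nocoll sep H0 nz inj]
    show ?thesis unfolding S_def D_def Q_def by (intro conjI allI impI) (rule lc | assumption)+
  qed
  have "\<forall>\<^sub>F t in at 0. finite (S t) \<and> card (S t) = card ?P \<and> (\<forall>w\<in>S t. Q w t)"
  proof (rule count_near_limits[where D = D])
    show "finite ?P" using fin by simp
    show "\<forall>\<^sub>F \<rho> in at_right 0. \<forall>\<^sub>F t in at 0. \<exists>!w. w \<in> S t \<and> D p w t < \<rho>" if "p \<in> ?P" for p
      using local[OF that] by blast
    show "\<forall>\<^sub>F \<rho> in at_right 0. \<forall>\<^sub>F t in at 0. \<forall>w\<in>S t. D p w t < \<rho> \<longrightarrow> Q w t" if "p \<in> ?P" for p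
      using local[OF that] by blast
    show "\<forall>\<^sub>F \<rho> in at_right 0. \<forall>\<^sub>F t in at 0. \<forall>w\<in>S t. \<not> (D p w t < \<rho> \<and> D p' w t < \<rho>)"
      if p: "p \<in> ?P" "p' \<in> ?P" "p \<noteq> p'" for p p'
    proof -
      let ?h = "\<lambda>p. chart (\<tau> p) (x0 p) 0"
      have "?h p \<noteq> ?h p'"
      proof
        assume eq: "?h p = ?h p'"
        have sepI: "?h p u = ?h p v \<longleftrightarrow> p \<in> range Inr" if "p \<in> ?P" for p
          using that C1_sep uv unfolding hat by auto
        consider w w' where "p = Inl w" "p' = Inl w'" | w w' where "p = Inr w" "p' = Inr w'" "w \<in> C2" "w' \<in> C2"
          using sepI[OF p(1)] sepI[OF p(2)] eq p by (cases p; cases p') auto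
        then show False
        proof cases
          case 1 then show False using eq p(3) unfolding hat by simp
        next
          case 2
          have "w z = w' z" for z
          proof (cases "z = u")
            case True then show ?thesis using C2_off[of w u] C2_off[of w' u] 2 by simp
          next
            case False
            then show ?thesis using fun_cong[OF eq, of z] 2 unfolding hat by simp
          qed
          then show False using 2 p(3) by (simp add: fun_eq_iff)
        qed
      qed
      then obtain z where z: "?h p z \<noteq> ?h p' z" by (auto simp: fun_eq_iff)
      define e where "e = cmod (?h p z - ?h p' z) / 2"
      have e: "e > 0" using z by (simp add: e_def)
      have "\<forall>\<^sub>F \<rho> in at_right 0. \<forall>\<^sub>F t in at 0. \<forall>w\<in>S t. D p w t < \<rho> \<longrightarrow> cmod (w z - ?h p z) < e"
        "\<forall>\<^sub>F \<rho> in at_right 0. \<forall>\<^sub>F t in at 0. \<forall>w\<in>S t. D p' w t < \<rho> \<longrightarrow> cmod (w z - ?h p' z) < e"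
        using local[OF p(1)] local[OF p(2)] e by blast+
      then show ?thesis
      proof eventually_elim
        case (elim \<rho>)
        then show ?case
        proof eventually_elim
          case (elim t)
          show ?case
          proof (intro ballI notI)
            fix w assume "w \<in> S t" "D p w t < \<rho> \<and> D p' w t < \<rho>"
            then have "cmod (w z - ?h p z) < e" "cmod (w z - ?h p' z) < e" using elim by blast+
            then have "cmod ((w z - ?h p' z) - (w z - ?h p z)) < e + e"
              using norm_triangle_ineq4[of "w z - ?h p' z" "w z - ?h p z"] by linarith
            then show False by (simp add: e_def)
          qed
        qed
      qed
    qed
    fix t :: "nat \<Rightarrow> complex" and w
    assume t: "\<And>n. t n \<noteq> 0" "t \<longlonglongrightarrow> 0" and w: "\<And>n. w n \<in> S (t n)"
    obtain r :: "nat \<Rightarrow> nat" and l where r: "strict_mono r" and l: "\<And>x. (\<lambda>n. w (r n) x) \<longlonglongrightarrow> l x"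
      and nc: "\<And>x y. {x, y} \<in> E \<Longrightarrow> l x \<noteq> l y"
      and cl: "if l u = l v then l(u := a u) \<in> C2 else l \<in> C1"
      using crit_limits[OF nonres t(2) w[unfolded S_def]] unfolding C1_def C2_def by blast
    have "\<exists>p\<in>?P. \<forall>z. (\<lambda>n. chart_inv (\<tau> p) (w (r n)) (t (r n)) z) \<longlonglongrightarrow> x0 p z"
    proof (cases "l u = l v")
      case False
      then show ?thesis using cl l by (intro bexI[of _ "Inl l"]) (auto simp: \<tau>_def chart_inv_def x0_def)
    next
      case True
      let ?l = "l(u := a u)"
      have upd: "?l(u := ?l v) = l" using True uv by auto
      have lC: "?l \<in> C2" using cl True by simp
      have Al: "lapl V E q l u \<noteq> 0" using A[of ?l] lC unfolding upd C2_def by simp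
      have eqn: "lapl V E q (w (r n)) u + t (r n) / (w (r n) u - w (r n) v) = 0" for n
        using w[of "r n"] u unfolding S_def crit_def lapl_insert by auto
      have "(w (r n) u - w (r n) v) / t (r n) = - (1 / lapl V E q (w (r n)) u)" for n
      proof -
        have "t (r n) / (w (r n) u - w (r n) v) = - lapl V E q (w (r n)) u" for n
          using eqn[of n] by (simp add: eq_neg_iff_add_eq_0 add.commute)
        moreover have "(w (r n) u - w (r n) v) / t (r n) = 1 / (t (r n) / (w (r n) u - w (r n) v))" by simp
        ultimately show ?thesis by simp
      qed
      moreover have "(\<lambda>n. - (1 / lapl V E q (w (r n)) u)) \<longlonglongrightarrow> - (1 / lapl V E q l u)"
        by (intro tendsto_intros lapl_tendsto[OF nc l] Al)
      ultimately have "(\<lambda>n. (w (r n) u - w (r n) v) / t (r n)) \<longlonglongrightarrow> - (1 / lapl V E q l u)" by simp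
      then have "\<forall>z. (\<lambda>n. chart_inv (\<tau> (Inr ?l)) (w (r n)) (t (r n)) z) \<longlonglongrightarrow> x0 (Inr ?l) z"
        using l by (auto simp: chart_inv_def x0_def \<tau>_def upd simp del: fun_upd_apply) (auto simp: upd[simplified])
      then show ?thesis using lC by (intro bexI[of _ "Inr ?l"]) auto
    qed
    then obtain p where p: "p \<in> ?P" "\<And>z. (\<lambda>n. chart_inv (\<tau> p) (w (r n)) (t (r n)) z) \<longlonglongrightarrow> x0 p z" by blast
    have "(\<lambda>n. D p (w (r n)) (t (r n))) \<longlonglongrightarrow> (\<Sum>z\<in>U. cmod (x0 p z - x0 p z))"
      unfolding D_def l1_def by (intro tendsto_intros p(2))
    then have D0: "(\<lambda>n. D p (w (r n)) (t (r n))) \<longlonglongrightarrow> 0" by simp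
    show "\<exists>p\<in>?P. \<forall>\<rho>>0. \<exists>n. D p (w n) (t n) < \<rho>"
    proof (intro bexI[OF _ p(1)] allI impI)
      fix \<rho> :: real assume "\<rho> > 0"
      from order_tendstoD(2)[OF D0 this] obtain n where "D p (w (r n)) (t (r n)) < \<rho>"
        by (auto simp: eventually_sequentially)
      then show "\<exists>n. D p (w n) (t n) < \<rho>" by blast
    qed
  qed
  then show ?thesis
    unfolding good_def S_def Q_def using fin by (simp add: card_Plus)
qed

end

section \<open>Zariski-generic validity of the count\<close>

lemma wt_cong: "(\<And>e. e \<in> E \<Longrightarrow> x \<in> e \<Longrightarrow> q e = q' e) \<Longrightarrow> wt E q x y = wt E q' x y"
  by (simp add: wt_def)

lemma crit_cong:
  assumes "\<And>e. e \<in> E \<Longrightarrow> e \<inter> U \<noteq> {} \<Longrightarrow> q e = q' e"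
  shows "crit V U a E q = crit V U a E q'"
proof -
  have "wt E q x y = wt E q' x y" if "x \<in> U" for x y by (rule wt_cong) (use assms that in auto)
  then have "lapl V E q w x = lapl V E q' w x" if "x \<in> U" for w x using that by (simp add: lapl_def)
  then show ?thesis by (simp add: crit_def)
qed

lemma good_cong:
  assumes "\<And>e. e \<in> E \<Longrightarrow> e \<inter> U \<noteq> {} \<Longrightarrow> q e = q' e"
  shows "good V U a E q N \<longleftrightarrow> good V U a E q' N"
proof -
  have "wt E q x y = wt E q' x y" if "x \<in> U" for x y by (rule wt_cong) (use assms that in auto)
  then have "dlapl V E q w h x = dlapl V E q' w h x" if "x \<in> U" for w h x using that by (simp add: dlapl_def)
  then have "nondegenerate V U E q w = nondegenerate V U E q' w" for w by (simp add: nondegenerate_def)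
  then show ?thesis using crit_cong[of E U q q' V a, OF assms] unfolding good_def by simp
qed

lemma sum_divide_eq_0_iff:
  fixes n d :: "'b \<Rightarrow> complex"
  assumes "finite A" "\<And>y. y \<in> A \<Longrightarrow> d y \<noteq> 0"
  shows "(\<Sum>y\<in>A. n y / d y) = 0 \<longleftrightarrow> (\<Sum>y\<in>A. n y * (\<Prod>z\<in>A - {y}. d z)) = 0"
proof -
  have "(\<Sum>y\<in>A. n y / d y) * (\<Prod>z\<in>A. d z) = (\<Sum>y\<in>A. n y * (\<Prod>z\<in>A - {y}. d z))"
    unfolding sum_distrib_right
  proof (intro sum.cong refl)
    fix y assume y: "y \<in> A"
    show "n y / d y * (\<Prod>z\<in>A. d z) = n y * (\<Prod>z\<in>A - {y}. d z)"
      using prod.remove[OF assms(1) y, of d] assms(2)[OF y] by simp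
  qed
  moreover have "(\<Prod>z\<in>A. d z) \<noteq> 0" using assms by simp
  ultimately show ?thesis by (metis mult_eq_0_iff)
qed

lemma subsets_of_card_iff:
  "finite C \<and> card C = N \<longleftrightarrow> (\<exists>F\<subseteq>C. finite F \<and> card F = N) \<and> \<not> (\<exists>F\<subseteq>C. finite F \<and> card F = Suc N)"
proof
  assume "finite C \<and> card C = N"
  then show "(\<exists>F\<subseteq>C. finite F \<and> card F = N) \<and> \<not> (\<exists>F\<subseteq>C. finite F \<and> card F = Suc N)"
    by (intro conjI notI exI[of _ C]) (auto dest: card_mono)
next
  assume a: "(\<exists>F\<subseteq>C. finite F \<and> card F = N) \<and> \<not> (\<exists>F\<subseteq>C. finite F \<and> card F = Suc N)"
  have fin: "finite C"
  proof (rule ccontr)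
    assume "infinite C"
    then show False using infinite_arbitrarily_large[of C "Suc N"] a by blast
  qed
  moreover have "card C \<ge> N" using a fin card_mono by blast
  moreover have "\<not> card C \<ge> Suc N" using a fin obtain_subset_with_card_n[of "Suc N" C] by metis
  ultimately show "finite C \<and> card C = N" by simp
qed

text \<open>
  To express the count by quantifiers over coordinates, a point of the larger space consists of the
  weights (\<open>Inl\<close>) together with a sequence of positions of the vertices (\<open>Inr\<close>).
\<close>

definition wtco :: "('a set + nat \<times> 'a \<Rightarrow> complex) \<Rightarrow> 'a set \<Rightarrow> complex" where
  "wtco X e = X (Inl e)"

definition ptco :: "'a set \<Rightarrow> ('a \<Rightarrow> complex) \<Rightarrow> nat \<Rightarrow> ('a set + nat \<times> 'a \<Rightarrow> complex) \<Rightarrow> 'a \<Rightarrow> complex" where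
  "ptco U a j X x = (if x \<in> U then X (Inr (j, x)) else a x)"

lemma mpoly_fun_wtco: "mpoly_fun (\<lambda>X. wtco X e)"
  by (simp add: wtco_def mpoly_fun.coord)

lemma mpoly_fun_ptco: "mpoly_fun (\<lambda>X. ptco U a j X x)"
  by (cases "x \<in> U") (auto simp: ptco_def intro: mpoly_fun.intros)

lemma constructible_conj_ball:
  assumes "finite A" "constructible P" "\<And>j. j \<in> A \<Longrightarrow> constructible (\<lambda>X. P X \<and> Q j X)"
  shows "constructible (\<lambda>X. P X \<and> (\<forall>j\<in>A. Q j X))"
proof -
  have "constructible (\<lambda>X. P X \<and> (\<forall>j\<in>A. P X \<and> Q j X))"
    by (intro constructible.conj constructible_ball assms)
  moreover have "(\<lambda>X. P X \<and> (\<forall>j\<in>A. P X \<and> Q j X)) = (\<lambda>X. P X \<and> (\<forall>j\<in>A. Q j X))" by blast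
  ultimately show ?thesis by simp
qed

lemma constructible_sum_divide:
  assumes "finite A" "\<And>y. mpoly_fun (n y)" "\<And>y. mpoly_fun (d y)" "constructible P"
    and "\<And>X y. P X \<Longrightarrow> y \<in> A \<Longrightarrow> d y X \<noteq> 0"
  shows "constructible (\<lambda>X. P X \<and> (\<Sum>y\<in>A. n y X / d y X) = 0)"
proof -
  have "constructible (\<lambda>X. P X \<and> (\<Sum>y\<in>A. n y X * (\<Prod>z\<in>A - {y}. d z X)) = 0)"
    by (intro constructible.conj constructible.zero mpoly_fun_sum mpoly_fun.mult mpoly_fun_prod assms)
  moreover have "(\<lambda>X. P X \<and> (\<Sum>y\<in>A. n y X / d y X) = 0) =
      (\<lambda>X. P X \<and> (\<Sum>y\<in>A. n y X * (\<Prod>z\<in>A - {y}. d z X)) = 0)"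
  proof (intro ext conj_cong refl)
    fix X assume "P X"
    then show "((\<Sum>y\<in>A. n y X / d y X) = 0) = ((\<Sum>y\<in>A. n y X * (\<Prod>z\<in>A - {y}. d z X)) = 0)"
      by (intro sum_divide_eq_0_iff[of A "\<lambda>y. d y X" "\<lambda>y. n y X"] assms(1) assms(5))
  qed
  ultimately show ?thesis by simp
qed

context pinned_graph
begin

lemma lapl_neighbours: "lapl V E q w x = (\<Sum>y\<in>{y \<in> V. {x, y} \<in> E}. q {x, y} / (w x - w y))"
  unfolding lapl_def sum.inter_filter[OF finite_V] by (intro sum.cong) (auto simp: wt_def)

lemma dlapl_neighbours: "dlapl V E q w h x = (\<Sum>y\<in>{y \<in> V. {x, y} \<in> E}. q {x, y} * (h x - h y) / (w x - w y)\<^sup>2)"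
  unfolding dlapl_def sum.inter_filter[OF finite_V] by (intro sum.cong) (auto simp: wt_def)

lemma constructible_crit: "constructible (\<lambda>X. ptco U a j X \<in> crit V U a E (wtco X))"
proof -
  let ?w = "ptco U a j"
  let ?A = "{p \<in> V \<times> V. {fst p, snd p} \<in> E}"
  let ?P = "\<lambda>X. \<forall>p\<in>?A. \<not> ?w X (fst p) = ?w X (snd p)"
  have fin: "finite ?A"
    by (rule finite_subset[of _ "V \<times> V"]) (auto simp: finite_V)
  have P: "constructible ?P"
    by (intro constructible_ball constructible.neg constructible_eq mpoly_fun_ptco fin)
  have "constructible (\<lambda>X. ?P X \<and> (\<forall>x\<in>U. (\<Sum>y\<in>{y \<in> V. {x, y} \<in> E}. wtco X {x, y} / (?w X x - ?w X y)) = 0))"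
  proof (rule constructible_conj_ball[OF finite_U P])
    fix x assume x: "x \<in> U"
    show "constructible (\<lambda>X. ?P X \<and> (\<Sum>y\<in>{y \<in> V. {x, y} \<in> E}. wtco X {x, y} / (?w X x - ?w X y)) = 0)"
      by (rule constructible_sum_divide[where n = "\<lambda>y X. wtco X {x, y}" and d = "\<lambda>y X. ?w X x - ?w X y", OF _ _ _ P])
        (use finite_V UV x in \<open>auto intro: mpoly_fun_wtco mpoly_fun_diff mpoly_fun_ptco\<close>)
  qed
  moreover have "?w X \<in> crit V U a E (wtco X) \<longleftrightarrow>
      ?P X \<and> (\<forall>x\<in>U. (\<Sum>y\<in>{y \<in> V. {x, y} \<in> E}. wtco X {x, y} / (?w X x - ?w X y)) = 0)" for X
  proof -
    have "(x, y) \<in> ?A" if "{x, y} \<in> E" for x y using edgeD[OF that] that UV BV by auto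
    then have "?P X \<longleftrightarrow> (\<forall>x y. {x, y} \<in> E \<longrightarrow> ?w X x \<noteq> ?w X y)" by fastforce
    then show ?thesis unfolding crit_def lapl_neighbours by (simp add: ptco_def)
  qed
  ultimately show ?thesis by presburger
qed

lemma constructible_kernel:
  "constructible (\<lambda>X. ptco U a i X \<in> crit V U a E (wtco X) \<and>
     (\<forall>x\<in>U. dlapl V E (wtco X) (ptco U a i X) (ptco U (\<lambda>x. 0) j X) x = 0))"
proof (rule constructible_conj_ball[OF finite_U constructible_crit])
  fix x assume x: "x \<in> U"
  let ?w = "ptco U a i" and ?h = "ptco U (\<lambda>x. 0) j"
  show "constructible (\<lambda>X. ?w X \<in> crit V U a E (wtco X) \<and> dlapl V E (wtco X) (?w X) (?h X) x = 0)"
    unfolding dlapl_neighbours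
    by (rule constructible_sum_divide[where n = "\<lambda>y X. wtco X {x, y} * (?h X x - ?h X y)"
          and d = "\<lambda>y X. (?w X x - ?w X y)\<^sup>2", OF _ _ _ constructible_crit])
      (use finite_V x in \<open>auto intro!: mpoly_fun_wtco mpoly_fun_diff mpoly_fun_ptco mpoly_fun.mult mpoly_fun_power simp: crit_def\<close>)
qed

text \<open>
  The first \<open>M\<close> of the position vectors are quantified, everything else is kept.
\<close>

definition merge :: "nat \<Rightarrow> ('a set + nat \<times> 'a \<Rightarrow> complex) \<Rightarrow> ('a set + nat \<times> 'a \<Rightarrow> complex) \<Rightarrow> 'a set + nat \<times> 'a \<Rightarrow> complex" where
  "merge M X Y i = (if i \<in> Inr ` ({..<M} \<times> U) then Y i else X i)"

lemma wtco_merge [simp]: "wtco (merge M X Y) = wtco X"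
  by (auto simp: wtco_def merge_def fun_eq_iff)

lemma ptco_merge: "j < M \<Longrightarrow> ptco U c j (merge M X Y) = ptco U c j Y"
  by (auto simp: ptco_def merge_def fun_eq_iff)

lemma constructible_ex_merge: "constructible P \<Longrightarrow> constructible (\<lambda>X. \<exists>Y. P (merge M X Y))"
  using constructible_ex_many[of P "Inr ` ({..<M} \<times> U)"] finite_U unfolding merge_def[abs_def] by simp

text \<open>
  "At least \<open>M\<close> critical points" is expressed by \<open>M\<close> position vectors that are pairwise distinct.
\<close>

lemma constructible_many_crit:
  "constructible (\<lambda>X. \<exists>F\<subseteq>crit V U a E (wtco X). finite F \<and> card F = M)"
proof -
  let ?T = "\<lambda>X. (\<forall>j\<in>{..<M}. ptco U a j X \<in> crit V U a E (wtco X)) \<and>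
     (\<forall>i\<in>{..<M}. \<forall>j\<in>{..<M}. i \<noteq> j \<longrightarrow> (\<exists>x\<in>U. \<not> ptco U a i X x = ptco U a j X x))"
  have "constructible ?T"
    by (intro constructible.conj constructible_ball constructible_crit constructible_imp constructible_const
        constructible_bex finite_U constructible.neg constructible_eq mpoly_fun_ptco) auto
  from constructible_ex_merge[OF this, of M]
  have "constructible (\<lambda>X. \<exists>Y. ?T (merge M X Y))" .
  moreover have "(\<exists>Y. ?T (merge M X Y)) \<longleftrightarrow> (\<exists>F\<subseteq>crit V U a E (wtco X). finite F \<and> card F = M)" for X
  proof
    assume "\<exists>Y. ?T (merge M X Y)"
    then obtain Y where "?T (merge M X Y)" by blast
    then have Y: "\<forall>j<M. ptco U a j Y \<in> crit V U a E (wtco X)"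
      "\<forall>i<M. \<forall>j<M. i \<noteq> j \<longrightarrow> (\<exists>x\<in>U. \<not> ptco U a i Y x = ptco U a j Y x)"
      by (simp_all add: ptco_merge)
    have "inj_on (\<lambda>j. ptco U a j Y) {..<M}"
    proof (rule inj_onI, rule ccontr)
      fix i j assume "i \<in> {..<M}" "j \<in> {..<M}" "ptco U a i Y = ptco U a j Y" "i \<noteq> j"
      then show False using Y(2)[rule_format, of i j] by auto
    qed
    then have "card ((\<lambda>j. ptco U a j Y) ` {..<M}) = M" by (simp add: card_image)
    then show "\<exists>F\<subseteq>crit V U a E (wtco X). finite F \<and> card F = M"
      using Y(1) by (intro exI[of _ "(\<lambda>j. ptco U a j Y) ` {..<M}"]) auto
  next
    assume "\<exists>F\<subseteq>crit V U a E (wtco X). finite F \<and> card F = M"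
    then obtain F where F: "F \<subseteq> crit V U a E (wtco X)" "finite F" "card F = M" by blast
    then obtain g where g: "bij_betw g {..<M} F"
      using ex_bij_betw_nat_finite[of F] by (metis atLeast0LessThan)
    define Y where "Y i = (case i of Inl e \<Rightarrow> 0 | Inr jx \<Rightarrow> g (fst jx) (snd jx))" for i :: "'a set + nat \<times> 'a"
    have gC: "g j \<in> crit V U a E (wtco X)" if "j < M" for j using g F(1) that by (auto simp: bij_betw_def)
    have Yg: "ptco U a j Y = g j" if "j < M" for j
      using gC[OF that] by (auto simp: ptco_def Y_def crit_def fun_eq_iff)
    have "\<exists>x\<in>U. \<not> g i x = g j x" if "i < M" "j < M" "i \<noteq> j" for i j
    proof (rule ccontr)
      assume "\<not> ?thesis"
      then have "g i x = g j x" for x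
        using gC[OF that(1)] gC[OF that(2)] by (cases "x \<in> U") (auto simp: crit_def)
      then have "g i = g j" by blast
      then show False using g that by (auto simp: bij_betw_def inj_on_def)
    qed
    then have "?T (merge M X Y)" using gC by (simp add: ptco_merge Yg)
    then show "\<exists>Y. ?T (merge M X Y)" by blast
  qed
  ultimately show ?thesis by (simp only:)
qed

lemma constructible_bad:
  "constructible (\<lambda>X. \<exists>w\<in>crit V U a E (wtco X). \<not> (nondegenerate V U E (wtco X) w \<and> (\<forall>x\<in>U. w x \<noteq> 0)))"
proof -
  let ?k = "\<lambda>X. ptco U a 0 X \<in> crit V U a E (wtco X) \<and>
     (\<forall>x\<in>U. dlapl V E (wtco X) (ptco U a 0 X) (ptco U (\<lambda>x. 0) 1 X) x = 0)"
  let ?T = "\<lambda>X. (ptco U a 0 X \<in> crit V U a E (wtco X) \<and> (\<exists>x\<in>U. ptco U a 0 X x = 0)) \<or>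
     (?k X \<and> (\<exists>x\<in>U. \<not> ptco U (\<lambda>x. 0) 1 X x = 0))"
  have "constructible ?T"
    by (intro constructible_disj constructible.conj[OF constructible_kernel] constructible.conj constructible_crit
        constructible_bex finite_U constructible.neg constructible.zero mpoly_fun_ptco)
  from constructible_ex_merge[OF this, of 2]
  have "constructible (\<lambda>X. \<exists>Y. ?T (merge 2 X Y))" .
  moreover have "(\<exists>Y. ?T (merge 2 X Y)) \<longleftrightarrow>
     (\<exists>w\<in>crit V U a E (wtco X). \<not> (nondegenerate V U E (wtco X) w \<and> (\<forall>x\<in>U. w x \<noteq> 0)))" for X
  proof
    assume "\<exists>Y. ?T (merge 2 X Y)"
    then obtain Y where Y: "ptco U a 0 Y \<in> crit V U a E (wtco X)"
      "(\<exists>x\<in>U. ptco U a 0 Y x = 0) \<or> (\<forall>x\<in>U. dlapl V E (wtco X) (ptco U a 0 Y) (ptco U (\<lambda>x. 0) 1 Y) x = 0) \<and>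
        (\<exists>x\<in>U. ptco U (\<lambda>x. 0) 1 Y x \<noteq> 0)"
      by (auto simp: ptco_merge)
    have "\<forall>x. x \<notin> U \<longrightarrow> ptco U (\<lambda>x. 0) 1 Y x = 0" by (simp add: ptco_def)
    then show "\<exists>w\<in>crit V U a E (wtco X). \<not> (nondegenerate V U E (wtco X) w \<and> (\<forall>x\<in>U. w x \<noteq> 0))"
      using Y unfolding nondegenerate_def by blast
  next
    assume "\<exists>w\<in>crit V U a E (wtco X). \<not> (nondegenerate V U E (wtco X) w \<and> (\<forall>x\<in>U. w x \<noteq> 0))"
    then obtain w where w: "w \<in> crit V U a E (wtco X)" and d: "\<not> nondegenerate V U E (wtco X) w \<or> (\<exists>x\<in>U. w x = 0)"
      by blast
    obtain h where h: "(\<exists>x\<in>U. w x = 0) \<or> ((\<forall>x. x \<notin> U \<longrightarrow> h x = 0) \<and> (\<forall>x\<in>U. dlapl V E (wtco X) w h x = 0) \<and> (\<exists>x\<in>U. h x \<noteq> 0))"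
      using d unfolding nondegenerate_def by blast
    define Y where "Y i = (case i of Inl e \<Rightarrow> 0 | Inr jx \<Rightarrow> if fst jx = 0 then w (snd jx) else h (snd jx))" for i :: "'a set + nat \<times> 'a"
    have Yw: "ptco U a 0 Y = w" using w by (auto simp: ptco_def Y_def crit_def fun_eq_iff)
    have Yh: "ptco U (\<lambda>x. 0) 1 Y = h" if "\<forall>x. x \<notin> U \<longrightarrow> h x = 0" using that by (auto simp: ptco_def Y_def fun_eq_iff)
    have "?T (merge 2 X Y)" using h w Yh by (auto simp: ptco_merge Yw)
    then show "\<exists>Y. ?T (merge 2 X Y)" by blast
  qed
  ultimately show ?thesis by (simp only:)
qed

text \<open>
  Exactly \<open>N\<close> critical points means at least \<open>N\<close> but not at least \<open>N + 1\<close>, which also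
  excludes infinite sets.
\<close>

theorem good_dichotomy:
  "\<exists>f. mpoly_fun f \<and> (\<exists>q. f q \<noteq> 0) \<and>
     ((\<forall>q. f q \<noteq> 0 \<longrightarrow> good V U a E q N) \<or> (\<forall>q. f q \<noteq> 0 \<longrightarrow> \<not> good V U a E q N))"
proof -
  have "constructible (\<lambda>X :: 'a set + nat \<times> 'a \<Rightarrow> complex. good V U a E (wtco X) N)"
  proof -
    have "good V U a E (wtco X) N \<longleftrightarrow>
      ((\<exists>F\<subseteq>crit V U a E (wtco X). finite F \<and> card F = N) \<and> \<not> (\<exists>F\<subseteq>crit V U a E (wtco X). finite F \<and> card F = Suc N)) \<and>
      \<not> (\<exists>w\<in>crit V U a E (wtco X). \<not> (nondegenerate V U E (wtco X) w \<and> (\<forall>x\<in>U. w x \<noteq> 0)))"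
      for X :: "'a set + nat \<times> 'a \<Rightarrow> complex"
      unfolding good_def subsets_of_card_iff[symmetric] by blast
    moreover have "constructible \<dots>"
      by (intro constructible.conj constructible.neg constructible_many_crit constructible_bad)
    ultimately show ?thesis by presburger
  qed
  from constructible_dichotomy[OF this]
  obtain f X where f: "mpoly_fun f" "f X \<noteq> 0" and
    d: "(\<forall>X. f X \<noteq> 0 \<longrightarrow> good V U a E (wtco X) N) \<or> (\<forall>X. f X \<noteq> 0 \<longrightarrow> \<not> good V U a E (wtco X) N)" by blast
  let ?X = "\<lambda>q i. case i of Inl e \<Rightarrow> q e | Inr p \<Rightarrow> X (Inr p)"
  have "mpoly_fun (\<lambda>q. f (?X q))"
  proof (rule mpoly_fun_compose[OF f(1)])
    fix i show "mpoly_fun (\<lambda>q. ?X q i)" by (cases i) (auto intro: mpoly_fun.intros)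
  qed
  moreover have "wtco (?X q) = q" for q by (simp add: wtco_def fun_eq_iff)
  moreover have "?X (wtco X) = X" by (auto simp: wtco_def fun_eq_iff split: sum.split)
  ultimately show ?thesis using f(2) d by (intro exI[of _ "\<lambda>q. f (?X q)"]) metis
qed

lemma mpoly_fun_wt: "mpoly_fun (\<lambda>q. wt E q x y)"
  by (cases "{x, y} \<in> E") (auto simp: wt_def intro: mpoly_fun.intros)

text \<open>
  All the forms in question are nonzero when every weight is \<open>1\<close>, because they then count edges.
\<close>

lemma nonresonant_generic: "\<exists>f. mpoly_fun f \<and> (\<exists>q. f q \<noteq> 0) \<and> (\<forall>q. f q \<noteq> 0 \<longrightarrow> nonresonant V U B E q)"
proof -
  let ?inner = "\<lambda>q S. (\<Sum>x\<in>S. \<Sum>y\<in>S. wt E q x y)"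
  let ?outer = "\<lambda>q S. ?inner q S + 2 * (\<Sum>x\<in>S. \<Sum>y\<in>V - S. wt E q x y)"
  let ?A = "Pow U - {{}}" and ?C = "{S \<in> Pow (U \<union> B). \<exists>x\<in>S. \<exists>y\<in>S. {x, y} \<in> E}"
  let ?f = "\<lambda>q. (\<Prod>S\<in>?A. ?outer q S) * (\<Prod>S\<in>?C. ?inner q S)"
  have fin: "finite V" "finite U" "finite B" using finite_V UV BV finite_subset by auto
  have "mpoly_fun ?f"
    by (intro mpoly_fun.mult mpoly_fun_prod mpoly_fun.add mpoly_fun_sum mpoly_fun_wt mpoly_fun.const)
  moreover have "nonresonant V U B E q" if "?f q \<noteq> 0" for q
  proof -
    have "\<forall>S\<in>?A. ?outer q S \<noteq> 0" "\<forall>S\<in>?C. ?inner q S \<noteq> 0" using that fin by auto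
    then show ?thesis unfolding nonresonant_def by blast
  qed
  moreover have "?f (\<lambda>e. 1) \<noteq> 0"
  proof -
    define n where "n x y = (if {x, y} \<in> E then 1 else 0 :: nat)" for x y
    have w1: "wt E (\<lambda>e. 1) x y = of_nat (n x y)" for x y by (simp add: wt_def n_def)
    have pos: "(\<Sum>x\<in>S. \<Sum>y\<in>T. n x y) \<noteq> 0" if "finite S" "finite T" "x \<in> S" "y \<in> T" "{x, y} \<in> E" for S T x y
      using that by (auto simp: n_def)
    have "?outer (\<lambda>e. 1) S \<noteq> 0" if S: "S \<in> ?A" for S
    proof -
      obtain x where x: "x \<in> S" "x \<in> U" using S by auto
      have finS: "finite S" using S fin by (auto intro: finite_subset)
      have "b0 \<in> V - S" using b0 BV disj S by auto
      then have "(\<Sum>x\<in>S. \<Sum>y\<in>V - S. n x y) \<noteq> 0" using pos[OF finS _ x(1) _ pinned[OF x(2)]] fin by blast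
      then have "(\<Sum>x\<in>S. \<Sum>y\<in>S. n x y) + 2 * (\<Sum>x\<in>S. \<Sum>y\<in>V - S. n x y) \<noteq> 0" by linarith
      then have "complex_of_nat ((\<Sum>x\<in>S. \<Sum>y\<in>S. n x y) + 2 * (\<Sum>x\<in>S. \<Sum>y\<in>V - S. n x y)) \<noteq> 0"
        unfolding of_nat_eq_0_iff .
      then show ?thesis unfolding w1 by (simp only: of_nat_add of_nat_mult of_nat_sum of_nat_numeral not_False_eq_True)
    qed
    moreover have "?inner (\<lambda>e. 1) S \<noteq> 0" if S: "S \<in> ?C" for S
    proof -
      obtain x y where x: "x \<in> S" "y \<in> S" "{x, y} \<in> E" using S by auto
      have finS: "finite S" using S fin by (auto intro: finite_subset)
      have "complex_of_nat (\<Sum>x\<in>S. \<Sum>y\<in>S. n x y) \<noteq> 0"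
        unfolding of_nat_eq_0_iff by (rule pos[OF finS finS x])
      then show ?thesis unfolding w1 by (simp only: of_nat_sum not_False_eq_True)
    qed
    moreover have "finite ?A" "finite ?C" using fin by auto
    ultimately show ?thesis by (simp add: prod_zero_iff)
  qed
  ultimately show ?thesis by (intro exI[of _ ?f]) blast
qed

end

section \<open>Deletion and contraction\<close>

definition ext_col :: "'a set \<Rightarrow> ('a \<Rightarrow> nat) \<Rightarrow> ('a \<Rightarrow> nat) \<Rightarrow> 'a \<Rightarrow> nat" where
  "ext_col U \<kappa> c x = (if x \<in> U then c x else \<kappa> x)"

definition pinned_colourings :: "'a set \<Rightarrow> ('a \<Rightarrow> nat) \<Rightarrow> 'a set set \<Rightarrow> nat \<Rightarrow> ('a \<Rightarrow> nat) set" where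
  "pinned_colourings U \<kappa> E n =
     {c \<in> U \<rightarrow>\<^sub>E {..<n}. \<forall>x y. {x, y} \<in> E \<longrightarrow> ext_col U \<kappa> c x \<noteq> ext_col U \<kappa> c y}"

lemma finite_pinned_colourings: "finite U \<Longrightarrow> finite (pinned_colourings U \<kappa> E n)"
  unfolding pinned_colourings_def by (rule finite_subset[of _ "U \<rightarrow>\<^sub>E {..<n}"]) (auto simp: finite_PiE)

context contraction
begin

lemma ext_col_contr:
  assumes c: "c \<in> U \<rightarrow>\<^sub>E {..<n}" and eq: "ext_col U \<kappa> c u = ext_col U \<kappa> c v"
  shows "(\<forall>x y. {x, y} \<in> E \<longrightarrow> ext_col U \<kappa> c x \<noteq> ext_col U \<kappa> c y) \<longleftrightarrow>
    (\<forall>x y. {x, y} \<in> contr_edges u v E \<longrightarrow>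
       ext_col (U - {u}) \<kappa> (restrict c (U - {u})) x \<noteq> ext_col (U - {u}) \<kappa> (restrict c (U - {u})) y)"
    (is "?l \<longleftrightarrow> ?r")
proof -
  let ?g = "ext_col U \<kappa> c" and ?d = "ext_col (U - {u}) \<kappa> (restrict c (U - {u}))"
  have gd: "?d x = ?g x" if "x \<noteq> u" for x using that by (auto simp: ext_col_def)
  show ?thesis
  proof
    assume l: ?l
    show ?r
    proof (intro allI impI)
      fix x y assume e: "{x, y} \<in> contr_edges u v E"
      have xy: "x \<noteq> u" "y \<noteq> u" using contr_edge_u[of y] contr_edge_u[of x] e by (auto simp: insert_commute)
      show "?d x \<noteq> ?d y"
        using contr_edge_iff[OF xy] e l[rule_format, of x y] l[rule_format, of u y] l[rule_format, of u x] eq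
        unfolding gd[OF xy(1)] gd[OF xy(2)] by auto
    qed
  next
    assume r: ?r
    show ?l
    proof (intro allI impI)
      fix x y assume e: "{x, y} \<in> E"
      have xy: "x \<noteq> y" using edgeD[OF e] by simp
      consider "x = u" "y \<noteq> u" | "x \<noteq> u" "y = u" | "x \<noteq> u" "y \<noteq> u" using xy by blast
      then show "?g x \<noteq> ?g y"
      proof cases
        case 1
        then have "?d v \<noteq> ?d y" using r e contr_edge_iff[of v y] uv by simp
        then show ?thesis using 1 eq gd uv by simp
      next
        case 2
        then have "?d x \<noteq> ?d v" using r e contr_edge_iff[of x v] uv by (simp add: insert_commute)
        then show ?thesis using 2 eq gd uv by simp
      next
        case 3
        then have "?d x \<noteq> ?d y" using r e contr_edge_iff[of x y] by simp
        then show ?thesis using 3 gd by simp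
      qed
    qed
  qed
qed

text \<open>
  Colourings of the graph without \<open>{u, v}\<close> either separate \<open>u\<close> and \<open>v\<close>, or give them the same colour and are
  colourings of the contracted graph. The colours of the pins must be available, since \<open>u\<close>
  receives such a colour when \<open>v\<close> is a pin.
\<close>

lemma card_pinned_colourings:
  assumes \<kappa>: "\<kappa> ` B \<subseteq> {..<n}"
  shows "card (pinned_colourings U \<kappa> E n) = card (pinned_colourings U \<kappa> (insert {u, v} E) n) +
     card (pinned_colourings (U - {u}) \<kappa> (contr_edges u v E) n)"
proof -
  let ?g = "ext_col U \<kappa>"
  let ?P = "pinned_colourings U \<kappa> E n"
  let ?Q = "{c \<in> ?P. ?g c u = ?g c v}"
  have "(\<forall>x y. {x, y} \<in> insert {u, v} E \<longrightarrow> f x \<noteq> f y) \<longleftrightarrow> (\<forall>x y. {x, y} \<in> E \<longrightarrow> f x \<noteq> f y) \<and> f u \<noteq> f v"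
    for f :: "'a \<Rightarrow> nat"
    by (auto simp: doubleton_eq_iff)
  then have split: "pinned_colourings U \<kappa> (insert {u, v} E) n = {c \<in> ?P. ?g c u \<noteq> ?g c v}"
    unfolding pinned_colourings_def by simp
  have "card ({c \<in> ?P. ?g c u \<noteq> ?g c v} \<union> ?Q) = card {c \<in> ?P. ?g c u \<noteq> ?g c v} + card ?Q"
    by (rule card_Un_disjoint) (use finite_pinned_colourings[OF finite_U, of \<kappa> E n] in auto)
  moreover have "{c \<in> ?P. ?g c u \<noteq> ?g c v} \<union> ?Q = ?P" by blast
  ultimately have "card ?P = card (pinned_colourings U \<kappa> (insert {u, v} E) n) + card ?Q"
    unfolding split by simp
  moreover have bij: "bij_betw (\<lambda>c. restrict c (U - {u})) ?Q (pinned_colourings (U - {u}) \<kappa> (contr_edges u v E) n)"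
  proof (rule bij_betw_byWitness[where f' = "\<lambda>d. d(u := ext_col (U - {u}) \<kappa> d v)"])
    have inv: "(restrict c (U - {u}))(u := ext_col (U - {u}) \<kappa> (restrict c (U - {u})) v) = c" if c: "c \<in> ?Q" for c
    proof
      fix x
      have "c \<in> extensional U" "?g c u = ?g c v" using c by (auto simp: pinned_colourings_def PiE_iff)
      then show "((restrict c (U - {u}))(u := ext_col (U - {u}) \<kappa> (restrict c (U - {u})) v)) x = c x"
        using u uv by (auto simp: ext_col_def extensional_def restrict_def)
    qed
    then show "\<forall>c\<in>?Q. (restrict c (U - {u}))(u := ext_col (U - {u}) \<kappa> (restrict c (U - {u})) v) = c" by blast
    have res: "restrict (d(u := ext_col (U - {u}) \<kappa> d v)) (U - {u}) = d"
      if "d \<in> pinned_colourings (U - {u}) \<kappa> (contr_edges u v E) n" for d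
      using that by (auto simp: pinned_colourings_def PiE_iff extensional_def restrict_def fun_eq_iff)
    then show "\<forall>d\<in>pinned_colourings (U - {u}) \<kappa> (contr_edges u v E) n.
        restrict (d(u := ext_col (U - {u}) \<kappa> d v)) (U - {u}) = d" by blast
    show "(\<lambda>c. restrict c (U - {u})) ` ?Q \<subseteq> pinned_colourings (U - {u}) \<kappa> (contr_edges u v E) n"
    proof
      fix d assume "d \<in> (\<lambda>c. restrict c (U - {u})) ` ?Q"
      then obtain c where c: "c \<in> ?Q" "d = restrict c (U - {u})" by blast
      then have "c \<in> U \<rightarrow>\<^sub>E {..<n}" by (simp add: pinned_colourings_def)
      with ext_col_contr[OF this, of \<kappa>] c show "d \<in> pinned_colourings (U - {u}) \<kappa> (contr_edges u v E) n"
        by (auto simp: pinned_colourings_def PiE_iff)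
    qed
    show "(\<lambda>d. d(u := ext_col (U - {u}) \<kappa> d v)) ` pinned_colourings (U - {u}) \<kappa> (contr_edges u v E) n \<subseteq> ?Q"
    proof
      fix c assume "c \<in> (\<lambda>d. d(u := ext_col (U - {u}) \<kappa> d v)) ` pinned_colourings (U - {u}) \<kappa> (contr_edges u v E) n"
      then obtain d where d: "d \<in> pinned_colourings (U - {u}) \<kappa> (contr_edges u v E) n"
        and cd: "c = d(u := ext_col (U - {u}) \<kappa> d v)" by blast
      have dU: "d \<in> (U - {u}) \<rightarrow>\<^sub>E {..<n}" using d by (simp add: pinned_colourings_def)
      have "ext_col (U - {u}) \<kappa> d v < n"
        using dU \<kappa> v uv by (auto simp: ext_col_def PiE_iff)
      then have cU: "c \<in> U \<rightarrow>\<^sub>E {..<n}" using dU u unfolding cd by (auto simp: PiE_iff extensional_def)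
      have eq: "?g c u = ?g c v" using u uv unfolding cd by (auto simp: ext_col_def)
      have "restrict c (U - {u}) = d" unfolding cd by (rule res[OF d])
      then show "c \<in> ?Q" using ext_col_contr[OF cU eq] cU eq d by (simp add: pinned_colourings_def)
    qed
  qed
  ultimately show ?thesis using bij_betw_same_card[OF bij] by simp
qed

text \<open>
  Contraction of weights is surjective, so generic weights contract to generic weights. At parallel
  edges the edge at \<open>v\<close> carries all of the weight.
\<close>

lemma contr_wt_lift:
  "\<exists>q'. \<forall>e\<in>contr_edges u v E. contr_wt u v E q' e = q e"
proof (intro exI ballI)
  define q' where "q' e = (if u \<in> e then (if insert v (e - {u}) \<in> E then 0 else q (insert v (e - {u}))) else q e)" for e
  fix e assume "e \<in> contr_edges u v E"
  then consider "e \<in> E" "u \<notin> e" | y where "e = {v, y}" "{u, y} \<in> E"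
    unfolding contr_edges_def by blast
  then show "contr_wt u v E q' e = q e"
  proof cases
    case 2
    then have y: "y \<noteq> u" "y \<noteq> v" using edgeD[of u y] notin by auto
    have "insert u (e - {v}) = {u, y}" "insert v ({u, y} - {u}) = e" "u \<notin> e" "v \<in> e" using y 2 uv by auto
    then show ?thesis using 2 by (simp add: contr_wt_def q'_def)
  next
    case 1
    show ?thesis
    proof (cases "v \<in> e \<and> insert u (e - {v}) \<in> E")
      case True
      have "insert v (insert u (e - {v}) - {u}) = e" using True 1 by auto
      then show ?thesis using 1 by (simp add: contr_wt_def q'_def)
    next
      case False
      then show ?thesis using 1 by (auto simp: contr_wt_def q'_def)
    qed
  qed
qed

text \<open>
  The polynomial \<open>f\<close> may involve irrelevant coordinates. They are frozen at the values of a point where \<open>f\<close> does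
  not vanish.
\<close>

lemma contr_generic:
  assumes f: "mpoly_fun f" "f q0 \<noteq> 0"
    and g: "\<And>q. f q \<noteq> 0 \<Longrightarrow> good V (U - {u}) a (contr_edges u v E) q N"
  shows "\<exists>f'. mpoly_fun f' \<and> (\<exists>q. f' q \<noteq> 0) \<and>
     (\<forall>q. f' q \<noteq> 0 \<longrightarrow> good V (U - {u}) a (contr_edges u v E) (contr_wt u v E q) N)"
proof -
  let ?q = "\<lambda>q e. if e \<in> contr_edges u v E then contr_wt u v E q e else q0 e"
  have "mpoly_fun (\<lambda>q. f (?q q))"
  proof (rule mpoly_fun_compose[OF f(1)])
    fix e
    show "mpoly_fun (\<lambda>q. ?q q e)"
      by (cases "e \<in> contr_edges u v E"; cases "e \<in> E"; cases "v \<in> e"; cases "insert u (e - {v}) \<in> E")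
        (simp_all add: contr_wt_def mpoly_fun.const mpoly_fun.coord mpoly_fun.add)
  qed
  moreover obtain q' where "\<forall>e\<in>contr_edges u v E. contr_wt u v E q' e = q0 e" using contr_wt_lift by blast
  then have "?q q' = q0" by auto
  then have "f (?q q') \<noteq> 0" using f by simp
  moreover have "good V (U - {u}) a (contr_edges u v E) (contr_wt u v E q) N" if "f (?q q) \<noteq> 0" for q
    using g[OF that] by (subst (asm) good_cong[of _ _ _ "contr_wt u v E q"]) auto
  ultimately show ?thesis by (intro exI[of _ "\<lambda>q. f (?q q)"]) blast
qed

text \<open>
  Moving weight from \<open>{v, b0}\<close> to \<open>{u, b0}\<close> changes neither the contracted weights at moving vertices
  nor the critical points of the contracted graph, but it changes \<open>lapl\<close> at \<open>u\<close> by a nonzero multiple of the amount. So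
  all but finitely many amounts avoid the finitely many bad coincidences.
\<close>

lemma shift_weights:
  assumes F: "mpoly_fun F" "F q0 \<noteq> 0"
    and fin: "finite (crit V (U - {u}) a (contr_edges u v E) (contr_wt u v E q0))"
  shows "\<exists>q. F q \<noteq> 0 \<and> (\<forall>w\<in>crit V (U - {u}) a (contr_edges u v E) (contr_wt u v E q). lapl V E q (w(u := w v)) u \<noteq> 0)"
proof -
  define d where "d e = (if e = {u, b0} then 1 else if e = {v, b0} then -1 else 0 :: complex)" for e
  let ?q = "\<lambda>s e. q0 e + s * d e"
  let ?C = "\<lambda>s. crit V (U - {u}) a (contr_edges u v E) (contr_wt u v E (?q s))"
  have nub: "u \<noteq> b0" by (rule u_ne_b0)
  have C: "?C s = crit V (U - {u}) a (contr_edges u v E) (contr_wt u v E q0)" for s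
  proof (rule crit_cong)
    fix e assume e: "e \<in> contr_edges u v E" "e \<inter> (U - {u}) \<noteq> {}"
    have ue: "u \<notin> e"
    proof
      assume "u \<in> e"
      then obtain y where "e = {v, y}" "{u, y} \<in> E" using e by (auto simp: contr_edges_def)
      then show False using \<open>u \<in> e\<close> uv edgeD[of u u] by auto
    qed
    show "contr_wt u v E (?q s) e = contr_wt u v E q0 e"
    proof (cases "e = {v, b0}")
      case True
      then have "v \<in> U" using e b0 disj by auto
      then have "{v, b0} \<in> E" "{u, b0} \<in> E" using pinned u by auto
      moreover have "insert u (e - {v}) = {u, b0}" using True vb0 by auto
      moreover have "{u, b0} \<noteq> {v, b0}" using uv nub by (auto simp: doubleton_eq_iff)
      ultimately show ?thesis using True by (simp add: contr_wt_def d_def)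
    next
      case False
      have "d e = 0" using False ue by (auto simp: d_def)
      moreover have "d (insert u (e - {v})) = 0" if "v \<in> e"
      proof -
        have "insert u (e - {v}) \<noteq> {u, b0}"
        proof
          assume eq: "insert u (e - {v}) = {u, b0}"
          then have "e - {v} = {b0}" using ue nub by auto
          then show False using False \<open>v \<in> e\<close> by auto
        qed
        moreover have "insert u (e - {v}) \<noteq> {v, b0}" using uv nub by auto
        ultimately show ?thesis by (simp add: d_def)
      qed
      ultimately show ?thesis by (auto simp: contr_wt_def)
    qed
  qed
  have lap: "lapl V E (?q s) (w(u := w v)) u = lapl V E q0 (w(u := w v)) u + s * (1 / (w v - w b0))" for s w
  proof -
    have "wt E (?q s) u y = wt E q0 u y + (if y = b0 then s else 0)" for y
      using pinned[OF u] uv nub by (auto simp: wt_def d_def doubleton_eq_iff)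
    then have "lapl V E (?q s) (w(u := w v)) u =
        (\<Sum>y\<in>V. wt E q0 u y / ((w(u := w v)) u - (w(u := w v)) y) + (if y = b0 then s / (w v - w b0) else 0))"
      unfolding lapl_def using nub by (intro sum.cong refl) (auto simp: add_divide_distrib)
    also have "\<dots> = lapl V E q0 (w(u := w v)) u + s * (1 / (w v - w b0))"
      unfolding sum.distrib lapl_def using finite_V b0 BV by (auto simp: subset_iff)
    finally show ?thesis .
  qed
  have "finite {s. lapl V E (?q s) (w(u := w v)) u = 0}" if w: "w \<in> ?C 0" for w
  proof -
    have "(w(u := w v)) u \<noteq> (w(u := w v)) b0" by (rule crit_contr_no_collision[OF w pinned[OF u]])
    then have nz: "w v - w b0 \<noteq> 0" using nub by simp
    have "{s. lapl V E (?q s) (w(u := w v)) u = 0} \<subseteq> {- lapl V E q0 (w(u := w v)) u * (w v - w b0)}"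
    proof
      fix s assume "s \<in> {s. lapl V E (?q s) (w(u := w v)) u = 0}"
      then have "lapl V E q0 (w(u := w v)) u + s / (w v - w b0) = 0" unfolding lap by simp
      then show "s \<in> {- lapl V E q0 (w(u := w v)) u * (w v - w b0)}"
        using nz by (simp add: field_simps add_eq_0_iff)
    qed
    then show ?thesis by (rule finite_subset) simp
  qed
  moreover have "finite (?C 0)" unfolding C by (rule fin)
  ultimately have "finite (\<Union>w\<in>?C 0. {s. lapl V E (?q s) (w(u := w v)) u = 0})" by blast
  moreover have "finite {s. F (?q s) = 0}"
    by (rule finite_zeros_on_line[OF F(1), of _ 0]) (use F(2) in simp)
  ultimately have "finite ((\<Union>w\<in>?C 0. {s. lapl V E (?q s) (w(u := w v)) u = 0}) \<union> {s. F (?q s) = 0})" by blast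
  then obtain s where "s \<notin> (\<Union>w\<in>?C 0. {s. lapl V E (?q s) (w(u := w v)) u = 0}) \<union> {s. F (?q s) = 0}"
    using ex_new_if_finite infinite_UNIV_char_0 by blast
  then have "F (?q s) \<noteq> 0" "\<forall>w\<in>?C s. lapl V E (?q s) (w(u := w v)) u \<noteq> 0"
    unfolding C by auto
  then show ?thesis by blast
qed

text \<open>
  If the expected count failed generically, say wherever \<open>f4\<close> does not vanish, choose weights that are generic
  for all ingredients and for \<open>f4\<close>. Along the line on which only the weight of \<open>{u, v}\<close> varies,
  \<open>f4\<close> has finitely many zeros, so it does not vanish for small nonzero weights, where
  \<open>good_insert_edge\<close> applies.
\<close>

theorem good_generic_insert_edge:
  assumes f1: "mpoly_fun f1" "\<exists>q. f1 q \<noteq> 0" "\<And>q. f1 q \<noteq> 0 \<Longrightarrow> good V U a E q N1"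
    and f2: "mpoly_fun f2" "\<exists>q. f2 q \<noteq> 0" "\<And>q. f2 q \<noteq> 0 \<Longrightarrow> good V (U - {u}) a (contr_edges u v E) q N2"
  shows "\<exists>f. mpoly_fun f \<and> (\<exists>q. f q \<noteq> 0) \<and> (\<forall>q. f q \<noteq> 0 \<longrightarrow> good V U a (insert {u, v} E) q (N1 + N2))"
proof -
  interpret G: pinned_graph V U B a b0 "insert {u, v} E" by (rule pinned_graph_insert)
  obtain f4 where f4: "mpoly_fun f4" "\<exists>q. f4 q \<noteq> 0" and
    d: "(\<forall>q. f4 q \<noteq> 0 \<longrightarrow> good V U a (insert {u, v} E) q (N1 + N2)) \<or>
        (\<forall>q. f4 q \<noteq> 0 \<longrightarrow> \<not> good V U a (insert {u, v} E) q (N1 + N2))"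
    using G.good_dichotomy[of "N1 + N2"] by blast
  obtain f3 where f3: "mpoly_fun f3" "\<exists>q. f3 q \<noteq> 0"
    "\<And>q. f3 q \<noteq> 0 \<Longrightarrow> good V (U - {u}) a (contr_edges u v E) (contr_wt u v E q) N2"
    using contr_generic[OF f2(1) _ f2(3)] f2(2) by blast
  obtain R where R: "mpoly_fun R" "\<exists>q. R q \<noteq> 0" "\<And>q. R q \<noteq> 0 \<Longrightarrow> nonresonant V U B E q"
    using nonresonant_generic by blast
  have m: "mpoly_fun (\<lambda>q. f1 q * f3 q)" "mpoly_fun (\<lambda>q. R q * f4 q)"
    by (intro mpoly_fun.mult f1 f3 R f4)+
  have ne: "\<exists>q. f1 q * f3 q \<noteq> 0" "\<exists>q. R q * f4 q \<noteq> 0"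
    using common_nonzero[OF f1(1) f3(1)] common_nonzero[OF R(1) f4(1)] f1(2) f3(2) R(2) f4(2) by auto
  then obtain q0 where q0: "f1 q0 * f3 q0 \<noteq> 0" "R q0 * f4 q0 \<noteq> 0"
    using common_nonzero[OF m] by blast
  have F: "mpoly_fun (\<lambda>q. (f1 q * f3 q) * (R q * f4 q))" by (intro mpoly_fun.mult m)
  have "good V (U - {u}) a (contr_edges u v E) (contr_wt u v E q0) N2" using f3(3) q0 by auto
  then have "finite (crit V (U - {u}) a (contr_edges u v E) (contr_wt u v E q0))" by (simp add: good_def)
  from shift_weights[OF F _ this] q0
  obtain q where q: "f1 q * f3 q * (R q * f4 q) \<noteq> 0" and
    A: "\<And>w. w \<in> crit V (U - {u}) a (contr_edges u v E) (contr_wt u v E q) \<Longrightarrow> lapl V E q (w(u := w v)) u \<noteq> 0"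
    by auto
  have "\<forall>\<^sub>F t in at 0. good V U a (insert {u, v} E) (q({u, v} := t)) (N1 + N2)"
    by (rule good_insert_edge[OF _ _ _ A]) (use q f1(3) f3(3) R(3) in auto)
  moreover have "\<forall>\<^sub>F t in at 0. f4 (q({u, v} := t)) \<noteq> 0"
  proof -
    let ?l = "\<lambda>t i. (q({u, v} := 0)) i + t * (if i = {u, v} then 1 else 0)"
    have l: "?l t = q({u, v} := t)" for t by auto
    have "q({u, v} := q {u, v}) = q" by simp
    then have "f4 (?l (q {u, v})) \<noteq> 0" using q unfolding l by simp
    from finite_zeros_on_line[OF f4(1) this] have fin: "finite {t. f4 (q({u, v} := t)) = 0}" unfolding l .
    have "open (- ({t. f4 (q({u, v} := t)) = 0} - {0}))"
      using fin by (intro open_Compl finite_imp_closed) simp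
    then show ?thesis
      unfolding eventually_at_topological
      by (intro exI[of _ "- ({t. f4 (q({u, v} := t)) = 0} - {0})"]) auto
  qed
  ultimately have "\<forall>\<^sub>F t in at 0. good V U a (insert {u, v} E) (q({u, v} := t)) (N1 + N2) \<and> f4 (q({u, v} := t)) \<noteq> 0"
    by (rule eventually_conj)
  from eventually_happens'[OF _ this]
  obtain t where "good V U a (insert {u, v} E) (q({u, v} := t)) (N1 + N2)" "f4 (q({u, v} := t)) \<noteq> 0"
    by auto
  then show ?thesis using d f4 by blast
qed

end

lemma card_contr_edges_le:
  assumes "finite E" "{u} \<notin> E"
  shows "card (contr_edges u v E) \<le> card E"
proof -
  have "contr_edges u v E \<subseteq> (\<lambda>e. if u \<in> e then insert v (e - {u}) else e) ` E"
  proof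
    fix e assume "e \<in> contr_edges u v E"
    then consider "e \<in> E" "u \<notin> e" | y where "e = {v, y}" "{u, y} \<in> E"
      unfolding contr_edges_def by blast
    then show "e \<in> (\<lambda>e. if u \<in> e then insert v (e - {u}) else e) ` E"
    proof cases
      case 1 then show ?thesis by (intro image_eqI[of _ _ e]) auto
    next
      case 2
      show ?thesis
      proof (cases "y = u")
        case True then show ?thesis using 2 assms(2) by simp
      next
        case False then show ?thesis using 2 by (intro image_eqI[of _ _ "{u, y}"]) auto
      qed
    qed
  qed
  then show ?thesis using surj_card_le[OF assms(1)] by blast
qed

text \<open>
  Deletion-contraction of all edges other than those to \<open>b0\<close>. In the base case the equation at a
  moving vertex has a single term, hence no solution for nonzero weight, and the colourings are counted by
  \<open>(n - 1) ^ card U\<close>, which vanishes at \<open>n = 1\<close> unless \<open>U\<close> is empty.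
\<close>

theorem generic_count:
  assumes "pinned_graph V U B a b0 E" and \<kappa>: "inj_on \<kappa> B"
  shows "\<exists>(p :: int poly) N.
     (\<forall>n. \<kappa> ` B \<subseteq> {..<n} \<longrightarrow> poly p (int n) = int (card (pinned_colourings U \<kappa> E n))) \<and>
     int N = (-1) ^ card U * poly p 1 \<and>
     (\<exists>f. mpoly_fun f \<and> (\<exists>q. f q \<noteq> 0) \<and> (\<forall>q. f q \<noteq> 0 \<longrightarrow> good V U a E q N))"
  using assms(1)
proof (induction "card U + card E" arbitrary: U E rule: less_induct)
  case less
  interpret G: pinned_graph V U B a b0 E by (rule less.prems)
  have EP: "E \<subseteq> Pow V"
  proof
    fix e assume "e \<in> E"
    then obtain x y where "e = {x, y}" "x \<in> U \<union> B" "y \<in> U \<union> B" using G.edge by blast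
    then show "e \<in> Pow V" using G.UV G.BV by auto
  qed
  then have finE: "finite E" using G.finite_V finite_subset by blast
  show ?case
  proof (cases "\<forall>e\<in>E. \<forall>x\<in>e \<inter> U. e = {x, b0}")
    case True
    have nb: "{x, y} \<in> E \<Longrightarrow> x \<in> U \<Longrightarrow> y = b0" for x y
      using True G.edgeD[of x y] by (auto simp: doubleton_eq_iff)
    let ?p = "[:-1, 1:] ^ card U :: int poly"
    have "card (pinned_colourings U \<kappa> E n) = (n - 1) ^ card U" if n: "\<kappa> ` B \<subseteq> {..<n}" for n
    proof -
      have b0U: "b0 \<notin> U" using G.b0 G.disj by auto
      have "pinned_colourings U \<kappa> E n = U \<rightarrow>\<^sub>E ({..<n} - {\<kappa> b0})"
      proof (intro equalityI subsetI)
        fix c assume c: "c \<in> pinned_colourings U \<kappa> E n"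
        then have "c x \<noteq> \<kappa> b0" if "x \<in> U" for x
          using G.pinned[OF that] that b0U by (force simp: pinned_colourings_def ext_col_def)
        then show "c \<in> U \<rightarrow>\<^sub>E ({..<n} - {\<kappa> b0})" using c by (auto simp: pinned_colourings_def PiE_iff)
      next
        fix c assume c: "c \<in> U \<rightarrow>\<^sub>E ({..<n} - {\<kappa> b0})"
        have "ext_col U \<kappa> c x \<noteq> ext_col U \<kappa> c y" if e: "{x, y} \<in> E" for x y
        proof -
          consider "x \<in> U" | "y \<in> U" | "x \<in> B" "y \<in> B" using G.edgeD[OF e] by auto
          then show ?thesis
          proof cases
            case 1 then show ?thesis using nb[OF e] c b0U by (auto simp: ext_col_def PiE_iff)
          next
            case 2 then show ?thesis using nb[of y x] e c b0U by (auto simp: ext_col_def PiE_iff insert_commute)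
          next
            case 3
            then have "x \<notin> U" "y \<notin> U" using G.disj by auto
            then show ?thesis using 3 \<kappa> G.edgeD[OF e] by (auto simp: ext_col_def inj_on_def)
          qed
        qed
        then show "c \<in> pinned_colourings U \<kappa> E n" using c by (auto simp: pinned_colourings_def PiE_iff)
      qed
      moreover have "\<kappa> b0 < n" using n G.b0 by auto
      ultimately show ?thesis using G.finite_U by (simp add: card_PiE)
    qed
    moreover have "n \<ge> 1" if "\<kappa> ` B \<subseteq> {..<n}" for n using that G.b0 by force
    ultimately have p: "\<forall>n. \<kappa> ` B \<subseteq> {..<n} \<longrightarrow> poly ?p (int n) = int (card (pinned_colourings U \<kappa> E n))"
      by (simp add: poly_power of_nat_diff algebra_simps)
    have p1: "poly ?p 1 = 0 ^ card U" by (simp add: poly_power)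
    show ?thesis
    proof (cases "U = {}")
      case U: True
      have "crit V U a E q = {a}" for q
      proof -
        have "a x \<noteq> a y" if "{x, y} \<in> E" for x y
          using G.edgeD[OF that] U G.inj_a by (auto dest: inj_onD)
        then show ?thesis using U by (auto simp: crit_def)
      qed
      then have "good V U a E q 1" for q using U by (simp add: good_def nondegenerate_def)
      then have gen: "\<exists>f. mpoly_fun f \<and> (\<exists>q. f q \<noteq> 0) \<and> (\<forall>q. f q \<noteq> 0 \<longrightarrow> good V U a E q 1)"
        by (intro exI[of _ "\<lambda>q. 1"]) (auto intro: mpoly_fun.const)
      show ?thesis
      proof (rule exI[of _ ?p], rule exI[of _ 1], intro conjI)
        show "int 1 = (-1) ^ card U * poly ?p 1" using p1 U by simp
      qed (rule p gen)+
    next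
      case False
      then obtain x where x: "x \<in> U" by blast
      have "crit V U a E q = {}" if q: "q {x, b0} \<noteq> 0" for q
      proof -
        have "lapl V E q w x \<noteq> 0" if w: "w \<in> crit V U a E q" for w
        proof -
          have "b0 \<in> V" using G.b0 G.BV by blast
          then have "{y \<in> V. {x, y} \<in> E} = {b0}" using nb[OF _ x] G.pinned[OF x] by blast
          then have "lapl V E q w x = q {x, b0} / (w x - w b0)" by (simp add: G.lapl_neighbours)
          moreover have "w x \<noteq> w b0" using w G.pinned[OF x] unfolding crit_def by blast
          ultimately show ?thesis using q by simp
        qed
        moreover have "lapl V E q w x = 0" if "w \<in> crit V U a E q" for w
          using that x by (simp add: crit_def)
        ultimately show ?thesis by blast
      qed
      then have "good V U a E q 0" if "q {x, b0} \<noteq> 0" for q using that by (simp add: good_def)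
      moreover have "\<exists>q. q {x, b0} \<noteq> (0 :: complex)" by (rule exI[of _ "\<lambda>e. 1"]) simp
      ultimately have gen: "\<exists>f. mpoly_fun f \<and> (\<exists>q. f q \<noteq> 0) \<and> (\<forall>q. f q \<noteq> 0 \<longrightarrow> good V U a E q 0)"
        by (intro exI[of _ "\<lambda>q. q {x, b0}"] conjI allI impI mpoly_fun.coord)
      show ?thesis
      proof (rule exI[of _ ?p], rule exI[of _ 0], intro conjI)
        show "int 0 = (-1) ^ card U * poly ?p 1" using p1 False G.finite_U by (simp add: card_gt_0_iff)
      qed (rule p gen)+
    qed
  next
    case False
    then obtain e u where e: "e \<in> E" "u \<in> e" "u \<in> U" "e \<noteq> {u, b0}" by blast
    obtain v where v: "e = {u, v}" "u \<noteq> v" "v \<in> U \<union> B"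
      using G.edge[OF e(1)] e(2) by (auto simp: doubleton_eq_iff)
    have vb0: "v \<noteq> b0" using e v by auto
    define E' where "E' = E - {e}"
    have ins: "insert {u, v} E' = E" using e v by (auto simp: E'_def)
    have pin': "{x, b0} \<in> E'" if "x \<in> U" for x
    proof -
      have "u \<noteq> b0" using e G.b0 G.disj by auto
      then have "{x, b0} \<noteq> e" using v vb0 by (auto simp: doubleton_eq_iff)
      then show ?thesis using G.pinned[OF that] by (simp add: E'_def)
    qed
    interpret C: contraction V U B a b0 E' u v
    proof unfold_locales
      show "\<exists>x y. e = {x, y} \<and> x \<noteq> y \<and> x \<in> U \<union> B \<and> y \<in> U \<union> B" if "e \<in> E'" for e
        using that G.edge by (simp add: E'_def)
      show "{u, v} \<notin> E'" using v by (simp add: E'_def)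
    qed (use G.finite_V G.UV G.BV G.disj G.b0 G.inj_a G.a_nz pin' e v vb0 in auto)
    have finE': "finite E'" using finE by (simp add: E'_def)
    have cE': "card E' < card E" unfolding E'_def by (rule card_Diff1_less[OF finE e(1)])
    have cU: "card (U - {u}) < card U" by (rule card_Diff1_less[OF G.finite_U e(3)])
    have "card U + card E' < card U + card E" using cE' by simp
    from less.hyps[OF this C.pinned_graph_axioms]
    obtain p1 N1 f1 where 1: "\<forall>n. \<kappa> ` B \<subseteq> {..<n} \<longrightarrow> poly p1 (int n) = int (card (pinned_colourings U \<kappa> E' n))"
      "int N1 = (-1) ^ card U * poly p1 1"
      "mpoly_fun f1" "\<exists>q. f1 q \<noteq> 0" "\<And>q. f1 q \<noteq> 0 \<Longrightarrow> good V U a E' q N1" by blast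
    have "{u} \<notin> E'" using C.edgeD[of u u] by auto
    then have "card (U - {u}) + card (contr_edges u v E') < card U + card E"
      using cU cE' card_contr_edges_le[OF finE', of u v] by linarith
    from less.hyps[OF this C.pinned_graph_contr]
    obtain p2 N2 f2 where 2: "\<forall>n. \<kappa> ` B \<subseteq> {..<n} \<longrightarrow> poly p2 (int n) = int (card (pinned_colourings (U - {u}) \<kappa> (contr_edges u v E') n))"
      "int N2 = (-1) ^ card (U - {u}) * poly p2 1"
      "mpoly_fun f2" "\<exists>q. f2 q \<noteq> 0" "\<And>q. f2 q \<noteq> 0 \<Longrightarrow> good V (U - {u}) a (contr_edges u v E') q N2" by blast
    have "\<forall>n. \<kappa> ` B \<subseteq> {..<n} \<longrightarrow> poly (p1 - p2) (int n) = int (card (pinned_colourings U \<kappa> E n))"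
      using 1(1) 2(1) C.card_pinned_colourings[of \<kappa>] by (simp add: ins)
    moreover have "int (N1 + N2) = (-1) ^ card U * poly (p1 - p2) 1"
    proof -
      obtain m where m: "card (U - {u}) = m" by blast
      have "card U = Suc m" using card.remove[OF G.finite_U e(3)] unfolding m .
      then show ?thesis using 1(2) 2(2) unfolding m by (simp add: algebra_simps)
    qed
    moreover have "\<exists>f. mpoly_fun f \<and> (\<exists>q. f q \<noteq> 0) \<and> (\<forall>q. f q \<noteq> 0 \<longrightarrow> good V U a E q (N1 + N2))"
      using C.good_generic_insert_edge[OF 1(3-5) 2(3-5)] unfolding ins .
    ultimately show ?thesis by blast
  qed
qed

section \<open>Sending a boundary vertex to infinity\<close>

lemma polynomial_fun_Re_Im:
  assumes "mpoly_fun f"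
  shows "polynomial_fun I (\<lambda>x. Re (f (\<lambda>e. complex_of_real (if e \<in> I then x e else r e)))) \<and>
         polynomial_fun I (\<lambda>x. Im (f (\<lambda>e. complex_of_real (if e \<in> I then x e else r e))))"
  using assms
proof induction
  case (const c) show ?case by (auto intro: polynomial_fun.const)
next
  case (coord i) show ?case by (cases "i \<in> I") (auto intro: polynomial_fun.intros)
next
  case (add f g) then show ?case by (auto intro: polynomial_fun.add)
next
  case (mult f g)
  let ?F = "\<lambda>x. f (\<lambda>e. complex_of_real (if e \<in> I then x e else r e))"
  let ?G = "\<lambda>x. g (\<lambda>e. complex_of_real (if e \<in> I then x e else r e))"
  have parts: "polynomial_fun I (\<lambda>x. Re (?F x))" "polynomial_fun I (\<lambda>x. Im (?F x))"
    "polynomial_fun I (\<lambda>x. Re (?G x))" "polynomial_fun I (\<lambda>x. Im (?G x))"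
    using mult.IH by blast+
  have "polynomial_fun I (\<lambda>x. Re (?F x) * Re (?G x) + -1 * (Im (?F x) * Im (?G x)))"
    by (intro polynomial_fun.add polynomial_fun.mult polynomial_fun.const parts)
  moreover have "polynomial_fun I (\<lambda>x. Re (?F x) * Im (?G x) + Im (?F x) * Re (?G x))"
    by (intro polynomial_fun.add polynomial_fun.mult parts)
  ultimately show ?case by (simp only: times_complex.simps mult_minus1 diff_conv_add_uminus conj_absorb)
qed

text \<open>
  The moving vertices cannot use the colours of the pins, so they are coloured with \<open>n - card B\<close> colours.
\<close>

lemma card_pinned_colourings_full:
  assumes U: "finite U" and B: "finite B" and disj: "U \<inter> B = {}"
    and \<kappa>: "bij_betw \<kappa> B {..<card B}" and n: "card B \<le> n"
    and full: "\<And>x b. x \<in> U \<Longrightarrow> b \<in> B \<Longrightarrow> {x, b} \<in> E"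
    and E: "\<And>x y. {x, y} \<in> E \<Longrightarrow> x \<in> U \<union> B \<and> y \<in> U \<union> B \<and> x \<noteq> y"
    and F: "\<And>x y. x \<in> U \<Longrightarrow> y \<in> U \<Longrightarrow> {x, y} \<in> F \<longleftrightarrow> {x, y} \<in> E"
  shows "card (pinned_colourings U \<kappa> E n) = card (proper_colourings U F (n - card B))"
proof -
  let ?m = "card B"
  have \<kappa>lt: "\<kappa> b < ?m" if "b \<in> B" for b using \<kappa> that by (auto simp: bij_betw_def)
  have ge: "?m \<le> c x" if c: "c \<in> pinned_colourings U \<kappa> E n" and x: "x \<in> U" for c x
  proof (rule ccontr)
    assume "\<not> ?thesis"
    then have "c x \<in> \<kappa> ` B" using \<kappa> by (auto simp: bij_betw_def)
    then obtain b where b: "b \<in> B" "c x = \<kappa> b" by blast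
    then have "ext_col U \<kappa> c x = ext_col U \<kappa> c b" using x disj by (auto simp: ext_col_def)
    then show False using c full[OF x b(1)] by (auto simp: pinned_colourings_def)
  qed
  have "bij_betw (\<lambda>c. \<lambda>x\<in>U. c x - ?m) (pinned_colourings U \<kappa> E n) (proper_colourings U F (n - ?m))"
  proof (rule bij_betw_byWitness[where f' = "\<lambda>d. \<lambda>x\<in>U. d x + ?m"])
    show "\<forall>c\<in>pinned_colourings U \<kappa> E n. (\<lambda>x\<in>U. (\<lambda>x\<in>U. c x - ?m) x + ?m) = c"
    proof
      fix c assume c: "c \<in> pinned_colourings U \<kappa> E n"
      then have "c \<in> extensional U" by (simp add: pinned_colourings_def PiE_iff)
      then show "(\<lambda>x\<in>U. (\<lambda>x\<in>U. c x - ?m) x + ?m) = c"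
        using ge[OF c] by (auto simp: extensional_def restrict_def fun_eq_iff)
    qed
    show "\<forall>d\<in>proper_colourings U F (n - ?m). (\<lambda>x\<in>U. (\<lambda>x\<in>U. d x + ?m) x - ?m) = d"
      by (auto simp: proper_colourings_def PiE_iff extensional_def restrict_def fun_eq_iff)
    show "(\<lambda>c. \<lambda>x\<in>U. c x - ?m) ` pinned_colourings U \<kappa> E n \<subseteq> proper_colourings U F (n - ?m)"
    proof
      fix d assume "d \<in> (\<lambda>c. \<lambda>x\<in>U. c x - ?m) ` pinned_colourings U \<kappa> E n"
      then obtain c where c: "c \<in> pinned_colourings U \<kappa> E n" and d: "d = (\<lambda>x\<in>U. c x - ?m)" by blast
      have "d \<in> U \<rightarrow>\<^sub>E {..<n - ?m}"
      proof (rule PiE_I)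
        fix x assume x: "x \<in> U"
        have "c x < n" using c x by (auto simp: pinned_colourings_def PiE_iff)
        then show "d x \<in> {..<n - ?m}" using ge[OF c x] x by (simp add: d)
      qed (simp add: d)
      moreover have "d x \<noteq> d y" if "x \<in> U" "y \<in> U" "{x, y} \<in> F" for x y
      proof -
        have "ext_col U \<kappa> c x \<noteq> ext_col U \<kappa> c y" using that F c by (auto simp: pinned_colourings_def)
        then show ?thesis using that ge[OF c that(1)] ge[OF c that(2)] by (simp add: d ext_col_def)
      qed
      ultimately show "d \<in> proper_colourings U F (n - ?m)" by (auto simp: proper_colourings_def)
    qed
    show "(\<lambda>d. \<lambda>x\<in>U. d x + ?m) ` proper_colourings U F (n - ?m) \<subseteq> pinned_colourings U \<kappa> E n"
    proof
      fix c assume "c \<in> (\<lambda>d. \<lambda>x\<in>U. d x + ?m) ` proper_colourings U F (n - ?m)"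
      then obtain d where d: "d \<in> proper_colourings U F (n - ?m)" and c: "c = (\<lambda>x\<in>U. d x + ?m)" by blast
      have lt: "d x < n - ?m" if "x \<in> U" for x using d that by (auto simp: proper_colourings_def PiE_iff)
      have "c \<in> U \<rightarrow>\<^sub>E {..<n}"
      proof (rule PiE_I)
        fix x assume "x \<in> U" then show "c x \<in> {..<n}" using lt[of x] n by (simp add: c)
      qed (simp add: c)
      moreover have "ext_col U \<kappa> c x \<noteq> ext_col U \<kappa> c y" if e: "{x, y} \<in> E" for x y
      proof -
        have xy: "x \<in> U \<union> B" "y \<in> U \<union> B" "x \<noteq> y" using E[OF e] by auto
        have cU: "ext_col U \<kappa> c x = d x + ?m" if "x \<in> U" for x using that by (simp add: ext_col_def c)
        have cB: "ext_col U \<kappa> c x = \<kappa> x" if "x \<in> B" for x using that disj by (auto simp: ext_col_def)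
        consider "x \<in> U" "y \<in> U" | "x \<in> U" "y \<in> B" | "x \<in> B" "y \<in> U" | "x \<in> B" "y \<in> B" using xy by blast
        then show ?thesis
        proof cases
          case 1 then show ?thesis using d e F[of x y] cU by (auto simp: proper_colourings_def)
        next
          case 2 then show ?thesis using cU[of x] cB[of y] \<kappa>lt[of y] by simp
        next
          case 3 then show ?thesis using cU[of y] cB[of x] \<kappa>lt[of x] by simp
        next
          case 4 then show ?thesis using cB[of x] cB[of y] \<kappa> xy(3) by (auto simp: bij_betw_def inj_on_def)
        qed
      qed
      ultimately show "c \<in> pinned_colourings U \<kappa> E n" by (simp add: pinned_colourings_def)
    qed
  qed
  then show ?thesis by (rule bij_betw_same_card)
qed

lemma moebius_difference:
  fixes x y c :: complex
  assumes "x \<noteq> c" "y \<noteq> c" "x \<noteq> y"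
  shows "1 / (x - y) = 1 / (x - c) - (1 / (x - c))\<^sup>2 / (1 / (x - c) - 1 / (y - c))"
proof -
  have nz: "x - c \<noteq> 0" "y - c \<noteq> 0" "y - x \<noteq> 0" "x - y \<noteq> 0" using assms by auto
  have "1 / (x - c) - 1 / (y - c) = (y - x) / ((x - c) * (y - c))" using nz by (simp add: field_simps)
  then have "(1 / (x - c))\<^sup>2 / (1 / (x - c) - 1 / (y - c)) = (y - c) / ((x - c) * (y - x))"
    using nz by (simp add: power2_eq_square)
  also have "1 / (x - c) - \<dots> = 1 / (x - y)"
    using nz by (simp add: divide_simps) (simp add: algebra_simps)
  finally show ?thesis by simp
qed

text \<open>
  The vertex \<open>\<beta>\<close> is sent to infinity, and \<open>b0\<close> is one of the remaining boundary vertices.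
\<close>

locale moebius_setting = graph_with_boundary V E Vb for V :: "'a set" and E :: "'a set set" and Vb :: "'a set" +
  fixes zb :: "'a \<Rightarrow> complex" and \<beta> b0 :: 'a
  assumes full: "\<And>u b. u \<in> V - Vb \<Longrightarrow> b \<in> Vb \<Longrightarrow> {u, b} \<in> E"
    and inj: "inj_on zb Vb" and \<beta>: "\<beta> \<in> Vb" and b0: "b0 \<in> Vb" and ne: "b0 \<noteq> \<beta>"
begin

definition "int_verts = V - Vb"
definition "pins = Vb - {\<beta>}"
definition "affine_edges = {e \<in> E. \<beta> \<notin> e}"
definition "pin_pos x = 1 / (zb x - zb \<beta>)"

lemma edge_facts:
  assumes "{x, y} \<in> E"
  shows "x \<in> V" "y \<in> V" "x \<noteq> y"
proof -
  show "x \<in> V" "y \<in> V" using edge_subset[OF assms] by auto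
  show "x \<noteq> y" using edge_card[OF assms] by auto
qed

lemma affine_edges_iff: "{x, y} \<in> affine_edges \<longleftrightarrow> {x, y} \<in> E \<and> x \<noteq> \<beta> \<and> y \<noteq> \<beta>"
  by (auto simp: affine_edges_def)

lemma pinned: "pinned_graph V int_verts pins pin_pos b0 affine_edges"
proof
  show "inj_on pin_pos pins"
  proof (rule inj_onI)
    fix x y assume "x \<in> pins" "y \<in> pins" "pin_pos x = pin_pos y"
    then show "x = y" using inj by (auto simp: pins_def pin_pos_def dest: inj_onD)
  qed
  show "pin_pos b \<noteq> 0" if "b \<in> pins" for b
    using that inj \<beta> by (auto simp: pins_def pin_pos_def dest: inj_onD)
  show "\<exists>x y. e = {x, y} \<and> x \<noteq> y \<and> x \<in> int_verts \<union> pins \<and> y \<in> int_verts \<union> pins" if e: "e \<in> affine_edges" for e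
  proof -
    have "e \<in> E" "\<beta> \<notin> e" using e by (auto simp: affine_edges_def)
    then obtain x y where "e = {x, y}" "x \<noteq> y" using edge_card card_2_iff by metis
    then show ?thesis using edge_facts[of x y] \<open>e \<in> E\<close> \<open>\<beta> \<notin> e\<close> by (intro exI[of _ x] exI[of _ y]) (auto simp: int_verts_def pins_def)
  qed
  show "{x, b0} \<in> affine_edges" if "x \<in> int_verts" for x
    using that full[of x b0] b0 ne \<beta> by (auto simp: affine_edges_iff int_verts_def)
qed (use finite_V boundary_subset b0 ne in \<open>auto simp: int_verts_def pins_def\<close>)

sublocale G: pinned_graph V int_verts pins pin_pos b0 affine_edges by (rule pinned)

lemma neighbours_int:
  assumes "u \<in> int_verts"
  shows "neighbours E u = insert \<beta> {y \<in> V. {u, y} \<in> affine_edges}" "\<beta> \<notin> {y \<in> V. {u, y} \<in> affine_edges}"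
  using assms full[of u \<beta>] \<beta> edge_facts by (auto simp: neighbours_def affine_edges_iff int_verts_def)

text \<open>
  Write each term as in \<open>moebius_difference\<close>. The parts linear in \<open>w u\<close> add up to the sum of all weights at \<open>u\<close>,
  including the one towards \<open>\<beta>\<close>, times \<open>w u\<close>, and hence to zero.
\<close>

lemma lapl_moebius:
  fixes q :: "'a set \<Rightarrow> real"
  assumes u: "u \<in> int_verts" and q: "(\<Sum>v\<in>neighbours E u. q {u, v}) = 0"
    and zu: "z u \<noteq> z \<beta>"
    and zy: "\<And>y. y \<in> V \<Longrightarrow> {u, y} \<in> affine_edges \<Longrightarrow> z y \<noteq> z \<beta> \<and> z u \<noteq> z y \<and> w y = 1 / (z y - z \<beta>)"
    and wu: "w u = 1 / (z u - z \<beta>)"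
  shows "(\<Sum>v\<in>neighbours E u. complex_of_real (q {u, v}) / (z u - z v)) =
     - (w u)\<^sup>2 * lapl V affine_edges (\<lambda>e. complex_of_real (q e)) w u"
proof -
  let ?N = "{y \<in> V. {u, y} \<in> affine_edges}"
  let ?q = "\<lambda>v. complex_of_real (q {u, v})"
  have fin: "finite ?N" using finite_V by simp
  note N = neighbours_int[OF u]
  have "complex_of_real (\<Sum>v\<in>neighbours E u. q {u, v}) = 0" using q by simp
  then have bal: "?q \<beta> + (\<Sum>v\<in>?N. ?q v) = 0" unfolding N(1) using fin N(2) by simp
  have "(\<Sum>v\<in>neighbours E u. ?q v / (z u - z v)) = ?q \<beta> * w u + (\<Sum>v\<in>?N. ?q v / (z u - z v))"
    unfolding N(1) using fin N(2) by (simp add: wu)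
  also have "(\<Sum>v\<in>?N. ?q v / (z u - z v)) = (\<Sum>v\<in>?N. ?q v * w u - (w u)\<^sup>2 * (?q v / (w u - w v)))"
  proof (rule sum.cong[OF refl])
    fix v assume "v \<in> ?N"
    then have v: "z v \<noteq> z \<beta>" "z u \<noteq> z v" "w v = 1 / (z v - z \<beta>)" using zy by auto
    have "?q v / (z u - z v) = ?q v * (1 / (z u - z v))" by simp
    also have "\<dots> = ?q v * (w u - (w u)\<^sup>2 / (w u - w v))"
      unfolding moebius_difference[OF zu v(1,2)] wu v(3) ..
    finally show "?q v / (z u - z v) = ?q v * w u - (w u)\<^sup>2 * (?q v / (w u - w v))"
      by (simp add: right_diff_distrib)
  qed
  also have "?q \<beta> * w u + \<dots> = (?q \<beta> + (\<Sum>v\<in>?N. ?q v)) * w u - (w u)\<^sup>2 * (\<Sum>v\<in>?N. ?q v / (w u - w v))"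
    by (simp add: sum_subtractf sum_distrib_left sum_distrib_right distrib_right)
  finally show ?thesis unfolding bal G.lapl_neighbours by simp
qed

text \<open>
  A critical point with \<open>w x = 0\<close> would correspond to a realization with \<open>z x = \<infinity>\<close>; these are excluded
  by assumption, as they do not occur for good weights.
\<close>

lemma bij_realizations:
  assumes q: "q \<in> balanced_weights V E Vb"
    and nz: "\<And>w x. w \<in> crit V int_verts pin_pos affine_edges (\<lambda>e. complex_of_real (q e)) \<Longrightarrow> x \<in> int_verts \<Longrightarrow> w x \<noteq> 0"
  shows "bij_betw (\<lambda>z x. if x \<in> int_verts then 1 / (z x - zb \<beta>) else pin_pos x)
     (realizations V E Vb zb q) (crit V int_verts pin_pos affine_edges (\<lambda>e. complex_of_real (q e)))"
proof (rule bij_betw_byWitness[where f' =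
      "\<lambda>w x. if x \<in> int_verts then zb \<beta> + 1 / w x else if x \<in> V then zb x else undefined"])
  let ?\<phi> = "\<lambda>z x. if x \<in> int_verts then 1 / (z x - zb \<beta>) else pin_pos x"
  let ?\<psi> = "\<lambda>w x. if x \<in> int_verts then zb \<beta> + 1 / w x else if x \<in> V then zb x else undefined"
  let ?C = "crit V int_verts pin_pos affine_edges (\<lambda>e. complex_of_real (q e))"
  have bal: "(\<Sum>v\<in>neighbours E u. q {u, v}) = 0" if "u \<in> int_verts" for u
    using q that by (auto simp: balanced_weights_def int_verts_def)
  have zbne: "zb x \<noteq> zb \<beta>" if "x \<in> Vb" "x \<noteq> \<beta>" for x
    using inj \<beta> that by (auto dest: inj_onD)
  have VbI: "x \<in> Vb" if "x \<in> V" "x \<notin> int_verts" for x using that by (simp add: int_verts_def)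
  have \<beta>V: "\<beta> \<in> V" "\<beta> \<notin> int_verts" using \<beta> boundary_subset by (auto simp: int_verts_def)
  show "\<forall>z\<in>realizations V E Vb zb q. ?\<psi> (?\<phi> z) = z"
  proof
    fix z assume z: "z \<in> realizations V E Vb zb q"
    show "?\<psi> (?\<phi> z) = z"
    proof
      fix x
      show "?\<psi> (?\<phi> z) x = z x"
        using z VbI[of x] boundary_subset
        by (auto simp: realizations_def PiE_iff extensional_def int_verts_def)
    qed
  qed
  show "\<forall>w\<in>?C. ?\<phi> (?\<psi> w) = w"
    by (auto simp: crit_def fun_eq_iff)
  show "?\<phi> ` realizations V E Vb zb q \<subseteq> ?C"
  proof
    fix w assume "w \<in> ?\<phi> ` realizations V E Vb zb q"
    then obtain z where z: "z \<in> realizations V E Vb zb q" and w: "w = ?\<phi> z" by blast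
    have zB: "\<And>b. b \<in> Vb \<Longrightarrow> z b = zb b" and zE: "\<And>u v. {u, v} \<in> E \<Longrightarrow> z u \<noteq> z v"
      and zeq: "\<And>u. u \<in> int_verts \<Longrightarrow> (\<Sum>v\<in>neighbours E u. complex_of_real (q {u, v}) / (z u - z v)) = 0"
      using z by (auto simp: realizations_def int_verts_def)
    have z\<beta>: "z \<beta> = zb \<beta>" using zB \<beta> .
    have zne: "z x \<noteq> z \<beta>" if "x \<in> V" "x \<noteq> \<beta>" for x
    proof (cases "x \<in> int_verts")
      case True then show ?thesis using zE[of x \<beta>] full[of x \<beta>] \<beta> by (simp add: int_verts_def)
    next
      case False then show ?thesis using zbne[of x] zB[of x] VbI[of x] that z\<beta> by simp
    qed
    have wx: "w x = 1 / (z x - z \<beta>)" if "x \<in> V" for x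
      using that zB VbI[of x] z\<beta> by (auto simp: w pin_pos_def)
    have "lapl V affine_edges (\<lambda>e. complex_of_real (q e)) w u = 0" if u: "u \<in> int_verts" for u
    proof -
      have uV: "u \<in> V" "u \<noteq> \<beta>" using u \<beta> by (auto simp: int_verts_def)
      have "- (w u)\<^sup>2 * lapl V affine_edges (\<lambda>e. complex_of_real (q e)) w u = 0"
        using lapl_moebius[of u q z w, OF u bal[OF u] zne[OF uV] _ wx[OF uV(1)]] zeq[OF u] zne zE wx
        by (simp add: affine_edges_iff)
      moreover have "w u \<noteq> 0" using wx[OF uV(1)] zne[OF uV] by simp
      ultimately show ?thesis by simp
    qed
    moreover have "w x \<noteq> w y" if e: "{x, y} \<in> affine_edges" for x y
    proof -
      have e': "{x, y} \<in> E" "x \<noteq> \<beta>" "y \<noteq> \<beta>" using e by (auto simp: affine_edges_iff)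
      then show ?thesis using wx zE[OF e'(1)] edge_facts[OF e'(1)] by auto
    qed
    ultimately show "w \<in> ?C" by (auto simp: crit_def w)
  qed
  show "?\<psi> ` ?C \<subseteq> realizations V E Vb zb q"
  proof
    fix z assume "z \<in> ?\<psi> ` ?C"
    then obtain w where w: "w \<in> ?C" and z: "z = ?\<psi> w" by blast
    have wU: "\<And>x. x \<notin> int_verts \<Longrightarrow> w x = pin_pos x" and wE: "\<And>x y. {x, y} \<in> affine_edges \<Longrightarrow> w x \<noteq> w y"
      and wl: "\<And>x. x \<in> int_verts \<Longrightarrow> lapl V affine_edges (\<lambda>e. complex_of_real (q e)) w x = 0"
      using w by (auto simp: crit_def)
    have zB: "z b = zb b" if "b \<in> Vb" for b using that boundary_subset by (auto simp: z int_verts_def)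
    have z\<beta>: "z \<beta> = zb \<beta>" using zB \<beta> .
    have zne: "z x \<noteq> z \<beta>" if "x \<in> V" "x \<noteq> \<beta>" for x
    proof (cases "x \<in> int_verts")
      case True then show ?thesis unfolding z\<beta> using nz[OF w True] by (simp add: z)
    next
      case False then show ?thesis using zbne[of x] zB[of x] VbI[of x] that z\<beta> by simp
    qed
    have wx: "w x = 1 / (z x - z \<beta>)" if "x \<in> V" for x
    proof (cases "x \<in> int_verts")
      case True then show ?thesis unfolding z\<beta> by (simp add: z)
    next
      case False then show ?thesis using wU zB[OF VbI[OF that]] z\<beta> by (simp add: pin_pos_def)
    qed
    have zE: "z x \<noteq> z y" if e: "{x, y} \<in> E" for x y
    proof -
      consider "x = \<beta>" | "y = \<beta>" | "{x, y} \<in> affine_edges" using e by (auto simp: affine_edges_iff)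
      then show ?thesis
      proof cases
        case 1 then show ?thesis using zne[of y] edge_facts[OF e] by metis
      next
        case 2 then show ?thesis using zne[of x] edge_facts[OF e] by metis
      next
        case 3 then show ?thesis using wE[OF 3] wx edge_facts[OF e] by metis
      qed
    qed
    have "(\<Sum>v\<in>neighbours E u. complex_of_real (q {u, v}) / (z u - z v)) = 0" if u: "u \<in> int_verts" for u
    proof -
      have uV: "u \<in> V" "u \<noteq> \<beta>" using u \<beta> by (auto simp: int_verts_def)
      show ?thesis
        using lapl_moebius[of u q z w, OF u bal[OF u] zne[OF uV] _ wx[OF uV(1)]] wl[OF u] zne zE wx
        by (simp add: affine_edges_iff)
    qed
    moreover have "z \<in> V \<rightarrow>\<^sub>E UNIV" using \<beta>V by (auto simp: z int_verts_def extensional_def PiE_iff)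
    ultimately show "z \<in> realizations V E Vb zb q"
      using zB zE by (auto simp: realizations_def int_verts_def)
  qed
qed

text \<open>
  The balance condition at \<open>u\<close> determines the weight of the edge to \<open>\<beta>\<close> and imposes nothing else.
\<close>

lemma extend_to_balanced:
  "\<exists>q\<in>balanced_weights V E Vb. \<forall>e\<in>affine_edges. q e = r e"
proof -
  define other where "other e = the_elem (e - {\<beta>})" for e
  define q where "q e = (if e \<in> affine_edges then r e else if e \<in> E then
      - (\<Sum>y\<in>{y \<in> V. {other e, y} \<in> affine_edges}. r {other e, y}) else undefined)" for e
  have "(\<Sum>v\<in>neighbours E u. q {u, v}) = 0" if u: "u \<in> int_verts" for u
  proof -
    have u\<beta>: "u \<noteq> \<beta>" "{u, \<beta>} \<in> E" using u full[of u \<beta>] \<beta> by (auto simp: int_verts_def)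
    have "{u, \<beta>} - {\<beta>} = {u}" using u\<beta> by auto
    then have "other {u, \<beta>} = u" by (simp add: other_def)
    moreover have "{u, \<beta>} \<notin> affine_edges" by (simp add: affine_edges_iff)
    ultimately have "q {u, \<beta>} = - (\<Sum>y\<in>{y \<in> V. {u, y} \<in> affine_edges}. r {u, y})"
      using u\<beta> by (simp add: q_def)
    then show ?thesis unfolding neighbours_int(1)[OF u] using neighbours_int(2)[OF u] finite_V by (simp add: q_def)
  qed
  moreover have "q e = undefined" if "e \<notin> E" for e using that by (simp add: q_def affine_edges_def)
  ultimately have "q \<in> balanced_weights V E Vb"
    by (auto simp: balanced_weights_def int_verts_def PiE_iff extensional_def)
  then show ?thesis by (intro bexI[of _ q]) (simp add: q_def)
qed

end

theorem theorem7:
  fixes V Vb :: "'a set" and E :: "'a set set" and zb :: "'a \<Rightarrow> complex" and k :: nat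
  assumes "graph_with_boundary V E Vb"
    and "card Vb = k" and "k \<ge> 2"
    and "\<And>u b. u \<in> V - Vb \<Longrightarrow> b \<in> Vb \<Longrightarrow> {u, b} \<in> E"
    and "inj_on zb Vb"
  shows "holds_generically E (balanced_weights V E Vb)
    (\<lambda>q. finite (realizations V E Vb zb q) \<and>
      int (card (realizations V E Vb zb q)) =
        (-1) ^ card (V - Vb) *
        poly (chromatic_polynomial (V - Vb) (induced_edges E (V - Vb))) (- int k + 2))"
proof -
  obtain \<beta> b0 where \<beta>: "\<beta> \<in> Vb" "b0 \<in> Vb" "b0 \<noteq> \<beta>"
  proof -
    have "finite Vb" using assms(2,3) card_ge_0_finite[of Vb] by simp
    moreover have "\<not> card Vb \<le> Suc 0" using assms(2,3) by simp
    ultimately show thesis using that card_le_Suc0_iff_eq[of Vb] by blast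
  qed
  interpret moebius_setting V E Vb zb \<beta> b0
    using assms \<beta> by (intro moebius_setting.intro moebius_setting_axioms.intro) auto
  have finVb: "finite Vb" using finite_subset[OF boundary_subset finite_V] .
  have finB: "finite pins" and cB: "card pins = k - 1"
    using finVb \<beta> assms(2) by (auto simp: pins_def)
  obtain \<kappa> where \<kappa>: "bij_betw \<kappa> pins {..<card pins}"
    using ex_bij_betw_finite_nat[OF finB] by (auto simp: atLeast0LessThan)
  obtain p N f where p: "\<forall>n. \<kappa> ` pins \<subseteq> {..<n} \<longrightarrow> poly p (int n) = int (card (pinned_colourings int_verts \<kappa> affine_edges n))"
    and N: "int N = (-1) ^ card int_verts * poly p 1"
    and f: "mpoly_fun f" "\<exists>q. f q \<noteq> 0" "\<And>q. f q \<noteq> 0 \<Longrightarrow> good V int_verts pin_pos affine_edges q N"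
    using generic_count[OF pinned bij_betw_imp_inj_on[OF \<kappa>]] by blast
  let ?\<chi> = "chromatic_polynomial (V - Vb) (induced_edges E (V - Vb))"
  \<comment> \<open>With \<open>k - 1\<close> colours used by the pins, \<open>p\<close> is a translate of the chromatic polynomial.\<close>
  have "poly p (int n + int (card pins)) = poly ?\<chi> (int n)" for n
  proof -
    have "\<kappa> ` pins \<subseteq> {..<n + card pins}" using \<kappa> by (auto simp: bij_betw_def)
    then have "poly p (int (n + card pins)) = int (card (pinned_colourings int_verts \<kappa> affine_edges (n + card pins)))"
      using p by blast
    also have "card (pinned_colourings int_verts \<kappa> affine_edges (n + card pins)) =
        card (proper_colourings int_verts (induced_edges E (V - Vb)) (n + card pins - card pins))"
    proof (rule card_pinned_colourings_full[OF G.finite_U finB G.disj \<kappa>])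
      show "{x, b} \<in> affine_edges" if "x \<in> int_verts" "b \<in> pins" for x b
        using that full[of x b] \<beta> by (auto simp: affine_edges_iff int_verts_def pins_def)
      show "{x, y} \<in> induced_edges E (V - Vb) \<longleftrightarrow> {x, y} \<in> affine_edges" if "x \<in> int_verts" "y \<in> int_verts" for x y
        using that \<beta> by (auto simp: induced_edges_def affine_edges_iff int_verts_def)
    qed (use G.edgeD in auto)
    also have "int \<dots> = poly ?\<chi> (int n)"
      using poly_chromatic_polynomial[of "V - Vb"] finite_V by (simp add: int_verts_def)
    finally show ?thesis by simp
  qed
  then have agree: "poly (p \<circ>\<^sub>p [:int (card pins), 1:] - ?\<chi>) (int n) = 0" for n
    by (simp add: poly_pcompose add.commute)
  have "p \<circ>\<^sub>p [:int (card pins), 1:] - ?\<chi> = 0"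
  proof (rule ccontr)
    assume "p \<circ>\<^sub>p [:int (card pins), 1:] - ?\<chi> \<noteq> 0"
    then have "finite {x. poly (p \<circ>\<^sub>p [:int (card pins), 1:] - ?\<chi>) x = 0}" by (rule poly_roots_finite)
    moreover have "range int \<subseteq> {x. poly (p \<circ>\<^sub>p [:int (card pins), 1:] - ?\<chi>) x = 0}" using agree by blast
    ultimately have "finite (range int)" by (rule rev_finite_subset)
    then show False by (simp add: finite_image_iff)
  qed
  then have "poly (p \<circ>\<^sub>p [:int (card pins), 1:]) (- int k + 2) = poly ?\<chi> (- int k + 2)" by simp
  then have "poly p 1 = poly ?\<chi> (- int k + 2)"
    using cB assms(3) by (simp add: poly_pcompose of_nat_diff)
  with N have N\<chi>: "int N = (-1) ^ card (V - Vb) * poly ?\<chi> (- int k + 2)" by (simp add: int_verts_def)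
  obtain r where r: "f (\<lambda>e. complex_of_real (r e)) \<noteq> 0" using real_nonzero[OF f(1)] f(2) by blast
  \<comment> \<open>Only the weights off \<open>\<beta>\<close> are variables; the open set is where the real or the imaginary part of
    \<open>g\<close> does not vanish.\<close>
  define g where "g x = f (\<lambda>e. complex_of_real (if e \<in> affine_edges then x e else r e))" for x
  let ?X = "balanced_weights V E Vb"
  let ?P = "{\<lambda>x. Re (g x), \<lambda>x. Im (g x)}"
  let ?O = "?X - {x \<in> ?X. \<forall>p\<in>?P. p x = 0}"
  have mono: "polynomial_fun E h" if "polynomial_fun affine_edges h" for h
    using that by induction (auto intro: polynomial_fun.intros simp: affine_edges_def)
  have "\<forall>p\<in>?P. polynomial_fun E p"
    using polynomial_fun_Re_Im[OF f(1), of affine_edges r] mono unfolding g_def by blast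
  then have "zariski_open_in E ?X ?O" unfolding zariski_open_in_def by blast
  moreover have "?O \<noteq> {}"
  proof -
    obtain q where q: "q \<in> ?X" "\<forall>e\<in>affine_edges. q e = r e" using extend_to_balanced by blast
    have "(\<lambda>e. complex_of_real (if e \<in> affine_edges then q e else r e)) = (\<lambda>e. complex_of_real (r e))"
      using q(2) by auto
    then have "g q \<noteq> 0" using r by (simp add: g_def)
    then show ?thesis using q(1) by (auto simp: complex_eq_iff)
  qed
  moreover have "\<forall>q\<in>?O. finite (realizations V E Vb zb q) \<and> int (card (realizations V E Vb zb q)) =
        (-1) ^ card (V - Vb) * poly ?\<chi> (- int k + 2)"
  proof
    fix q assume q: "q \<in> ?O"
    have "g q \<noteq> 0" using q by auto
    then have "good V int_verts pin_pos affine_edges (\<lambda>e. complex_of_real (if e \<in> affine_edges then q e else r e)) N"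
      unfolding g_def by (rule f(3))
    then have good: "good V int_verts pin_pos affine_edges (\<lambda>e. complex_of_real (q e)) N"
      by (subst (asm) good_cong[of _ _ _ "\<lambda>e. complex_of_real (q e)"]) auto
    have bij: "bij_betw (\<lambda>z x. if x \<in> int_verts then 1 / (z x - zb \<beta>) else pin_pos x)
     (realizations V E Vb zb q) (crit V int_verts pin_pos affine_edges (\<lambda>e. complex_of_real (q e)))"
    proof (rule bij_realizations)
      show "q \<in> balanced_weights V E Vb" using q by blast
      show "w x \<noteq> 0" if "w \<in> crit V int_verts pin_pos affine_edges (\<lambda>e. complex_of_real (q e))" "x \<in> int_verts" for w x
        using good that unfolding good_def by blast
    qed
    have crit: "finite (crit V int_verts pin_pos affine_edges (\<lambda>e. complex_of_real (q e)))"
      "card (crit V int_verts pin_pos affine_edges (\<lambda>e. complex_of_real (q e))) = N"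
      using good unfolding good_def by blast+
    show "finite (realizations V E Vb zb q) \<and> int (card (realizations V E Vb zb q)) =
        (-1) ^ card (V - Vb) * poly ?\<chi> (- int k + 2)"
      unfolding bij_betw_finite[OF bij] bij_betw_same_card[OF bij] crit(2) using crit(1) N\<chi> by (rule conjI)
  qed
  ultimately show ?thesis
    unfolding holds_generically_def by (intro exI[of _ ?O] conjI)
qed

end
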